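(* The $\mathbb Z$-algebra $E_0$, with $1=\sum_{I\in\Lambda}1_I$, is generated by $u_{I,J}$, $d_{J,I}$ and $1_K$, where $I,J,K\in\Lambda$ with $I\sqsubset J$, subject to the relations: (1) $d_{J,I}u_{I,J}=1_J$ for all $I,J\in\Lambda$ with $I\sqsubset J$; (2) $u_{I,J}u_{J,K}=u_{I,J'}u_{J',K}$ and $d_{K,J}d_{J,I}=d_{K,J'}d_{J',I}$ for all $I,J,J',K\in\Lambda$ with $I\sqsubset J\sqsubset K$ and $I\sqsubset J'\sqsubset K$; (3) $u_{\emptyset,I_1}\cdots u_{I_{m-1},I}\,d_{I,I_{m-1}}\cdots d_{I_2,I_1}d_{I_1,\emptyset}=p_{\{s_l\}}\cdots p_{\{s_2\}}p_{\{s_1\}}$, where $p_{\{s\}}=u_{\emptyset,\{s\}}d_{\{s\},\emptyset}$, for any $I\in\Lambda^*$, any ordering $I_\bullet:\emptyset=I_0\sqsubset I_1\sqsubset\cdots\sqsubset I_m=I$, and any reduced expression $w_{I}=s_l\cdots s_2s_1$ associated with the ordering $I_\bullet$; (4) $u_{I,J}1_J=u_{I,J}=1_Iu_{I,J}$, $d_{J,I}1_I=d_{J,I}=1_Jd_{J,I}$, $1_I^2=1_I$, and $1_I1_J=0$ for $I\neq J$.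
   Context: $(W,S)$ is a Coxeter system with $S$ finite and length function $\ell$. For $I\subseteq S$, $W_I=\langle I\rangle$; $I$ is finitary if $W_I$ is finite, and then $w_I$ is the longest element of $W_I$. $\Lambda$ is the set of finitary subsets (including $\emptyset$), $\Lambda^*=\Lambda\setminus\{\emptyset\}$. $I\sqsubset J$ means $I\subset J$ and $|I|=|J|-1$. $H_q$ is the Hecke algebra over $\mathbb Z[q]$ with basis $T_w$ ($w\in W$), generated by $T_s$ ($s\in S$) with $T_s^2=(q-1)T_s+q$ and the braid relations. For $I\in\Lambda$, $x_I=\sum_{w\in W_I}T_w$ and $\pi(I)=\sum_{w\in W_I}q^{\ell(w)}$. $E_q=\mathrm{End}_{H_q}(\bigoplus_{I\in\Lambda}x_IH_q)$ (right modules) and the 0-Hecke endomorphism algebra is $E_0=E_q\otimes_{\mathbb Z[q]}\mathbb Z$, where $q$ acts on $\mathbb Z$ as $0$. Let $R=\{f/(1+qg):f,g\in\mathbb Z[q]\}$, $RH_q=R\otimes_{\mathbb Z[q]} H_q$, $RE_q=R\otimes_{\mathbb Z[q]}E_q$; then $E_0=\mathbb Z\otimes_R RE_q$ via $R\to\mathbb Z$, $q\mapsto0$. Let $p_I=x_I/\pi(I)$. In $RE_q$: $1_K$ is the identity map on $p_K(RH_q)=x_K(RH_q)$; for $I\sqsubset J$, $u_{I,J}:p_J(RH_q)\to p_I(RH_q)$ is the inclusion and $d_{J,I}:p_I(RH_q)\to p_J(RH_q)$ is left multiplication by $\frac{\pi(I)}{\pi(J)}h_{J,I}$, where $h_{J,I}=\sum_wT_w$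 over those $w\in W_J$ that are of minimal length in $wW_I$ (so $x_J=h_{J,I}x_I$). All are extended by $0$ on the other summands; the same symbols denote their images in $E_0$. A reduced expression $w_I=s_l\cdots s_1$ is associated with the ordering $I_\bullet$ if for every $i$ we have $w_{I_i}=s_{j_i}s_{j_i-1}\cdots s_1$ for some $j_i$. *)

theory Defs
  imports
    "HOL-Algebra.Multiplicative_Group"
    "HOL-Algebra.Generated_Groups"
    "HOL-Algebra.Module"
    "HOL-Algebra.IntRing"
    "HOL-Computational_Algebra.Polynomial"
    "HOL-Computational_Algebra.Fraction_Field"
    "HOL-Library.Poly_Mapping"
begin

section \<open>Coxeter systems\<close>

definition word_prod :: "('w, 'm) monoid_scheme \<Rightarrow> 'w list \<Rightarrow> 'w" where
  "word_prod G ws = foldr (\<otimes>\<^bsub>G\<^esub>) ws \<one>\<^bsub>G\<^esub>"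

text \<open>
  The congruence on words in \<open>S\<close> generated by \<open>(st)\<^sup>m = 1\<close> for all \<open>s, t \<in> S\<close> such that \<open>st\<close> has
  finite order \<open>m\<close> (\<^const>\<open>group.ord\<close> is \<open>0\<close> for elements of infinite order).  The case \<open>s = t\<close> reads
  \<open>ss = 1\<close>, so that no formal inverses are needed and words in \<open>S\<close> modulo this congruence form the
  group with generators \<open>S\<close> and these relations.
\<close>

inductive cox_cong :: "('w, 'm) monoid_scheme \<Rightarrow> 'w set \<Rightarrow> 'w list \<Rightarrow> 'w list \<Rightarrow> bool"
  for G S where
  refl: "cox_cong G S us us"
| sym: "cox_cong G S us vs \<Longrightarrow> cox_cong G S vs us"
| trans: "cox_cong G S us vs \<Longrightarrow> cox_cong G S vs ws \<Longrightarrow> cox_cong G S us ws"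
| rel: "s \<in> S \<Longrightarrow> t \<in> S \<Longrightarrow> m = group.ord G (s \<otimes>\<^bsub>G\<^esub> t) \<Longrightarrow> m > 0 \<Longrightarrow> us \<in> lists S \<Longrightarrow> vs \<in> lists S \<Longrightarrow>
    cox_cong G S (us @ concat (replicate m [s, t]) @ vs) (us @ vs)"

locale coxeter_system = group G for G :: "('w, 'm) monoid_scheme" (structure) +
  fixes S :: "'w set"
  assumes S_carrier: "S \<subseteq> carrier G"
    and S_not_one: "\<one> \<notin> S"
    and S_involution: "s \<in> S \<Longrightarrow> s \<otimes> s = \<one>"
    and S_generates: "generate G S = carrier G"
    and S_presents: "us \<in> lists S \<Longrightarrow> vs \<in> lists S \<Longrightarrow> word_prod G us = word_prod G vs \<Longrightarrow>
      cox_cong G S us vs"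
begin

definition len :: "'w \<Rightarrow> nat" where
  "len w = (LEAST n. \<exists>ws \<in> lists S. length ws = n \<and> word_prod G ws = w)"

definition reduced :: "'w list \<Rightarrow> bool" where
  "reduced ws \<longleftrightarrow> ws \<in> lists S \<and> length ws = len (word_prod G ws)"

abbreviation W :: "'w set \<Rightarrow> 'w set" where
  "W I \<equiv> generate G I"

definition \<Lambda> :: "'w set set" where
  "\<Lambda> = {I. I \<subseteq> S \<and> finite (W I)}"

definition longest :: "'w set \<Rightarrow> 'w" where
  "longest I = (THE w. w \<in> W I \<and> (\<forall>v \<in> W I. len v \<le> len w))"

definition cov :: "'w set \<Rightarrow> 'w set \<Rightarrow> bool" (infix \<open>\<lessdot>\<close> 50) where
  "I \<lessdot> J \<longleftrightarrow> I \<in> \<Lambda> \<and> J \<in> \<Lambda> \<and> I \<subset> J \<and> card J = card I + 1"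

text \<open>The Poincare polynomial of \<open>W\<^sub>I\<close> in \<open>\<int>[q]\<close>, where \<open>q\<close> is \<open>[:0, 1:]\<close>.\<close>

definition poincare :: "'w set \<Rightarrow> int poly" where
  "poincare I = (\<Sum>w \<in> W I. [:0, 1:] ^ len w)"

definition min_coset_reps :: "'w set \<Rightarrow> 'w set \<Rightarrow> 'w set" where
  "min_coset_reps J I = {w \<in> W J. \<forall>v \<in> w <# W I. len w \<le> len v}"

end


section \<open>Monoid rings, extension of scalars and presentations\<close>

definition monoid_ring :: "('a, 'm) monoid_scheme \<Rightarrow> ('a \<Rightarrow>\<^sub>0 int) ring" where
  "monoid_ring M =
    \<lparr>carrier = {f. Poly_Mapping.keys f \<subseteq> carrier M},
     monoid.mult = (\<lambda>f g. frag_extend (\<lambda>x. frag_extend (\<lambda>y. frag_of (x \<otimes>\<^bsub>M\<^esub> y)) g) f),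
     one = frag_of \<one>\<^bsub>M\<^esub>, ring.zero = 0, add = (+)\<rparr>"

definition free_algebra :: "'x set \<Rightarrow> ('x list \<Rightarrow>\<^sub>0 int) ring" where
  "free_algebra X = monoid_ring (\<lparr>carrier = lists X, monoid.mult = (@), one = []\<rparr>)"

text \<open>
  \<open>B \<otimes>\<^sub>A M\<close> for a homomorphism \<open>\<phi> : A \<rightarrow> B\<close> of commutative rings and a (not necessarily commutative)
  \<open>A\<close>-algebra \<open>M\<close>: the free abelian group on \<open>B \<times> M\<close> with the product
  \<open>(b, x) (c, y) = (bc, xy)\<close>, modulo the bilinearity relations.  The set of these relations is closed
  under multiplication by pairs \<open>(c, y)\<close> from either side, up to relations of the same form, so the
  ideal it generates is the subgroup it generates.
\<close>

definition tensor_ideal ::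
  "('a, 'k) ring_scheme \<Rightarrow> ('a \<Rightarrow> 'b) \<Rightarrow> ('b, 'l) ring_scheme \<Rightarrow> ('a, 'c, 'n) module_scheme \<Rightarrow>
    ('b \<times> 'c \<Rightarrow>\<^sub>0 int) set" where
  "tensor_ideal A \<phi> B M = Idl\<^bsub>monoid_ring (B \<times>\<times> M)\<^esub>
    ({frag_of (b \<oplus>\<^bsub>B\<^esub> c, x) - frag_of (b, x) - frag_of (c, x) | b c x.
        b \<in> carrier B \<and> c \<in> carrier B \<and> x \<in> carrier M} \<union>
     {frag_of (b, x \<oplus>\<^bsub>M\<^esub> y) - frag_of (b, x) - frag_of (b, y) | b x y.
        b \<in> carrier B \<and> x \<in> carrier M \<and> y \<in> carrier M} \<union>
     {frag_of (b \<otimes>\<^bsub>B\<^esub> \<phi> a, x) - frag_of (b, a \<odot>\<^bsub>M\<^esub> x) | a b x.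
        a \<in> carrier A \<and> b \<in> carrier B \<and> x \<in> carrier M})"

definition base_change ::
  "('a, 'k) ring_scheme \<Rightarrow> ('a \<Rightarrow> 'b) \<Rightarrow> ('b, 'l) ring_scheme \<Rightarrow> ('a, 'c, 'n) module_scheme \<Rightarrow>
    ('b \<times> 'c \<Rightarrow>\<^sub>0 int) set ring" where
  "base_change A \<phi> B M = monoid_ring (B \<times>\<times> M) Quot tensor_ideal A \<phi> B M"

definition tensor ::
  "('a, 'k) ring_scheme \<Rightarrow> ('a \<Rightarrow> 'b) \<Rightarrow> ('b, 'l) ring_scheme \<Rightarrow> ('a, 'c, 'n) module_scheme \<Rightarrow>
    'b \<Rightarrow> 'c \<Rightarrow> ('b \<times> 'c \<Rightarrow>\<^sub>0 int) set" where
  "tensor A \<phi> B M b x = tensor_ideal A \<phi> B M +>\<^bsub>monoid_ring (B \<times>\<times> M)\<^esub> frag_of (b, x)"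

text \<open>
  The map \<open>B \<otimes>\<^sub>A M \<rightarrow> C \<otimes>\<^sub>A M\<close>, \<open>b \<otimes> x \<mapsto> \<psi> b \<otimes> x\<close>, induced by a homomorphism \<open>\<psi> : B \<rightarrow> C\<close> of
  \<open>A\<close>-algebras, where \<open>\<chi> : A \<rightarrow> C\<close> is the structure map.  It is given on cosets; the terms of the
union are all equal.
\<close>

definition scalar_map ::
  "('a, 'k) ring_scheme \<Rightarrow> ('a \<Rightarrow> 'd) \<Rightarrow> ('d, 'l) ring_scheme \<Rightarrow> ('a, 'c, 'n) module_scheme \<Rightarrow>
    ('b \<Rightarrow> 'd) \<Rightarrow> ('b \<times> 'c \<Rightarrow>\<^sub>0 int) set \<Rightarrow> ('d \<times> 'c \<Rightarrow>\<^sub>0 int) set" where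
  "scalar_map A \<chi> C M \<psi> X =
    (\<Union>F \<in> X. tensor_ideal A \<chi> C M +>\<^bsub>monoid_ring (C \<times>\<times> M)\<^esub>
       frag_extend (\<lambda>(b, x). frag_of (\<psi> b, x)) F)"

text \<open>
  \<open>E\<close> is generated as a unital \<open>\<int>\<close>-algebra by the elements \<open>ev x\<close> (\<open>x \<in> X\<close>) subject to the relations
  \<open>a = b\<close>, \<open>(a, b) \<in> Rel\<close>: mapping \<open>x\<close> to \<open>ev x\<close> induces an isomorphism from the quotient of the free
  algebra on \<open>X\<close> onto \<open>E\<close>.
\<close>

definition presented_by ::
  "('e, 'm) ring_scheme \<Rightarrow> 'x set \<Rightarrow> ('x \<Rightarrow> 'e) \<Rightarrow> (('x list \<Rightarrow>\<^sub>0 int) \<times> ('x list \<Rightarrow>\<^sub>0 int)) set \<Rightarrow> bool" where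
  "presented_by E X ev Rel \<longleftrightarrow>
    (let I = Idl\<^bsub>free_algebra X\<^esub> {a - b | a b. (a, b) \<in> Rel}
     in \<exists>\<Phi> \<in> ring_iso (free_algebra X Quot I) E.
          \<forall>x \<in> X. \<Phi> (I +>\<^bsub>free_algebra X\<^esub> frag_of [x]) = ev x)"


section \<open>The coefficient rings\<close>

abbreviation Zq :: "int poly ring" where
  "Zq \<equiv> \<lparr>carrier = UNIV, monoid.mult = (*), one = 1, ring.zero = 0, add = (+)\<rparr>"

definition R_carrier :: "int poly fract set" where
  "R_carrier = {Fract f (1 + [:0, 1:] * g) | f g. True}"

definition R_ring :: "int poly fract ring" where
  "R_ring = \<lparr>carrier = R_carrier, monoid.mult = (*), one = 1, ring.zero = 0, add = (+)\<rparr>"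

definition Zq_to_R :: "int poly \<Rightarrow> int poly fract" where
  "Zq_to_R f = Fract f 1"

definition Zq_to_Z :: "int poly \<Rightarrow> int" where
  "Zq_to_Z f = poly f 0"

definition R_to_Z :: "int poly fract \<Rightarrow> int" where
  "R_to_Z r = (THE n. \<exists>f g. r = Fract f (1 + [:0, 1:] * g) \<and> n = poly f 0)"


section \<open>The Hecke algebra and its endomorphism algebras\<close>

definition alternating :: "nat \<Rightarrow> 'w \<Rightarrow> 'w \<Rightarrow> 'w list" where
  "alternating n s t = map (\<lambda>i. if even i then s else t) [0..<n]"

text \<open>
  The Hecke algebra is characterised, up to unique isomorphism, as the algebra over \<open>\<int>[q]\<close> with basis
  \<open>T\<^sub>w\<close> that is generated by the \<open>T\<^sub>s\<close> with the quadratic and braid relations, where \<open>T\<^sub>w\<close> is the product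
  \<open>T\<^bsub>s\<^esub> \<cdots> T\<^bsub>t\<^esub>\<close> along any reduced expression \<open>w = s \<cdots> t\<close>.  The braid relation is vacuous if \<open>st\<close> has
  infinite order, where \<^const>\<open>group.ord\<close> is \<open>0\<close>.
\<close>

locale hecke_algebra = coxeter_system G S
  for G :: "('w, 'm) monoid_scheme" (structure) and S +
  fixes H :: "(int poly, 'h) module" and T :: "'w \<Rightarrow> 'h"
  assumes H_ring: "ring H"
    and H_module: "module Zq H"
    and H_smult_l: "x \<in> carrier H \<Longrightarrow> y \<in> carrier H \<Longrightarrow>
      (a \<odot>\<^bsub>H\<^esub> x) \<otimes>\<^bsub>H\<^esub> y = a \<odot>\<^bsub>H\<^esub> (x \<otimes>\<^bsub>H\<^esub> y)"
    and H_smult_r: "x \<in> carrier H \<Longrightarrow> y \<in> carrier H \<Longrightarrow>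
      x \<otimes>\<^bsub>H\<^esub> (a \<odot>\<^bsub>H\<^esub> y) = a \<odot>\<^bsub>H\<^esub> (x \<otimes>\<^bsub>H\<^esub> y)"
    and T_closed: "w \<in> carrier G \<Longrightarrow> T w \<in> carrier H"
    and T_basis: "x \<in> carrier H \<Longrightarrow>
      \<exists>!c. finite {w. c w \<noteq> 0} \<and> {w. c w \<noteq> 0} \<subseteq> carrier G \<and>
        x = finsum H (\<lambda>w. c w \<odot>\<^bsub>H\<^esub> T w) {w. c w \<noteq> 0}"
    and T_quadratic: "s \<in> S \<Longrightarrow>
      T s \<otimes>\<^bsub>H\<^esub> T s = ([:0, 1:] - 1) \<odot>\<^bsub>H\<^esub> T s \<oplus>\<^bsub>H\<^esub> [:0, 1:] \<odot>\<^bsub>H\<^esub> \<one>\<^bsub>H\<^esub>"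
    and T_braid: "s \<in> S \<Longrightarrow> t \<in> S \<Longrightarrow> n = ord (s \<otimes> t) \<Longrightarrow>
      word_prod H (map T (alternating n s t)) = word_prod H (map T (alternating n t s))"
    and T_reduced: "reduced ws \<Longrightarrow> T (word_prod G ws) = word_prod H (map T ws)"
begin

definition x_par :: "'w set \<Rightarrow> 'h" where
  "x_par I = finsum H T (W I)"

definition h_par :: "'w set \<Rightarrow> 'w set \<Rightarrow> 'h" where
  "h_par J I = finsum H T (min_coset_reps J I)"

definition xH :: "'w set \<Rightarrow> 'h set" where
  "xH I = {x_par I \<otimes>\<^bsub>H\<^esub> a | a. a \<in> carrier H}"

text \<open>The direct sum of the right modules \<open>x\<^sub>I H\<^sub>q\<close>, \<open>I \<in> \<Lambda>\<close> (a finite family, since \<open>S\<close> is finite).\<close>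

definition xH_sum :: "('w set \<Rightarrow> 'h) set" where
  "xH_sum = (\<Pi>\<^sub>E I \<in> \<Lambda>. xH I)"

definition E\<^sub>q :: "(int poly, ('w set \<Rightarrow> 'h) \<Rightarrow> 'w set \<Rightarrow> 'h) module" where
  "E\<^sub>q =
    \<lparr>carrier = {F \<in> xH_sum \<rightarrow>\<^sub>E xH_sum.
       (\<forall>v \<in> xH_sum. \<forall>w \<in> xH_sum. F (\<lambda>I\<in>\<Lambda>. v I \<oplus>\<^bsub>H\<^esub> w I) = (\<lambda>I\<in>\<Lambda>. F v I \<oplus>\<^bsub>H\<^esub> F w I)) \<and>
       (\<forall>v \<in> xH_sum. \<forall>a \<in> carrier H. F (\<lambda>I\<in>\<Lambda>. v I \<otimes>\<^bsub>H\<^esub> a) = (\<lambda>I\<in>\<Lambda>. F v I \<otimes>\<^bsub>H\<^esub> a))},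
     monoid.mult = compose xH_sum,
     one = (\<lambda>v\<in>xH_sum. v),
     ring.zero = (\<lambda>v\<in>xH_sum. \<lambda>I\<in>\<Lambda>. \<zero>\<^bsub>H\<^esub>),
     add = (\<lambda>F F'. \<lambda>v\<in>xH_sum. \<lambda>I\<in>\<Lambda>. F v I \<oplus>\<^bsub>H\<^esub> F' v I),
     module.smult = (\<lambda>a F. \<lambda>v\<in>xH_sum. \<lambda>I\<in>\<Lambda>. a \<odot>\<^bsub>H\<^esub> F v I)\<rparr>"

text \<open>A map \<open>f\<close> from the summand with index \<open>J\<close> to that with index \<open>I\<close>, extended by \<open>0\<close>.\<close>

definition component_map :: "'w set \<Rightarrow> 'w set \<Rightarrow> ('h \<Rightarrow> 'h) \<Rightarrow> ('w set \<Rightarrow> 'h) \<Rightarrow> 'w set \<Rightarrow> 'h" where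
  "component_map I J f = (\<lambda>v\<in>xH_sum. \<lambda>K\<in>\<Lambda>. if K = I then f (v J) else \<zero>\<^bsub>H\<^esub>)"

definition RE\<^sub>q where
  "RE\<^sub>q = base_change Zq Zq_to_R R_ring E\<^sub>q"

definition E\<^sub>0 where
  "E\<^sub>0 = base_change Zq Zq_to_Z \<Z> E\<^sub>q"

definition RE\<^sub>q_to_E\<^sub>0 where
  "RE\<^sub>q_to_E\<^sub>0 = scalar_map Zq Zq_to_Z \<Z> E\<^sub>q R_to_Z"

text \<open>
  In \<open>R \<otimes> E\<^sub>q\<close> the tensor \<open>r \<otimes> F\<close> stands for the endomorphism \<open>r F\<close> of \<open>\<Oplus>\<^sub>I x\<^sub>I(RH\<^sub>q)\<close>.  In particular
  \<open>d\<^bsub>J,I\<^esub>\<close>, which is left multiplication by \<open>(\<pi>(I) / \<pi>(J)) h\<^bsub>J,I\<^esub>\<close> on the summand \<open>x\<^sub>I(RH\<^sub>q) = p\<^sub>I(RH\<^sub>q)\<close>,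
  is \<open>\<pi>(I) / \<pi>(J) \<otimes> F\<close> with \<open>F\<close> the left multiplication by \<open>h\<^bsub>J,I\<^esub>\<close>.
\<close>

definition u_RE where
  "u_RE I J = tensor Zq Zq_to_R R_ring E\<^sub>q 1 (component_map I J (\<lambda>a. a))"

definition d_RE where
  "d_RE J I = tensor Zq Zq_to_R R_ring E\<^sub>q (Fract (poincare I) (poincare J))
     (component_map J I (\<lambda>a. h_par J I \<otimes>\<^bsub>H\<^esub> a))"

definition one_RE where
  "one_RE K = tensor Zq Zq_to_R R_ring E\<^sub>q 1 (component_map K K (\<lambda>a. a))"

end


section \<open>Generators and relations\<close>

text \<open>\<open>Up I J\<close>, \<open>Down J I\<close>, \<open>One K\<close> stand for \<open>u\<^bsub>I,J\<^esub>\<close>, \<open>d\<^bsub>J,I\<^esub>\<close>, \<open>1\<^sub>K\<close>.\<close>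

datatype 'w gen = Up "'w set" "'w set" | Down "'w set" "'w set" | One "'w set"

primrec (in hecke_algebra) gen_value where
  "gen_value (Up I J) = RE\<^sub>q_to_E\<^sub>0 (u_RE I J)"
| "gen_value (Down J I) = RE\<^sub>q_to_E\<^sub>0 (d_RE J I)"
| "gen_value (One K) = RE\<^sub>q_to_E\<^sub>0 (one_RE K)"

context coxeter_system
begin

definition gens :: "'w gen set" where
  "gens = {Up I J | I J. I \<lessdot> J} \<union> {Down J I | I J. I \<lessdot> J} \<union> {One K | K. K \<in> \<Lambda>}"

definition ordering :: "'w set \<Rightarrow> 'w set list \<Rightarrow> bool" where
  "ordering I Is \<longleftrightarrow> Is \<noteq> [] \<and> hd Is = {} \<and> last Is = I \<and>
     (\<forall>i. Suc i < length Is \<longrightarrow> Is ! i \<lessdot> Is ! Suc i)"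

text \<open>
  The word \<open>ws = [s\<^sub>l, \<dots>, s\<^sub>1]\<close> is a reduced expression of \<open>w\<^sub>I\<close> associated with the ordering; its part
  \<open>s\<^sub>j \<cdots> s\<^sub>1\<close> is the suffix of length \<open>j\<close>.
\<close>

definition associated_expr :: "'w set \<Rightarrow> 'w set list \<Rightarrow> 'w list \<Rightarrow> bool" where
  "associated_expr I Is ws \<longleftrightarrow> reduced ws \<and> word_prod G ws = longest I \<and>
     (\<forall>i < length Is. \<exists>j \<le> length ws. longest (Is ! i) = word_prod G (drop (length ws - j) ws))"

definition up_word :: "'w set list \<Rightarrow> 'w gen list" where
  "up_word Is = map (\<lambda>i. Up (Is ! i) (Is ! Suc i)) [0..<length Is - 1]"

definition down_word :: "'w set list \<Rightarrow> 'w gen list" where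
  "down_word Is = rev (map (\<lambda>i. Down (Is ! Suc i) (Is ! i)) [0..<length Is - 1])"

definition p_word :: "'w list \<Rightarrow> 'w gen list" where
  "p_word ws = concat (map (\<lambda>s. [Up {} {s}, Down {s} {}]) ws)"

definition rels :: "(('w gen list \<Rightarrow>\<^sub>0 int) \<times> ('w gen list \<Rightarrow>\<^sub>0 int)) set" where
  "rels =
    {(frag_of [], \<Sum>I\<in>\<Lambda>. frag_of [One I])} \<union>
    {(frag_of [Down J I, Up I J], frag_of [One J]) | I J. I \<lessdot> J} \<union>
    {(frag_of [Up I J, Up J K], frag_of [Up I J', Up J' K]) | I J J' K.
       I \<lessdot> J \<and> J \<lessdot> K \<and> I \<lessdot> J' \<and> J' \<lessdot> K} \<union>
    {(frag_of [Down K J, Down J I], frag_of [Down K J', Down J' I]) | I J J' K.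
       I \<lessdot> J \<and> J \<lessdot> K \<and> I \<lessdot> J' \<and> J' \<lessdot> K} \<union>
    {(frag_of (up_word Is @ down_word Is), frag_of (p_word ws)) | I Is ws.
       I \<in> \<Lambda> - {{}} \<and> ordering I Is \<and> associated_expr I Is ws} \<union>
    {(frag_of [Up I J, One J], frag_of [Up I J]) | I J. I \<lessdot> J} \<union>
    {(frag_of [One I, Up I J], frag_of [Up I J]) | I J. I \<lessdot> J} \<union>
    {(frag_of [Down J I, One I], frag_of [Down J I]) | I J. I \<lessdot> J} \<union>
    {(frag_of [One J, Down J I], frag_of [Down J I]) | I J. I \<lessdot> J} \<union>
    {(frag_of [One I, One I], frag_of [One I]) | I. I \<in> \<Lambda>} \<union>
    {(frag_of [One I, One J], 0) | I J. I \<in> \<Lambda> \<and> J \<in> \<Lambda> \<and> I \<noteq> J}"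

end

end

theory Submission
  imports Defs
begin

text \<open>
  Modulo \<open>q\<close> the factor \<open>\<pi>(I)/\<pi>(J)\<close> is \<open>1\<close>, so \<open>E\<^sub>0 = E\<^sub>q / q E\<^sub>q\<close> acts on functions on \<open>W\<close>: \<open>u\<^bsub>I,J\<^esub>\<close> is an
  inclusion and \<open>d\<^bsub>J,I\<^esub>\<close> sends \<open>f\<close> to \<open>f \<circ> d\<^sub>J\<close>, where \<open>d\<^sub>J(w)\<close> is the minimal element of \<open>W\<^sub>J w\<close>.  In this
  picture the relations hold by inspection; for (3), the descent operators \<open>w \<mapsto> min(w, sw)\<close> applied
  along a reduced expression of \<open>w\<^sub>I\<close> produce \<open>d\<^sub>I\<close>.

  Conversely, (1) and (2) make every \<open>I\<close> a retract of \<open>\<emptyset>\<close>, and (3) makes the algebra at \<open>\<emptyset>\<close> a quotient of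
  the 0-Hecke monoid ring: for rank two it gives the braid relations, as both orderings of
  \<open>{s, t}\<close> lead to the same product.  By Matsumoto's theorem the words \<open>d\<^bsub>I,\<emptyset>\<^esub> p\<^sub>w u\<^bsub>\<emptyset>,J\<^esub>\<close>, with
  \<open>w\<close> maximal in \<open>W\<^sub>I w W\<^sub>J\<close>, span the presented algebra.  The value of such a word at \<open>x\<^sub>J\<close> is the
  indicator function of the Bruhat interval below \<open>w\<close>, so by triangularity these words form a basis
  of \<open>E\<^sub>0\<close>.
\<close>


text \<open>No basis of \<open>E\<^sub>q\<close> over the polynomials in q is constructed. Its place
  is taken by saturation: an element of \<open>xH I\<close> that is divisible by q in H is q times
  an element of \<open>xH I\<close>. So an endomorphism that vanishes modulo q is q times an
  endomorphism, and questions about \<open>E\<^sub>0\<close> become questions about integer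
  functions on W. There left multiplication by x_I is composition with \<open>dmin I\<close>,
  because a sum over W_I with weights q^l(b) keeps only b = 1 at q = 0.

  Generation follows from symmetry: the function of the I-component of F(x_J) is invariant under W_I
  on the left and W_J on the right, so a longest element of its support is maximal in its double
  coset and can be cleared by a multiple of one basis function.

  The group is given by a presentation, from which the exchange condition, minimal coset
  representatives, longest elements and Matsumoto's theorem are derived. The descent action serves
  twice: it separates longest elements and reduced forms in the 0-Hecke monoid, and later it is the
  action of \<open>E\<^sub>0\<close> itself.\<close>

section \<open>Words and alternating words\<close>

lemma rev_in_lists [simp]: "rev ws \<in> lists A \<longleftrightarrow> ws \<in> lists A"
  by (simp add: in_lists_conv_set)

lemma take_in_lists [simp]: "ws \<in> lists A \<Longrightarrow> take n ws \<in> lists A"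
  by (auto dest: in_set_takeD)

lemma drop_in_lists [simp]: "ws \<in> lists A \<Longrightarrow> drop n ws \<in> lists A"
  by (auto dest: in_set_dropD)

lemma power_in_lists: "s \<in> A \<Longrightarrow> t \<in> A \<Longrightarrow> concat (replicate m [s, t]) \<in> lists A"
  by (induction m) auto

lemma word_prod_Nil [simp]: "word_prod M [] = \<one>\<^bsub>M\<^esub>"
  by (simp add: word_prod_def)

lemma word_prod_Cons [simp]: "word_prod M (x # xs) = x \<otimes>\<^bsub>M\<^esub> word_prod M xs"
  by (simp add: word_prod_def)

lemma (in monoid) word_prod_closed: "set ws \<subseteq> carrier G \<Longrightarrow> word_prod G ws \<in> carrier G"
  by (induction ws) auto

lemma (in monoid) word_prod_append:
  "set us \<subseteq> carrier G \<Longrightarrow> set vs \<subseteq> carrier G \<Longrightarrow>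
    word_prod G (us @ vs) = word_prod G us \<otimes> word_prod G vs"
  by (induction us) (auto simp: word_prod_closed m_assoc)

lemma alternating_Suc: "alternating (Suc n) s t = s # alternating n t s"
  by (simp add: alternating_def map_upt_Suc del: upt_Suc)

lemma alternating_0 [simp]: "alternating 0 s t = []"
  by (simp add: alternating_def)

lemma length_alternating [simp]: "length (alternating n s t) = n"
  by (simp add: alternating_def)

lemma alternating_in_lists: "s \<in> S \<Longrightarrow> t \<in> S \<Longrightarrow> alternating n s t \<in> lists S"
  by (auto simp: alternating_def)

lemma set_alternating: "2 \<le> n \<Longrightarrow> set (alternating n s t) = {s, t}"
proof -
  assume "2 \<le> n"
  then obtain k where "n = Suc (Suc k)" by (metis add_2_eq_Suc le_Suc_ex)
  then show ?thesis by (auto simp: alternating_Suc) (auto simp: alternating_def)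
qed

section \<open>Elements and standard subgroups in terms of words\<close>

context coxeter_system
begin

abbreviation wp :: "'w list \<Rightarrow> 'w" where
  "wp \<equiv> word_prod G"

lemma S_in_carrier [simp]: "s \<in> S \<Longrightarrow> s \<in> carrier G"
  using S_carrier by auto

lemma inv_S [simp]: "s \<in> S \<Longrightarrow> inv s = s"
  using S_involution by (simp add: inv_equality)

lemma S_cancel: "s \<in> S \<Longrightarrow> w \<in> carrier G \<Longrightarrow> s \<otimes> (s \<otimes> w) = w"
  by (simp add: S_involution m_assoc[symmetric])

lemma S_cancel_right: "s \<in> S \<Longrightarrow> w \<in> carrier G \<Longrightarrow> w \<otimes> s \<otimes> s = w"
  by (simp add: S_involution m_assoc)

lemma S_mult_neq: "s \<in> S \<Longrightarrow> w \<in> carrier G \<Longrightarrow> s \<otimes> w \<noteq> w"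
  using S_not_one by (metis S_in_carrier r_cancel_one')

lemma lists_S_carrier: "ws \<in> lists S \<Longrightarrow> set ws \<subseteq> carrier G"
  by auto

lemma wp_closed [simp]: "ws \<in> lists S \<Longrightarrow> wp ws \<in> carrier G"
  using word_prod_closed lists_S_carrier by blast

lemma wp_append: "us \<in> lists S \<Longrightarrow> vs \<in> lists S \<Longrightarrow> wp (us @ vs) = wp us \<otimes> wp vs"
  by (intro word_prod_append) auto

lemma wp_rev: "ws \<in> lists S \<Longrightarrow> wp (rev ws) = inv (wp ws)"
proof (induction ws)
  case (Cons s ws)
  then show ?case using wp_append[of "rev ws" "[s]"] by (simp add: inv_mult_group)
qed simp

lemma W_closed: "w \<in> W I \<Longrightarrow> I \<subseteq> S \<Longrightarrow> w \<in> carrier G"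
  using generate_in_carrier S_carrier by blast

lemma wp_in_W: "ws \<in> lists I \<Longrightarrow> wp ws \<in> W I"
  by (induction ws) (auto intro: generate.intros)

text \<open>\<open>generate\<close> also admits inverses of generators; these are involutions, so
  words without formal inverses suffice.\<close>

lemma W_word: "w \<in> W I \<Longrightarrow> I \<subseteq> S \<Longrightarrow> \<exists>ws \<in> lists I. w = wp ws"
proof (induction rule: generate.induct)
  case one
  then show ?case by (intro bexI[of _ "[]"]) auto
next
  case (incl h)
  then show ?case by (intro bexI[of _ "[h]"]) auto
next
  case (inv h)
  then show ?case by (intro bexI[of _ "[h]"]) auto
next
  case (eng h1 h2)
  then obtain us vs where "us \<in> lists I" "vs \<in> lists I" "h1 = wp us" "h2 = wp vs" by auto
  moreover from this eng.prems have "us \<in> lists S" "vs \<in> lists S" by auto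
  ultimately show ?case by (intro bexI[of _ "us @ vs"]) (auto simp: wp_append)
qed

lemma carrier_word: "w \<in> carrier G \<Longrightarrow> \<exists>ws \<in> lists S. w = wp ws"
  using W_word[of w S] S_generates by auto


subsection \<open>Reflections and the exchange condition\<close>

text \<open>The i-th entry is s_1 ... s_(i-1) s_i s_(i-1) ... s_1, the reflection that deletes the
  i-th letter when multiplied to the word from the left. For a reduced word these are the left
  inversions of the element.\<close>

primrec refls :: "'w list \<Rightarrow> 'w list" where
  "refls [] = []"
| "refls (s # ws) = s # map (\<lambda>r. s \<otimes> r \<otimes> s) (refls ws)"

definition cj :: "'w \<Rightarrow> 'w \<Rightarrow> 'w" where
  "cj g r = g \<otimes> r \<otimes> inv g"

lemma cj_closed [simp]: "g \<in> carrier G \<Longrightarrow> r \<in> carrier G \<Longrightarrow> cj g r \<in> carrier G"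
  by (simp add: cj_def)

lemma cj_one [simp]: "r \<in> carrier G \<Longrightarrow> cj \<one> r = r"
  by (simp add: cj_def)

lemma cj_mult: "g \<in> carrier G \<Longrightarrow> h \<in> carrier G \<Longrightarrow> r \<in> carrier G \<Longrightarrow>
    cj g (cj h r) = cj (g \<otimes> h) r"
  by (simp add: cj_def inv_mult_group m_assoc)

lemma cj_inj: "g \<in> carrier G \<Longrightarrow> inj_on (cj g) (carrier G)"
  by (rule inj_onI) (simp add: cj_def)

lemma cj_S: "s \<in> S \<Longrightarrow> cj s r = s \<otimes> r \<otimes> s"
  by (simp add: cj_def)

lemma refls_closed: "ws \<in> lists S \<Longrightarrow> set (refls ws) \<subseteq> carrier G"
  by (induction ws) auto

lemma length_refls [simp]: "length (refls ws) = length ws"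
  by (induction ws) auto

lemma refls_append: "us \<in> lists S \<Longrightarrow> vs \<in> lists S \<Longrightarrow>
    refls (us @ vs) = refls us @ map (cj (wp us)) (refls vs)"
proof (induction us)
  case Nil
  then show ?case using refls_closed[of vs]
    by (auto intro!: map_idI[symmetric] cj_one)
next
  case (Cons s us)
  then have "refls (us @ vs) = refls us @ map (cj (wp us)) (refls vs)" by auto
  moreover have "\<forall>r \<in> set (refls vs). s \<otimes> cj (wp us) r \<otimes> s = cj (s \<otimes> wp us) r"
  proof
    fix r assume "r \<in> set (refls vs)"
    then have "r \<in> carrier G" using refls_closed[of vs] Cons.prems by auto
    then have "cj s (cj (wp us) r) = cj (s \<otimes> wp us) r"
      using Cons.prems by (intro cj_mult) auto
    then show "s \<otimes> cj (wp us) r \<otimes> s = cj (s \<otimes> wp us) r"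
      using Cons.prems by (simp add: cj_S)
  qed
  ultimately show ?case by auto
qed

lemma refls_alternating_power:
  assumes "s \<in> S" "t \<in> S"
  shows "refls (concat (replicate m [s, t])) = map (\<lambda>i. (s \<otimes> t) [^] (i::nat) \<otimes> s) [0..<2 * m]"
proof (induction m)
  case 0
  then show ?case by simp
next
  case (Suc m)
  let ?r = "s \<otimes> t" and ?us = "concat (replicate m [s, t])"
  have cl: "?us \<in> lists S" "[s, t] \<in> lists S" using assms by (auto simp: power_in_lists)
  have "refls (concat (replicate (Suc m) [s, t])) = refls ([s, t] @ ?us)" by simp
  also have "\<dots> = refls [s, t] @ map (cj ?r) (refls ?us)"
    using refls_append[OF cl(2,1)] assms by simp
  also have "map (cj ?r) (refls ?us) = map (\<lambda>i. ?r [^] Suc (Suc i) \<otimes> s) [0..<2 * m]"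
  proof -
    have "cj ?r (?r [^] i \<otimes> s) = ?r [^] Suc (Suc i) \<otimes> s" for i :: nat
    proof -
      have "cj ?r (?r [^] i \<otimes> s) = ?r \<otimes> (?r [^] i \<otimes> s) \<otimes> (t \<otimes> s)"
        using assms by (simp add: cj_def inv_mult_group)
      also have "\<dots> = (?r \<otimes> ?r [^] i) \<otimes> ?r \<otimes> s"
        using assms by (simp add: m_assoc)
      also have "?r \<otimes> ?r [^] i = ?r [^] Suc i"
        using assms nat_pow_Suc2[of ?r i] by simp
      finally show ?thesis using assms by simp
    qed
    then show ?thesis by (simp add: Suc.IH)
  qed
  also have "refls [s, t] = map (\<lambda>i. ?r [^] i \<otimes> s) [0..<Suc (Suc 0)]"
    using assms by simp
  also have "map (\<lambda>i. ?r [^] Suc (Suc i) \<otimes> s) [0..<2 * m] =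
      map (\<lambda>i. ?r [^] i \<otimes> s) [Suc (Suc 0)..<Suc (Suc (2 * m))]"
    unfolding map_Suc_upt[symmetric] map_map o_def by simp
  also have "map (\<lambda>i. ?r [^] i \<otimes> s) [0..<Suc (Suc 0)] @ \<dots> =
      map (\<lambda>i. ?r [^] i \<otimes> s) [0..<2 * Suc m]"
    unfolding map_append[symmetric] using upt_add_eq_append[of 0 "Suc (Suc 0)" "2 * m"] by simp
  finally show ?case .
qed

lemma wp_power:
  assumes "s \<in> S" "t \<in> S"
  shows "wp (concat (replicate m [s, t])) = (s \<otimes> t) [^] m"
proof (induction m)
  case (Suc m)
  then show ?case using assms nat_pow_Suc2[of "s \<otimes> t" m] by (simp add: m_assoc)
qed simp

text \<open>The reflections of this word are (st)^i s for i < 2m. Since (st)^(i+m) = (st)^i, the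
  list is its first half written twice.\<close>

lemma even_count_refls_power:
  assumes "s \<in> S" "t \<in> S" "(s \<otimes> t) [^] m = \<one>"
  shows "even (count_list (refls (concat (replicate m [s, t]))) r)"
proof -
  let ?f = "\<lambda>i. (s \<otimes> t) [^] (i::nat) \<otimes> s"
  have "[0..<2 * m] = [0..<m] @ map (\<lambda>i. i + m) [0..<m]"
    using upt_add_eq_append[of 0 m m] by (simp add: map_add_upt mult_2)
  then have "map ?f [0..<2 * m] = map ?f [0..<m] @ map (\<lambda>i. ?f (i + m)) [0..<m]"
    by simp
  also have "(\<lambda>i. ?f (i + m)) = ?f"
    using assms by (simp add: nat_pow_mult[symmetric])
  finally show ?thesis
    by (simp add: refls_alternating_power[OF assms(1,2)])
qed

lemma count_map_cj:
  assumes "g \<in> carrier G" "set rs \<subseteq> carrier G" "r \<in> carrier G"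
  shows "count_list (map (cj g) rs) r = count_list rs (cj (inv g) r)"
  using assms(2)
proof (induction rs)
  case (Cons a rs)
  have "cj g a = r \<longleftrightarrow> a = cj (inv g) r"
    using assms(1,3) Cons.prems by (auto simp: cj_mult)
  then show ?case using Cons by auto
qed simp

text \<open>
  The parity of the number of occurrences of a reflection in \<open>refls us\<close> depends only on the element
  represented by \<open>us\<close>, since \<open>(st)\<^sup>m\<close> contributes each reflection twice.
\<close>

lemma cox_cong_invariants:
  assumes "cox_cong G S us vs"
  shows "(us \<in> lists S \<longleftrightarrow> vs \<in> lists S) \<and> (us \<in> lists S \<longrightarrow> wp us = wp vs \<and>
    even (length us + length vs) \<and>
    (\<forall>r \<in> carrier G. even (count_list (refls us) r + count_list (refls vs) r)))"
  using assms
proof induction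
  case (refl us)
  then show ?case by auto
next
  case (sym us vs)
  then show ?case by (auto simp: add.commute)
next
  case (trans us vs ws)
  then show ?case by (auto simp: even_add)
next
  case (rel s t m us vs)
  let ?p = "concat (replicate m [s, t])"
  have pl: "?p \<in> lists S" using rel by (intro power_in_lists)
  have one: "(s \<otimes> t) [^] m = \<one>" using rel pow_ord_eq_1[of "s \<otimes> t"] by simp
  then have wp_p: "wp ?p = \<one>" using wp_power rel by simp
  have eq: "refls (us @ ?p @ vs) =
      refls us @ map (cj (wp us)) (refls ?p) @ map (cj (wp us)) (refls vs)"
  proof -
    have "refls (?p @ vs) = refls ?p @ map (cj \<one>) (refls vs)"
      using refls_append[OF pl] rel wp_p by simp
    also have "map (cj \<one>) (refls vs) = refls vs"
      using refls_closed[of vs] rel by (intro map_idI cj_one) auto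
    finally show ?thesis using refls_append[of us "?p @ vs"] rel pl by simp
  qed
  have ev: "even (count_list (refls (us @ ?p @ vs)) r + count_list (refls (us @ vs)) r)"
    if "r \<in> carrier G" for r
  proof -
    have "even (count_list (map (cj (wp us)) (refls ?p)) r)"
      unfolding count_map_cj[OF wp_closed[OF rel(5)] refls_closed[OF pl] that]
      by (rule even_count_refls_power[OF rel(1,2) one])
    then show ?thesis using refls_append[of us vs] rel(5,6) by (simp add: eq)
  qed
  have w: "wp (us @ ?p @ vs) = wp (us @ vs)"
    using rel(5,6) pl wp_p by (simp add: wp_append)
  have "even (length ?p)" by (induction m) auto
  then have l: "even (length (us @ ?p @ vs) + length (us @ vs))" by simp
  have m: "us @ ?p @ vs \<in> lists S" "us @ vs \<in> lists S" using rel(5,6) pl by auto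
  show ?case
    by (intro conjI impI ballI) (simp_all only: m w l ev)
qed

text \<open>The only use of the presentation: by \<open>S_presents\<close>, equality in the group is
  congruence of words, so the parity invariants belong to the element.\<close>

lemma same_wp:
  assumes "us \<in> lists S" "vs \<in> lists S" "wp us = wp vs"
  shows "even (length us + length vs)"
    and "r \<in> carrier G \<Longrightarrow> odd (count_list (refls us) r) = odd (count_list (refls vs) r)"
proof -
  note inv = cox_cong_invariants[OF S_presents[OF assms]]
  show "even (length us + length vs)" using inv assms(1) by blast
  assume "r \<in> carrier G"
  then have "even (count_list (refls us) r + count_list (refls vs) r)"
    using inv assms(1) by blast
  then show "odd (count_list (refls us) r) = odd (count_list (refls vs) r)" by simp
qed

section \<open>The length function\<close>

lemma len_exists: "w \<in> carrier G \<Longrightarrow> \<exists>ws \<in> lists S. length ws = len w \<and> wp ws = w"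
  unfolding len_def using carrier_word[of w]
    LeastI_ex[of "\<lambda>n. \<exists>ws \<in> lists S. length ws = n \<and> wp ws = w"] by auto

lemma len_le: "ws \<in> lists S \<Longrightarrow> len (wp ws) \<le> length ws"
  unfolding len_def by (rule Least_le) auto

lemma reduced_lists: "reduced ws \<Longrightarrow> ws \<in> lists S"
  by (simp add: reduced_def)

lemma reduced_exists: "w \<in> carrier G \<Longrightarrow> \<exists>ws. reduced ws \<and> wp ws = w"
  using len_exists unfolding reduced_def by metis

lemma len_one [simp]: "len \<one> = 0"
  using len_le[of "[]"] by simp

lemma len_eq_0: "w \<in> carrier G \<Longrightarrow> len w = 0 \<longleftrightarrow> w = \<one>"
  using len_exists[of w] by auto

lemma len_inv [simp]: assumes "w \<in> carrier G" shows "len (inv w) = len w"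
proof -
  have *: "len (inv v) \<le> len v" if v: "v \<in> carrier G" for v
  proof -
    obtain ws where "ws \<in> lists S" "length ws = len v" "wp ws = v" using len_exists[OF v] by auto
    then show ?thesis using len_le[of "rev ws"] wp_rev[of ws] by auto
  qed
  show ?thesis using *[of w] *[of "inv w"] assms by simp
qed

text \<open>Prepending s to a shortest word of w gives a word of sw with one letter more. All words
  of an element have lengths of the same parity, so the two lengths cannot agree.\<close>

lemma len_mult_S_neq: assumes "s \<in> S" "w \<in> carrier G" shows "len (s \<otimes> w) \<noteq> len w"
proof
  assume eq: "len (s \<otimes> w) = len w"
  obtain us where us: "us \<in> lists S" "length us = len w" "wp us = w"
    using len_exists[OF assms(2)] by auto
  obtain vs where vs: "vs \<in> lists S" "length vs = len (s \<otimes> w)" "wp vs = s \<otimes> w"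
    using len_exists[of "s \<otimes> w"] assms by auto
  have "wp (s # us) = wp vs" using us vs by simp
  then have "even (length (s # us) + length vs)"
    using same_wp(1)[of "s # us" vs] us vs assms by auto
  then show False using us vs eq by simp
qed

lemma len_mult_S_le: assumes "s \<in> S" "w \<in> carrier G" shows "len (s \<otimes> w) \<le> Suc (len w)"
proof -
  obtain us where "us \<in> lists S" "length us = len w" "wp us = w"
    using len_exists[OF assms(2)] by auto
  then show ?thesis using len_le[of "s # us"] assms by auto
qed

lemma len_up: "s \<in> S \<Longrightarrow> w \<in> carrier G \<Longrightarrow> \<not> len (s \<otimes> w) < len w \<Longrightarrow> len (s \<otimes> w) = Suc (len w)"
  using len_mult_S_neq[of s w] len_mult_S_le[of s w] by linarith

lemma len_down:
  assumes "s \<in> S" "w \<in> carrier G" "len (s \<otimes> w) < len w" shows "len w = Suc (len (s \<otimes> w))"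
  using len_mult_S_le[of s "s \<otimes> w"] assms S_cancel[of s w] by simp

lemma len_S [simp]: "s \<in> S \<Longrightarrow> len s = 1"
  using len_up[of s \<one>] by simp

section \<open>The exchange and deletion conditions\<close>

text \<open>In s_1 ... s_(i-1) s_i s_(i-1) ... s_1 times s_1 ... s_k, the tail of the reflection
  cancels against the head of the word, and s_i against s_i. This is the exchange condition for
  words.\<close>

lemma refls_nth_mult:
  assumes "ws \<in> lists S" "i < length ws"
  shows "refls ws ! i \<otimes> wp ws = wp (take i ws @ drop (Suc i) ws)"
  using assms
proof (induction ws arbitrary: i)
  case (Cons s ws)
  then have "s \<in> S" and ws: "ws \<in> lists S" by auto
  then have "wp ws \<in> carrier G" by simp
  show ?case
  proof (cases i)
    case 0
    then show ?thesis using S_cancel[OF \<open>s \<in> S\<close> \<open>wp ws \<in> carrier G\<close>] by simp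
  next
    case (Suc j)
    have cl: "refls ws ! j \<in> carrier G"
      using refls_closed[OF ws] Cons.prems Suc nth_mem[of j "refls ws"] by auto
    have "refls (s # ws) ! i \<otimes> wp (s # ws) = s \<otimes> refls ws ! j \<otimes> s \<otimes> (s \<otimes> wp ws)"
      using Suc Cons.prems by simp
    also have "\<dots> = s \<otimes> (refls ws ! j \<otimes> wp ws)"
      using cl ws \<open>s \<in> S\<close> by (simp add: m_assoc S_cancel)
    also have "\<dots> = s \<otimes> wp (take j ws @ drop (Suc j) ws)"
      using Cons Suc by simp
    finally show ?thesis using Suc by simp
  qed
qed simp

lemma refls_take: "ws \<in> lists S \<Longrightarrow> i < j \<Longrightarrow> j \<le> length ws \<Longrightarrow> refls (take j ws @ vs) ! i = refls ws ! i"
proof (induction ws arbitrary: i j)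
  case (Cons s ws)
  then obtain j' where j: "j = Suc j'" by (cases j) auto
  show ?case
    using Cons j by (cases i) (auto simp: nth_append)
qed simp

lemma refls_square: "ws \<in> lists S \<Longrightarrow> r \<in> set (refls ws) \<Longrightarrow> r \<otimes> r = \<one>"
proof (induction ws arbitrary: r)
  case (Cons s ws)
  show ?case
  proof (cases "r = s")
    case False
    then obtain r' where r': "r' \<in> set (refls ws)" "r = s \<otimes> r' \<otimes> s" using Cons by auto
    then have "r' \<in> carrier G" "r' \<otimes> r' = \<one>" using refls_closed[of ws] Cons by auto
    then show ?thesis
      using Cons.prems r' by (simp add: m_assoc S_cancel) (metis S_cancel S_involution m_assoc
        S_in_carrier m_closed l_one)
  qed (use Cons.prems S_involution in auto)
qed simp

text \<open>Deletion: removing letter j and then letter i multiplies twice by the same involution.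
  The later letter goes first, because the i-th reflection depends only on the letters up to the
  i-th and so survives the removal of letter j.\<close>

lemma drop_two:
  assumes "ws \<in> lists S" "i < j" "j < length ws" "refls ws ! i = refls ws ! j"
  shows "\<exists>us. us \<in> lists S \<and> length us < length ws \<and> wp us = wp ws \<and> set us \<subseteq> set ws"
proof -
  let ?vs = "take j ws @ drop (Suc j) ws"
  let ?us = "take i ?vs @ drop (Suc i) ?vs"
  have vs: "?vs \<in> lists S" "length ?vs = length ws - 1" "set ?vs \<subseteq> set ws"
    using assms by (auto dest: in_set_takeD in_set_dropD)
  have us: "?us \<in> lists S" "length ?us = length ?vs - 1" "set ?us \<subseteq> set ?vs"
  proof -
    show sub: "set ?us \<subseteq> set ?vs"
      using set_take_subset[of i ?vs] set_drop_subset[of "Suc i" ?vs] by (metis Un_least set_append)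
    show "?us \<in> lists S" using vs(1) sub by blast
    show "length ?us = length ?vs - 1" using assms by auto
  qed
  have r: "refls ws ! j \<in> set (refls ws)" using assms by simp
  then have rc: "refls ws ! j \<in> carrier G" using refls_closed[of ws] assms by auto
  have "wp ?us = refls ?vs ! i \<otimes> wp ?vs"
    using refls_nth_mult[OF vs(1), of i] assms vs by simp
  also have "refls ?vs ! i = refls ws ! j"
    using refls_take[of ws i j] assms by simp
  also have "wp ?vs = refls ws ! j \<otimes> wp ws"
    using refls_nth_mult[OF assms(1,3)] by simp
  also have "refls ws ! j \<otimes> (refls ws ! j \<otimes> wp ws) = wp ws"
    using rc assms refls_square[OF assms(1) r] by (simp add: m_assoc[symmetric])
  finally show ?thesis using us vs assms by (intro exI[of _ ?us]) auto
qed

lemma reduced_distinct: assumes "reduced ws" shows "distinct (refls ws)"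
proof (rule ccontr)
  assume "\<not> distinct (refls ws)"
  then obtain i j where "i < j" "j < length ws" "refls ws ! i = refls ws ! j"
    unfolding distinct_conv_nth by (metis length_refls linorder_neq_iff)
  then obtain us where "us \<in> lists S" "length us < length ws" "wp us = wp ws"
    using drop_two[of ws i j] assms by (auto simp: reduced_def)
  then show False using len_le[of us] assms by (simp add: reduced_def)
qed

lemma distinct_odd: "distinct xs \<Longrightarrow> odd (count_list xs x) \<longleftrightarrow> x \<in> set xs"
  by (induction xs) (auto simp: count_list_0_iff)

text \<open>Compare with a reduced word of the same element. In a list without repetition an odd
  count means membership, so by parity both words have the same set of reflections, hence the same
  length.\<close>

lemma distinct_reduced: assumes "ws \<in> lists S" "distinct (refls ws)" shows "reduced ws"
proof -
  obtain vs where vs: "reduced vs" "wp vs = wp ws"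
    using reduced_exists[of "wp ws"] assms by auto
  then have d: "distinct (refls vs)" "vs \<in> lists S" by (auto simp: reduced_distinct reduced_lists)
  have "set (refls ws) = set (refls vs)"
    using refls_closed[of ws] refls_closed[of vs] same_wp(2)[of ws vs] assms d vs(2)
      distinct_odd[of "refls ws"] distinct_odd[of "refls vs"] by (metis subsetD subset_antisym subsetI)
  then have "length (refls ws) = length (refls vs)"
    using assms d by (metis distinct_card)
  then show ?thesis using vs assms by (simp add: reduced_def)
qed

lemma reduced_Cons_iff:
  assumes "s \<in> S" "reduced ws" shows "reduced (s # ws) \<longleftrightarrow> \<not> len (s \<otimes> wp ws) < len (wp ws)"
proof -
  have ws: "ws \<in> lists S" using assms by (simp add: reduced_def)
  then show ?thesis
    using assms len_up[of s "wp ws"] by (auto simp: reduced_def)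
qed

lemma reduced_tl: assumes "reduced (s # ws)" shows "reduced ws"
proof -
  have *: "s \<in> S" "ws \<in> lists S" "Suc (length ws) = len (s \<otimes> wp ws)"
    using assms by (auto simp: reduced_def)
  then have "len (s \<otimes> wp ws) \<le> Suc (len (wp ws))" by (intro len_mult_S_le) auto
  then show ?thesis using * len_le[of ws] by (simp add: reduced_def)
qed

lemma reduced_descent:
  assumes "s \<in> S" "w \<in> carrier G" "len (s \<otimes> w) < len w"
  shows "\<exists>ws. reduced (s # ws) \<and> wp (s # ws) = w"
proof -
  obtain ws where ws: "reduced ws" "wp ws = s \<otimes> w"
    using reduced_exists[of "s \<otimes> w"] assms by auto
  have "reduced (s # ws)"
    using reduced_Cons_iff[OF assms(1) ws(1)] ws assms by (simp add: S_cancel)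
  then show ?thesis using ws assms by (intro exI[of _ ws]) (simp add: S_cancel)
qed

text \<open>Deletion introduces no letters, so a word in I is shortened inside I.\<close>

lemma reduced_word_in:
  assumes "ws \<in> lists I" "I \<subseteq> S"
  shows "\<exists>us. reduced us \<and> us \<in> lists I \<and> wp us = wp ws"
  using assms(1)
proof (induction "length ws" arbitrary: ws rule: less_induct)
  case less
  have ws: "ws \<in> lists S" using less.prems assms by auto
  show ?case
  proof (cases "distinct (refls ws)")
    case True
    then show ?thesis using distinct_reduced[OF ws] less.prems by auto
  next
    case False
    then obtain i j where "i < j" "j < length ws" "refls ws ! i = refls ws ! j"
      unfolding distinct_conv_nth by (metis length_refls linorder_neq_iff)
    then obtain us where us: "us \<in> lists S" "length us < length ws" "wp us = wp ws" "set us \<subseteq> set ws"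
      using drop_two[OF ws] by blast
    have "us \<in> lists I" using us(4) less.prems by auto
    from less.hyps[OF us(2) this] show ?thesis using us(3) by simp
  qed
qed

lemma W_reduced_word: "I \<subseteq> S \<Longrightarrow> w \<in> W I \<Longrightarrow> \<exists>us. reduced us \<and> us \<in> lists I \<and> wp us = w"
  using W_word[of w I] reduced_word_in by blast

end


context coxeter_system
begin

subsection \<open>Cosets of parabolic subgroups\<close>

text \<open>Minimality is tested on generators only; \<open>lmin_iff\<close> shows that this forces
  minimality in the whole coset W_I w.\<close>

definition lmin :: "'w set \<Rightarrow> 'w set" where
  "lmin I = {w \<in> carrier G. \<forall>s \<in> I. \<not> len (s \<otimes> w) < len w}"

definition dmin :: "'w set \<Rightarrow> 'w \<Rightarrow> 'w" where
  "dmin I v = (THE d. d \<in> lmin I \<and> (\<exists>a \<in> W I. v = a \<otimes> d))"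

lemma W_subgroup: "I \<subseteq> S \<Longrightarrow> subgroup (W I) G"
  using generate_is_subgroup S_carrier by auto

lemma W_mult: "a \<in> W I \<Longrightarrow> b \<in> W I \<Longrightarrow> a \<otimes> b \<in> W I"
  by (rule generate.eng)

lemma W_inv: "I \<subseteq> S \<Longrightarrow> a \<in> W I \<Longrightarrow> inv a \<in> W I"
  using W_subgroup subgroup.m_inv_closed by metis

lemma W_one: "\<one> \<in> W I"
  by (rule generate.one)

lemma W_gen: "s \<in> I \<Longrightarrow> s \<in> W I"
  by (rule generate.incl)

lemma W_mono: "I \<subseteq> J \<Longrightarrow> W I \<subseteq> W J"
  by (rule mono_generate)

lemma W_empty [simp]: "W {} = {\<one>}"
proof -
  have "w \<in> W {} \<Longrightarrow> w = \<one>" for w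
    using W_word[of w "{}"] by auto
  then show ?thesis using W_one by auto
qed

lemma refls_in_W: "ws \<in> lists I \<Longrightarrow> set (refls ws) \<subseteq> W I"
proof (induction ws)
  case (Cons s ws)
  then have "s \<in> W I" using W_gen by auto
  then show ?case using Cons by (auto intro: W_mult)
qed simp

text \<open>
  A repeated reflection in the concatenation of a reduced word of an element of \<open>W I\<close> with \<open>vs\<close>
  would be conjugate, by an element of \<open>W I\<close>, to a reflection in \<open>W I\<close> that shortens \<open>wp vs\<close>.
\<close>

lemma reduced_append_min:
  assumes "I \<subseteq> S" "us \<in> lists I" "reduced us" "reduced vs"
    and min: "\<forall>b \<in> W I. len (wp vs) \<le> len (b \<otimes> wp vs)"
  shows "reduced (us @ vs)"
proof -
  have us: "us \<in> lists S" and vs: "vs \<in> lists S" using assms by (auto simp: reduced_def)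
  have a: "wp us \<in> W I" using wp_in_W assms by blast
  have "set (refls us) \<inter> cj (wp us) ` set (refls vs) = {}"
  proof (rule ccontr)
    assume "\<not> ?thesis"
    then obtain r where r: "r \<in> set (refls vs)" "cj (wp us) r \<in> set (refls us)" by auto
    then have rc: "r \<in> carrier G" using refls_closed[OF vs] by auto
    have "cj (wp us) r \<in> W I" using r refls_in_W[OF assms(2)] by auto
    then have "inv (wp us) \<otimes> cj (wp us) r \<otimes> wp us \<in> W I"
      using a W_inv[OF assms(1)] W_mult by auto
    then have rW: "r \<in> W I" using rc us by (simp add: cj_def m_assoc) (simp add: m_assoc[symmetric])
    obtain i where i: "i < length vs" "refls vs ! i = r" using r by (metis in_set_conv_nth length_refls)
    have "len (r \<otimes> wp vs) \<le> length (take i vs @ drop (Suc i) vs)"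
      using refls_nth_mult[OF vs i(1)] i vs len_le[of "take i vs @ drop (Suc i) vs"]
      by simp
    then show False using min rW assms(4) i by (force simp: reduced_def)
  qed
  moreover have "distinct (map (cj (wp us)) (refls vs))"
    using reduced_distinct[OF assms(4)] cj_inj[OF wp_closed[OF us]] refls_closed[OF vs]
    by (simp add: distinct_map inj_on_subset)
  ultimately show ?thesis
    using us vs reduced_distinct[OF assms(3)] by (intro distinct_reduced) (auto simp: refls_append)
qed

lemma len_mult_min:
  assumes "I \<subseteq> S" "a \<in> W I" "d \<in> carrier G" "\<forall>b \<in> W I. len d \<le> len (b \<otimes> d)"
  shows "len (a \<otimes> d) = len a + len d"
proof -
  obtain us where us: "us \<in> lists I" "reduced us" "wp us = a"
    using W_reduced_word assms by blast
  obtain vs where vs: "reduced vs" "wp vs = d" using reduced_exists assms by blast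
  have "reduced (us @ vs)" using reduced_append_min[of I us vs] us vs assms by blast
  then show ?thesis using us vs by (auto simp: reduced_def wp_append)
qed

lemma min_decomp:
  assumes "I \<subseteq> S" "v \<in> carrier G"
  shows "\<exists>a \<in> W I. \<exists>d \<in> carrier G. v = a \<otimes> d \<and> (\<forall>b \<in> W I. len d \<le> len (b \<otimes> d))"
proof -
  obtain a where a: "a \<in> W I" "\<forall>b. b \<in> W I \<longrightarrow> len (a \<otimes> v) \<le> len (b \<otimes> v)"
    using ex_has_least_nat[of "\<lambda>a. a \<in> W I" \<one> "\<lambda>a. len (a \<otimes> v)"] W_one by blast
  have ac: "a \<in> carrier G" using a(1) assms(1) by (rule W_closed)
  have "len (a \<otimes> v) \<le> len (b \<otimes> (a \<otimes> v))" if "b \<in> W I" for b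
  proof -
    have "b \<otimes> (a \<otimes> v) = b \<otimes> a \<otimes> v" using ac W_closed[OF that assms(1)] assms(2) by (simp add: m_assoc)
    then show ?thesis using a(2) W_mult[OF that a(1)] by simp
  qed
  moreover have "v = inv a \<otimes> (a \<otimes> v)" using ac assms by (simp add: m_assoc[symmetric])
  ultimately show ?thesis
    using W_inv[OF assms(1) a(1)] ac assms(2) by (intro bexI[of _ "inv a"] bexI[of _ "a \<otimes> v"]) auto
qed

text \<open>Write d = a e with e of least length in the coset. If a were not 1, the first letter of
  a reduced word of a would be a descent of d, because lengths add over e.\<close>

lemma lmin_iff:
  assumes "I \<subseteq> S"
  shows "d \<in> lmin I \<longleftrightarrow> d \<in> carrier G \<and> (\<forall>b \<in> W I. len d \<le> len (b \<otimes> d))"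
proof
  assume d: "d \<in> lmin I"
  then have "d \<in> carrier G" by (simp add: lmin_def)
  then obtain a e where ae: "a \<in> W I" "e \<in> carrier G" "d = a \<otimes> e" "\<forall>b \<in> W I. len e \<le> len (b \<otimes> e)"
    using min_decomp[OF assms, of d] by blast
  obtain us where us: "us \<in> lists I" "reduced us" "wp us = a"
    using W_reduced_word[OF assms ae(1)] by blast
  have "us = []"
  proof (cases us)
    case (Cons s us')
    then have s: "s \<in> I" "s \<in> S" "us' \<in> lists I" "us' \<in> lists S" using us(1) assms by auto
    have b: "wp us' \<in> W I" using wp_in_W[OF s(3)] .
    have a: "a = s \<otimes> wp us'" using us(3) Cons by simp
    have "s \<otimes> d = wp us' \<otimes> e"
      unfolding ae(3) a using ae(2) s(2,4) by (simp add: m_assoc S_cancel)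
    then have "len (s \<otimes> d) = len (wp us') + len e" using len_mult_min[OF assms b ae(2,4)] by simp
    also have "\<dots> < len a + len e" using us(2,3) Cons len_le[OF s(4)] by (simp add: reduced_def)
    also have "\<dots> = len d" using len_mult_min[OF assms ae(1,2,4)] ae(3) by simp
    finally have "len (s \<otimes> d) < len d" .
    then show ?thesis using d s(1) by (simp add: lmin_def)
  qed simp
  then have "a = \<one>" using us(3) by simp
  then have "d = e" using ae(2,3) by simp
  then show "d \<in> carrier G \<and> (\<forall>b \<in> W I. len d \<le> len (b \<otimes> d))" using ae(2,4) by simp
next
  assume d: "d \<in> carrier G \<and> (\<forall>b \<in> W I. len d \<le> len (b \<otimes> d))"
  then have "\<not> len (s \<otimes> d) < len d" if "s \<in> I" for s
    using W_gen[OF that] by (simp add: not_less)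
  then show "d \<in> lmin I" using d by (simp add: lmin_def)
qed

lemma lmin_closed: "d \<in> lmin I \<Longrightarrow> d \<in> carrier G"
  by (simp add: lmin_def)

lemma lmin_mono: "I \<subseteq> J \<Longrightarrow> lmin J \<subseteq> lmin I"
  by (auto simp: lmin_def)

lemma lmin_one [simp]: "\<one> \<in> lmin I"
  by (simp add: lmin_def)

lemma len_mult_lmin:
  assumes "I \<subseteq> S" "a \<in> W I" "d \<in> lmin I"
  shows "len (a \<otimes> d) = len a + len d"
  using len_mult_min[OF assms(1,2)] assms(3) unfolding lmin_iff[OF assms(1)] by simp

lemma reduced_append_lmin:
  assumes "I \<subseteq> S" "us \<in> lists I" "reduced us" "reduced vs" "wp vs \<in> lmin I"
  shows "reduced (us @ vs)"
  using reduced_append_min[OF assms(1-4)] assms(5) unfolding lmin_iff[OF assms(1)] by simp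

text \<open>e = c d with c = b^(-1) a in W_I. Additivity gives l(e) = l(c) + l(d), minimality of e
  gives l(e) \<le> l(d), so l(c) = 0.\<close>

lemma lmin_unique:
  assumes "I \<subseteq> S" "a \<in> W I" "d \<in> lmin I" "b \<in> W I" "e \<in> lmin I" "a \<otimes> d = b \<otimes> e"
  shows "d = e"
proof -
  have c: "a \<in> carrier G" "b \<in> carrier G" "d \<in> carrier G" "e \<in> carrier G"
    using W_closed[OF assms(2,1)] W_closed[OF assms(4,1)] lmin_closed[OF assms(3)] lmin_closed[OF assms(5)] .
  have e: "e = (inv b \<otimes> a) \<otimes> d"
  proof -
    have "e = inv b \<otimes> (b \<otimes> e)" using c by (simp add: m_assoc[symmetric])
    then show ?thesis using c assms(6) by (simp add: m_assoc)
  qed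
  have m: "inv b \<otimes> a \<in> W I" using W_mult[OF W_inv[OF assms(1,4)] assms(2)] .
  have "len e = len (inv b \<otimes> a) + len d" using len_mult_lmin[OF assms(1) m assms(3)] unfolding e .
  moreover have "len e \<le> len (inv (inv b \<otimes> a) \<otimes> e)"
    using assms(5) W_inv[OF assms(1) m] lmin_iff[OF assms(1)] by simp
  moreover have "inv (inv b \<otimes> a) \<otimes> e = d"
  proof -
    have "inv g \<otimes> (g \<otimes> d) = d" if "g \<in> carrier G" for g
      using that c(3) by (simp add: m_assoc[symmetric])
    from this[of "inv b \<otimes> a"] show ?thesis unfolding e using c by simp
  qed
  ultimately have "len (inv b \<otimes> a) = 0" by simp
  then have "inv b \<otimes> a = \<one>" using len_eq_0[of "inv b \<otimes> a"] c by simp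
  then show ?thesis unfolding e using c by simp
qed

lemma dmin_eqI: assumes "I \<subseteq> S" "a \<in> W I" "d \<in> lmin I" shows "dmin I (a \<otimes> d) = d"
  unfolding dmin_def
proof (rule the_equality)
  show "d \<in> lmin I \<and> (\<exists>b \<in> W I. a \<otimes> d = b \<otimes> d)" using assms(2,3) by blast
  show "e = d" if "e \<in> lmin I \<and> (\<exists>b \<in> W I. a \<otimes> d = b \<otimes> e)" for e
    using that lmin_unique[OF assms] by metis
qed

lemma lmin_decomp:
  assumes "I \<subseteq> S" "v \<in> carrier G" shows "\<exists>a \<in> W I. \<exists>d \<in> lmin I. v = a \<otimes> d"
  using min_decomp[OF assms] unfolding lmin_iff[OF assms(1)] Bex_def by metis

lemma dmin_decomp:
  assumes "I \<subseteq> S" "v \<in> carrier G"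
  obtains a d where "a \<in> W I" "d \<in> lmin I" "v = a \<otimes> d" "dmin I v = d"
proof -
  obtain a d where *: "a \<in> W I" "d \<in> lmin I" "v = a \<otimes> d" using lmin_decomp[OF assms] by blast
  then have "dmin I v = d" using dmin_eqI[OF assms(1) *(1,2)] by simp
  then show thesis by (rule that[OF *])
qed

lemma dmin_lmin: assumes "I \<subseteq> S" "v \<in> carrier G" shows "dmin I v \<in> lmin I"
proof -
  obtain a d where "d \<in> lmin I" "dmin I v = d" by (rule dmin_decomp[OF assms])
  then show ?thesis by simp
qed

lemma dmin_closed [simp]: "I \<subseteq> S \<Longrightarrow> v \<in> carrier G \<Longrightarrow> dmin I v \<in> carrier G"
  by (rule lmin_closed[OF dmin_lmin])

lemma dmin_fix: "I \<subseteq> S \<Longrightarrow> d \<in> lmin I \<Longrightarrow> dmin I d = d"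
  using dmin_eqI[of I \<one> d] W_one lmin_closed[of d I] by simp

lemma dmin_mult:
  assumes "I \<subseteq> S" "a \<in> W I" "v \<in> carrier G" shows "dmin I (a \<otimes> v) = dmin I v"
proof -
  obtain b d where b: "b \<in> W I" "d \<in> lmin I" "v = b \<otimes> d" "dmin I v = d"
    by (rule dmin_decomp[OF assms(1,3)])
  then have "a \<otimes> v = (a \<otimes> b) \<otimes> d"
    using W_closed[OF assms(2,1)] W_closed[OF b(1) assms(1)] lmin_closed[OF b(2)] by (simp add: m_assoc)
  then show ?thesis using dmin_eqI[OF assms(1) W_mult[OF assms(2) b(1)] b(2)] b(4) by simp
qed

lemma dmin_dmin:
  assumes "I \<subseteq> J" "J \<subseteq> S" "v \<in> carrier G" shows "dmin I (dmin J v) = dmin J v"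
proof (rule dmin_fix)
  show "I \<subseteq> S" using assms by blast
  show "dmin J v \<in> lmin I" using dmin_lmin[OF assms(2,3)] lmin_mono[OF assms(1)] by blast
qed

lemma dmin_empty [simp]: "v \<in> carrier G \<Longrightarrow> dmin {} v = v"
  by (rule dmin_fix) (simp_all add: lmin_def)

lemma dmin_W: assumes "I \<subseteq> S" "v \<in> W I" shows "dmin I v = \<one>"
  using dmin_mult[OF assms, of \<one>] dmin_fix[OF assms(1) lmin_one] W_closed[OF assms(2,1)] by simp

lemma invariant_dmin:
  assumes "I \<subseteq> S" and inv: "\<And>s v. s \<in> I \<Longrightarrow> v \<in> carrier G \<Longrightarrow> f (s \<otimes> v) = f v" and v: "v \<in> carrier G"
  shows "f (dmin I v) = f v"
proof -
  have *: "f (wp ws \<otimes> w) = f w" if "ws \<in> lists I" "w \<in> carrier G" for ws w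
    using that
  proof (induction ws)
    case (Cons s ws)
    then have "s \<in> S" "ws \<in> lists S" using assms(1) by auto
    then show ?case using Cons inv[of s "wp ws \<otimes> w"] by (simp add: m_assoc)
  qed simp
  obtain a d where a: "a \<in> W I" "d \<in> lmin I" "v = a \<otimes> d" "dmin I v = d"
    by (rule dmin_decomp[OF assms(1) v])
  obtain ws where "ws \<in> lists I" "a = wp ws" using W_word[OF a(1) assms(1)] by blast
  then show ?thesis using *[of ws d] a lmin_closed[OF a(2)] by simp
qed


subsection \<open>The action of the 0-Hecke monoid by descents\<close>

definition dn :: "'w \<Rightarrow> 'w \<Rightarrow> 'w" where
  "dn s v = (if len (s \<otimes> v) < len v then s \<otimes> v else v)"

lemma dn_closed [simp]: "s \<in> S \<Longrightarrow> v \<in> carrier G \<Longrightarrow> dn s v \<in> carrier G"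
  by (simp add: dn_def)

lemma fold_dn_closed: "ws \<in> lists S \<Longrightarrow> v \<in> carrier G \<Longrightarrow> fold dn ws v \<in> carrier G"
  by (induction ws arbitrary: v) auto

lemma dn_nondescent: "s \<in> S \<Longrightarrow> v \<in> carrier G \<Longrightarrow> \<not> len (s \<otimes> dn s v) < len (dn s v)"
  by (auto simp: dn_def S_cancel)

lemma dn_dn [simp]: "s \<in> S \<Longrightarrow> v \<in> carrier G \<Longrightarrow> dn s (dn s v) = dn s v"
  by (auto simp: dn_def S_cancel)

lemma dn_mult: "s \<in> S \<Longrightarrow> v \<in> carrier G \<Longrightarrow> dn s (s \<otimes> v) = dn s v"
  using len_mult_S_neq[of s v] by (auto simp: dn_def S_cancel)

lemma dn_coset: "I \<subseteq> S \<Longrightarrow> s \<in> I \<Longrightarrow> v \<in> carrier G \<Longrightarrow> dmin I (dn s v) = dmin I v"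
  by (auto simp: dn_def dmin_mult W_gen)

lemma fold_dn_coset: "I \<subseteq> S \<Longrightarrow> ws \<in> lists I \<Longrightarrow> v \<in> carrier G \<Longrightarrow> dmin I (fold dn ws v) = dmin I v"
proof (induction ws arbitrary: v)
  case (Cons s ws)
  then have "s \<in> I" "s \<in> S" "ws \<in> lists I" by auto
  then show ?case using Cons.IH[OF Cons.prems(1), of "dn s v"] dn_coset[of I s v] Cons.prems by simp
qed simp

lemma dmin_singleton: assumes "s \<in> S" "v \<in> carrier G" shows "dmin {s} v = dn s v"
proof -
  have "dn s v \<in> lmin {s}" using assms dn_nondescent[OF assms] by (simp add: lmin_def)
  then have "dmin {s} (dn s v) = dn s v" using dmin_fix[of "{s}"] assms(1) by simp
  then show ?thesis using dn_coset[of "{s}" s v] assms by simp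
qed

lemma fold_dn_reduced: "reduced ws \<Longrightarrow> fold dn ws (wp ws) = \<one>"
proof (induction ws)
  case (Cons s ws)
  then have s: "s \<in> S" "ws \<in> lists S" "reduced ws"
    using reduced_tl[of s ws] by (auto simp: reduced_def)
  then have "len (s \<otimes> wp (s # ws)) < len (wp (s # ws))"
    using Cons.prems len_le[OF s(2)] by (simp add: S_cancel reduced_def)
  then have "dn s (wp (s # ws)) = wp ws" using s by (simp add: dn_def S_cancel)
  then show ?case using Cons.IH[OF s(3)] by simp
qed simp

text \<open>
  The triangularity behind uniqueness of longest elements and linear independence: the set of \<open>v\<close>
  that a reduced \<open>ws\<close> brings down to \<open>1\<close> is the Bruhat interval with top \<open>wp ws\<close>.
\<close>

lemma fold_dn_one:
  assumes "ws \<in> lists S" "v \<in> carrier G" "fold dn ws v = \<one>" "length ws \<le> len v"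
  shows "v = wp ws"
  using assms
proof (induction ws arbitrary: v)
  case Nil
  then show ?case by simp
next
  case (Cons s ws)
  have s: "s \<in> S" and ws: "ws \<in> lists S" using Cons by auto
  have "len v \<le> Suc (len (dn s v))"
    using len_down[of s v] s Cons.prems by (auto simp: dn_def)
  then have eq: "dn s v = wp ws" using Cons.IH[of "dn s v"] ws Cons.prems s by simp
  \<comment> \<open>\<open>dn s v\<close> is the product of \<open>ws\<close>, which has fewer than
    \<open>len v\<close> letters, so \<open>dn\<close> has really applied the generator.\<close>
  then have "len (dn s v) \<noteq> len v" using len_le[OF ws] Cons.prems by auto
  then have "dn s v = s \<otimes> v" by (auto simp: dn_def split: if_splits)
  then have "s \<otimes> wp ws = v" using eq s Cons.prems S_cancel[of s v] by simp
  then show ?case by simp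
qed


subsection \<open>Dihedral subgroups\<close>

lemma not_reduced_repeat: assumes "s \<in> S" shows "\<not> reduced (s # s # ws)"
proof
  assume "reduced (s # s # ws)"
  then have "ws \<in> lists S" "Suc (Suc (length ws)) = len (wp ws)"
    using assms by (auto simp: reduced_def S_cancel)
  then show False using len_le[of ws] by simp
qed

lemma reduced_alternating:
  "reduced (s # ws) \<Longrightarrow> ws \<in> lists {s, t} \<Longrightarrow> s # ws = alternating (Suc (length ws)) s t"
proof (induction ws arbitrary: s t)
  case Nil
  then show ?case by (simp add: alternating_Suc)
next
  case (Cons x ws)
  have "s \<in> S" using Cons.prems by (auto simp: reduced_def)
  then have "x \<noteq> s" using Cons.prems not_reduced_repeat by auto
  then have x: "x = t" "ws \<in> lists {t, s}" using Cons.prems by auto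
  then have "t # ws = alternating (Suc (length ws)) t s"
    using Cons.IH[of t s] reduced_tl[OF Cons.prems(1)] by blast
  then show ?case using x alternating_Suc[of "Suc (length ws)" s t] by simp
qed

text \<open>Inverting the second word reverses it, and the reversed word continues the alternation
  of the first one to st ... st with 2k letters.\<close>

lemma alternating_quotient:
  assumes "s \<in> S" "t \<in> S"
  shows "wp (alternating k s t) \<otimes> inv (wp (alternating k t s)) = (s \<otimes> t) [^] k"
  using assms
proof (induction k arbitrary: s t)
  case 0
  then show ?case by simp
next
  case (Suc k)
  have cl: "alternating k s t \<in> lists S" "alternating k t s \<in> lists S"
    using Suc by (simp_all add: alternating_in_lists)
  have "wp (alternating (Suc k) s t) \<otimes> inv (wp (alternating (Suc k) t s)) =
      s \<otimes> (wp (alternating k t s) \<otimes> inv (wp (alternating k s t))) \<otimes> t"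
    using Suc.prems cl by (simp add: alternating_Suc inv_mult_group m_assoc)
  also have "\<dots> = s \<otimes> (t \<otimes> s) [^] k \<otimes> t" using Suc by simp
  also have "\<dots> = (s \<otimes> t) [^] Suc k"
    using Suc.prems
  proof (induction k)
    case (Suc k)
    have "s \<otimes> (t \<otimes> s) [^] Suc k \<otimes> t = s \<otimes> (t \<otimes> s) [^] k \<otimes> t \<otimes> (s \<otimes> t)"
      using Suc.prems by (simp add: m_assoc)
    then show ?case using Suc by simp
  qed simp
  finally show ?case .
qed

lemma alternating_eq:
  assumes "s \<in> S" "t \<in> S" "(s \<otimes> t) [^] k = \<one>"
  shows "wp (alternating k s t) = wp (alternating k t s)"
proof -
  have "alternating k s t \<in> lists S" "alternating k t s \<in> lists S"
    using assms by (simp_all add: alternating_in_lists)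
  moreover have "wp (alternating k s t) \<otimes> inv (wp (alternating k t s)) = \<one>"
    using alternating_quotient assms by simp
  ultimately show ?thesis using inv_equality[of "wp (alternating k s t)" "inv (wp (alternating k t s))"]
    by simp
qed

lemma power_swap:
  assumes "s \<in> S" "t \<in> S" "(s \<otimes> t) [^] (k::nat) = \<one>" shows "(t \<otimes> s) [^] k = \<one>"
  using assms nat_pow_inv[of "s \<otimes> t" k] by (simp add: inv_mult_group)

text \<open>A longer word has a suffix of m + 1 letters, starting with s or with t. Behind its first
  letter stand m alternating letters which, by (st)^m = 1, may be exchanged for those starting with
  the other generator; then the first two letters cancel.\<close>

lemma reduced_alternating_le:
  assumes "s \<in> S" "t \<in> S" "(s \<otimes> t) [^] m = \<one>" "m > 0" "reduced (alternating k s t)"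
  shows "k \<le> m"
proof (rule ccontr)
  assume "\<not> k \<le> m"
  then obtain l where l: "k = l + Suc m" by (metis add.commute less_iff_Suc_add not_le add_Suc_right)
  have "reduced (alternating (Suc m) s t) \<or> reduced (alternating (Suc m) t s)"
    using assms(5) unfolding l
  proof (induction l arbitrary: s t)
    case (Suc l)
    then show ?case using reduced_tl[of s "alternating (l + Suc m) t s"]
      by (metis add_Suc alternating_Suc)
  qed simp
  moreover have "\<not> reduced (alternating (Suc m) s t)"
    if "s \<in> S" "t \<in> S" "(s \<otimes> t) [^] m = \<one>" for s t
  proof
    obtain n where n: "m = Suc n" using assms(4) by (cases m) auto
    assume "reduced (alternating (Suc m) s t)"
    then have "Suc m = len (s \<otimes> wp (alternating m t s))"
      by (simp add: reduced_def alternating_Suc)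
    also have "s \<otimes> wp (alternating m t s) = wp (alternating n t s)"
      unfolding alternating_eq[OF that, symmetric]
      using that by (simp add: n alternating_Suc S_cancel alternating_in_lists)
    finally show False using len_le[of "alternating n t s"] alternating_in_lists[of t S s n] that n by simp
  qed
  ultimately show False using assms power_swap by blast
qed

lemma dihedral_cases:
  assumes "s \<in> S" "t \<in> S" "a \<in> W {s, t}" "a \<noteq> \<one>"
  obtains k where "reduced (alternating (Suc k) s t)" "a = wp (alternating (Suc k) s t)"
  | k where "reduced (alternating (Suc k) t s)" "a = wp (alternating (Suc k) t s)"
proof -
  have "{s, t} \<subseteq> S" using assms by simp
  then obtain us where us: "reduced us" "us \<in> lists {s, t}" "wp us = a"
    using W_reduced_word assms by blast
  then obtain x vs where x: "us = x # vs" using assms(4) by (cases us) auto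
  consider "x = s" | "x = t" using x us by auto
  then show ?thesis
  proof cases
    case 1
    have "us = alternating (Suc (length vs)) s t"
      using reduced_alternating[of s vs t] us x 1 by auto
    then show ?thesis using that(1) us by metis
  next
    case 2
    have "us = alternating (Suc (length vs)) t s"
      using reduced_alternating[of t vs s] us x 2 by auto
    then show ?thesis using that(2) us by metis
  qed
qed

text \<open>For the descent: an element of length m has an alternating word of m letters, and
  \<open>alternating_eq\<close> allows this word to begin with s.\<close>

lemma dihedral_len:
  assumes "s \<in> S" "t \<in> S" "(s \<otimes> t) [^] m = \<one>" "m > 0" "a \<in> W {s, t}"
  shows "len a \<le> m" and "len a = m \<Longrightarrow> len (s \<otimes> a) < len a"
proof -
  have "len a \<le> m \<and> (len a = m \<longrightarrow> len (s \<otimes> a) < len a)"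
  proof (cases "a = \<one>")
    case True
    then show ?thesis using assms by simp
  next
    case False
    obtain n where n: "m = Suc n" using assms(4) by (cases m) auto
    have al: "alternating n t s \<in> lists S" using assms by (simp add: alternating_in_lists)
    have sm: "len (s \<otimes> wp (alternating m s t)) \<le> n"
      using al len_le[OF al] assms by (simp add: n alternating_Suc S_cancel)
    from assms(1,2,5) False show ?thesis
    proof (cases rule: dihedral_cases)
      case (1 k)
      then have "Suc k \<le> m" "len a = Suc k"
        using reduced_alternating_le[OF assms(1-4)] by (auto simp: reduced_def)
      then show ?thesis using sm n 1 by auto
    next
      case (2 k)
      then have "Suc k \<le> m" "len a = Suc k"
        using reduced_alternating_le[OF assms(2,1) power_swap[OF assms(1-3)] assms(4)]
        by (auto simp: reduced_def)
      then show ?thesis using sm n 2 alternating_eq[OF assms(1-3)] by auto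
    qed
  qed
  then show "len a \<le> m" "len a = m \<Longrightarrow> len (s \<otimes> a) < len a" by auto
qed

lemma dihedral_finite:
  assumes "s \<in> S" "t \<in> S" "(s \<otimes> t) [^] (m::nat) = \<one>" "m > 0"
  shows "finite (W {s, t})"
proof (rule finite_subset)
  show "W {s, t} \<subseteq> wp ` {us. set us \<subseteq> {s, t} \<and> length us \<le> m}"
  proof
    fix a assume a: "a \<in> W {s, t}"
    obtain us where "reduced us" "us \<in> lists {s, t}" "wp us = a"
      using W_reduced_word[of "{s, t}" a] assms a by blast
    then show "a \<in> wp ` {us. set us \<subseteq> {s, t} \<and> length us \<le> m}"
      using dihedral_len(1)[OF assms a] by (intro image_eqI[of _ _ us]) (auto simp: reduced_def)
  qed
qed (simp add: finite_lists_length_le)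

text \<open>
  Starting from an element without left descent \<open>s\<close>, alternate application of \<open>dn t\<close> and \<open>dn s\<close>
  decreases the length at every step until the minimal element of the coset is reached.
\<close>

lemma fold_dn_alternating_nondescent:
  assumes "s \<in> S" "t \<in> S" "v \<in> carrier G" "\<not> len (s \<otimes> v) < len v"
    "len v \<le> n + len (dmin {s, t} v)"
  shows "fold dn (alternating n t s) v = dmin {s, t} v"
  using assms
proof (induction n arbitrary: s t v)
  case 0
  have sub: "{s, t} \<subseteq> S" using 0 by simp
  obtain a d where a: "a \<in> W {s, t}" "d \<in> lmin {s, t}" "v = a \<otimes> d" "dmin {s, t} v = d"
    by (rule dmin_decomp[OF sub \<open>v \<in> carrier G\<close>])
  then have "len v = len a + len d" using len_mult_lmin[OF sub a(1,2)] by simp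
  then have "a = \<one>" using 0 a sub len_eq_0[of a] W_closed[OF a(1) sub] by auto
  then show ?case using a lmin_closed[OF a(2)] by simp
next
  case (Suc n)
  have sub: "{s, t} \<subseteq> S" and eq: "{s, t} = {t, s}" using Suc.prems by auto
  let ?v = "dn t v"
  have d: "dmin {s, t} ?v = dmin {s, t} v" using dn_coset[OF sub, of t v] Suc.prems by simp
  have "len ?v \<le> n + len (dmin {s, t} ?v)"
  proof (cases "len (t \<otimes> v) < len v")
    case True
    then show ?thesis using Suc.prems d by (simp add: dn_def)
  next
    case False
    then have "v \<in> lmin {s, t}" using Suc.prems by (auto simp: lmin_def)
    then have "dmin {s, t} v = v" using dmin_fix sub by blast
    then show ?thesis using False by (simp add: dn_def)
  qed
  then have "fold dn (alternating n s t) ?v = dmin {s, t} ?v"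
    using Suc.IH[of t s ?v] Suc.prems dn_nondescent eq by simp
  then show ?case using d by (simp add: alternating_Suc)
qed

text \<open>After the first step s is no left descent. Write the element as a d with d minimal: a
  cannot have length m, since it would then have the descent s. So at most m - 1 steps are missing,
  as many as there are letters left.\<close>

lemma fold_dn_alternating:
  assumes "s \<in> S" "t \<in> S" "(s \<otimes> t) [^] m = \<one>" "m > 0" "v \<in> carrier G"
  shows "fold dn (alternating m s t) v = dmin {s, t} v"
proof -
  obtain n where n: "m = Suc n" using assms(4) by (cases m) auto
  have sub: "{s, t} \<subseteq> S" using assms by simp
  let ?v = "dn s v"
  have d: "dmin {s, t} ?v = dmin {s, t} v" using dn_coset[OF sub, of s v] assms by simp
  obtain a d where a: "a \<in> W {s, t}" "d \<in> lmin {s, t}" "?v = a \<otimes> d" "dmin {s, t} ?v = d"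
    by (rule dmin_decomp[OF sub dn_closed[OF assms(1,5)]])
  have lv: "len ?v = len a + len d" using len_mult_lmin[OF sub a(1,2)] a by simp
  have "len a \<noteq> m"
  proof
    assume "len a = m"
    then have *: "len (s \<otimes> a) < len a" using dihedral_len(2)[OF assms(1-4) a(1)] by simp
    have "s \<otimes> ?v = s \<otimes> a \<otimes> d"
      using a(3) assms(1) W_closed[OF a(1) sub] lmin_closed[OF a(2)] by (simp add: m_assoc)
    then have "len (s \<otimes> ?v) = len (s \<otimes> a) + len d"
      using len_mult_lmin[OF sub W_mult[OF W_gen a(1)] a(2), of s] by simp
    then show False using * lv dn_nondescent[of s v] assms by simp
  qed
  then have "len ?v \<le> n + len (dmin {s, t} ?v)"
    using dihedral_len(1)[OF assms(1-4) a(1)] lv n a(4) by simp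
  then have "fold dn (alternating n t s) ?v = dmin {s, t} ?v"
    using assms dn_nondescent by (intro fold_dn_alternating_nondescent) auto
  then show ?thesis using d by (simp add: n alternating_Suc)
qed

end


context coxeter_system
begin

subsection \<open>Matsumoto's theorem for 0-Hecke monoids\<close>

text \<open>The congruence of words that defines the 0-Hecke monoid.\<close>

inductive zcong :: "'w list \<Rightarrow> 'w list \<Rightarrow> bool" where
  zcong_refl: "zcong us us"
| zcong_sym: "zcong us vs \<Longrightarrow> zcong vs us"
| zcong_trans: "zcong us vs \<Longrightarrow> zcong vs ws \<Longrightarrow> zcong us ws"
| zcong_idem: "s \<in> S \<Longrightarrow> zcong [s, s] [s]"
| zcong_braid: "s \<in> S \<Longrightarrow> t \<in> S \<Longrightarrow> m = ord (s \<otimes> t) \<Longrightarrow> m > 0 \<Longrightarrow>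
    zcong (alternating m s t) (alternating m t s)"
| zcong_append: "zcong us vs \<Longrightarrow> zcong us' vs' \<Longrightarrow> zcong (us @ us') (vs @ vs')"

lemma zcong_Cons: "zcong us vs \<Longrightarrow> zcong (s # us) (s # vs)"
  using zcong_append[OF zcong_refl[of "[s]"]] by simp

lemma set_alternating_swap:
  assumes "s \<in> S" "t \<in> S" "m = ord (s \<otimes> t)" "m > 0"
  shows "set (alternating m s t) = set (alternating m t s)"
proof (cases "m = 1")
  case True
  then have "s \<otimes> t = \<one>" using assms ord_eq_1[of "s \<otimes> t"] by simp
  then have "s = t" using assms inv_equality[of s t] by simp
  then show ?thesis by simp
next
  case False
  then have "2 \<le> m" using assms by simp
  then show ?thesis by (auto simp: set_alternating)
qed

lemma zcong_set: "zcong us vs \<Longrightarrow> set us = set vs"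
proof (induction rule: zcong.induct)
  case (zcong_braid s t m)
  then show ?case by (rule set_alternating_swap)
qed auto

lemma zcong_lists: "zcong us vs \<Longrightarrow> us \<in> lists A \<longleftrightarrow> vs \<in> lists A"
  using zcong_set[of us vs] by (simp add: in_lists_conv_set)

text \<open>Both sides of a braid relation act as \<open>dmin {s, t}\<close>, which is symmetric in
  s and t.\<close>

lemma zcong_fold_dn:
  "zcong us vs \<Longrightarrow> us \<in> lists S \<Longrightarrow> v \<in> carrier G \<Longrightarrow> fold dn us v = fold dn vs v"
proof (induction arbitrary: v rule: zcong.induct)
  case (zcong_sym us vs)
  then show ?case using zcong_lists[OF zcong_sym.hyps, of S] by simp
next
  case (zcong_trans us vs ws)
  then show ?case using zcong_lists[OF zcong_trans.hyps(1), of S] by simp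
next
  case (zcong_braid s t m)
  have one: "(s \<otimes> t) [^] m = \<one>" using zcong_braid pow_ord_eq_1[of "s \<otimes> t"] by simp
  have "fold dn (alternating m s t) v = dmin {s, t} v"
    using fold_dn_alternating[OF zcong_braid(1,2) one zcong_braid(4)] zcong_braid by simp
  moreover have "fold dn (alternating m t s) v = dmin {t, s} v"
    using fold_dn_alternating[OF zcong_braid(2,1) power_swap[OF zcong_braid(1,2) one] zcong_braid(4)] zcong_braid by simp
  ultimately show ?case by (simp add: insert_commute)
next
  case (zcong_append us vs us' vs')
  then have "us \<in> lists S" "us' \<in> lists S" "vs \<in> lists S"
    using zcong_lists[OF zcong_append.hyps(1), of S] by auto
  then show ?case using zcong_append.IH zcong_append.prems fold_dn_closed[of vs v] by simp
qed auto

text \<open>One reduced word of a begins with s and one with t. Both alternate and have the same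
  length n, so their quotient (st)^n is 1 and the order of st divides n; conversely reducedness
  bounds n by that order.\<close>

lemma both_descents:
  assumes "s \<in> S" "t \<in> S" "s \<noteq> t" "a \<in> W {s, t}"
    "len (s \<otimes> a) < len a" "len (t \<otimes> a) < len a"
  obtains m where "m = ord (s \<otimes> t)" "m > 0" "a = wp (alternating m s t)" "reduced (alternating m s t)"
    "reduced (alternating m t s)"
proof -
  have sub: "{s, t} \<subseteq> S" using assms by simp
  have ac: "a \<in> carrier G" using W_closed assms(4) sub .
  have *: "\<exists>k. reduced (alternating (Suc k) x y) \<and> wp (alternating (Suc k) x y) = a"
    if xy: "{x, y} = {s, t}" and d: "len (x \<otimes> a) < len a" for x y
  proof -
    have x: "x \<in> S" "x \<in> {s, t}" using xy assms by auto
    have "x \<otimes> a \<in> W {s, t}" using W_mult[OF W_gen[OF x(2)] assms(4)] .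
    then obtain us where us: "reduced us" "us \<in> lists {s, t}" "wp us = x \<otimes> a"
      using W_reduced_word[OF sub] by blast
    have r: "reduced (x # us)"
      using reduced_Cons_iff[OF x(1) us(1)] us(3) d ac x(1) by (simp add: S_cancel)
    have "us \<in> lists {x, y}" using us(2) xy by simp
    then have "x # us = alternating (Suc (length us)) x y" using reduced_alternating[OF r] by blast
    moreover have "wp (x # us) = a" using us(3) ac x(1) by (simp add: S_cancel)
    ultimately show ?thesis using r by metis
  qed
  obtain k where k: "reduced (alternating (Suc k) s t)" "wp (alternating (Suc k) s t) = a"
    using *[of s t] assms(5) by blast
  obtain l where l: "reduced (alternating (Suc l) t s)" "wp (alternating (Suc l) t s) = a"
    using *[of t s] assms(6) by blast
  have kl: "l = k" using k l by (simp add: reduced_def)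
  have "(s \<otimes> t) [^] Suc k = a \<otimes> inv a"
    using alternating_quotient[OF assms(1,2), of "Suc k"] unfolding l(2)[unfolded kl] k(2) by (rule HOL.sym)
  then have "(s \<otimes> t) [^] Suc k = \<one>" unfolding r_inv[OF ac] .
  moreover have st: "s \<otimes> t \<in> carrier G" using assms(1,2) by simp
  ultimately have "ord (s \<otimes> t) dvd Suc k" using pow_eq_id[OF st] by blast
  then have "ord (s \<otimes> t) > 0" "ord (s \<otimes> t) \<le> Suc k"
    by (auto intro: dvd_imp_le gr0I)
  moreover have "Suc k \<le> ord (s \<otimes> t)"
    using reduced_alternating_le[OF assms(1,2) pow_ord_eq_1[OF st] calculation(1) k(1)] .
  ultimately have "Suc k = ord (s \<otimes> t)" by simp
  then show ?thesis using that[OF _ _ k(2)[symmetric] k(1) l(1)[unfolded kl]] by simp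
qed

text \<open>Words with a common first letter are settled by induction. If the first letters are s
  \<noteq> t, write w = a d with a in W_{s,t} and d minimal; a has both descents, hence two
  alternating words. Written with one of them, w shares its first letter with \<open>us\<close>, and
  with the other one it shares it with \<open>vs\<close>.\<close>

theorem matsumoto: "reduced us \<Longrightarrow> reduced vs \<Longrightarrow> wp us = wp vs \<Longrightarrow> zcong us vs"
proof (induction "length us" arbitrary: us vs)
  case 0
  then have "us = []" "wp vs = \<one>" by auto
  then have "vs = []" using 0(3) by (simp add: reduced_def)
  then show ?case using 0 by (simp add: zcong_refl)
next
  case (Suc n)
  have n: "length vs = Suc n" using Suc.prems Suc.hyps(2) by (simp add: reduced_def)
  obtain s us' where us: "us = s # us'" using Suc.hyps(2) by (cases us) auto
  obtain t vs' where vs: "vs = t # vs'" using n by (cases vs) auto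
  have same: "zcong (x # xs) (x # ys)"
    if "length xs = n" "reduced (x # xs)" "reduced (x # ys)" "wp (x # xs) = wp (x # ys)" for x xs ys
  proof -
    have x: "x \<in> S" "xs \<in> lists S" "ys \<in> lists S" using that by (auto simp: reduced_def)
    then have "wp xs = wp ys" using that(4) S_in_carrier by simp
    then show ?thesis using Suc.hyps(1)[of xs ys] that reduced_tl zcong_Cons by blast
  qed
  let ?w = "wp us"
  have S: "s \<in> S" "t \<in> S" "us' \<in> lists S" "vs' \<in> lists S"
    using Suc.prems us vs by (auto simp: reduced_def)
  have w: "?w \<in> carrier G" using S us by simp
  have ds: "len (s \<otimes> ?w) < len ?w"
    using S us Suc.prems(1) len_le[of us'] by (simp add: S_cancel reduced_def)
  have "len (t \<otimes> wp vs) < len (wp vs)"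
    using S vs Suc.prems(2) len_le[of vs'] by (simp add: S_cancel reduced_def)
  then have dt: "len (t \<otimes> ?w) < len ?w" using Suc.prems(3) by simp
  show ?case
  proof (cases "s = t")
    case True
    then show ?thesis using same[of us' s vs'] us vs Suc.prems Suc.hyps(2) by simp
  next
    case False
    have sub: "{s, t} \<subseteq> S" using S by simp
    obtain a d where a: "a \<in> W {s, t}" "d \<in> lmin {s, t}" "?w = a \<otimes> d"
      by (rule dmin_decomp[OF sub w])
    have ac: "a \<in> carrier G" "d \<in> carrier G" using W_closed[OF a(1) sub] lmin_closed[OF a(2)] .
    \<comment> \<open>Lengths add in w = a d and in x w = (x a) d, so descents of w in {s, t} are
      descents of a.\<close>
    have desc: "len (x \<otimes> a) < len a" if "x \<in> {s, t}" "len (x \<otimes> ?w) < len ?w" for x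
    proof -
      have "x \<in> carrier G" using that S by auto
      then have "x \<otimes> ?w = (x \<otimes> a) \<otimes> d" using a(3) ac by (simp add: m_assoc)
      then have "len (x \<otimes> ?w) = len (x \<otimes> a) + len d"
        using len_mult_lmin[OF sub W_mult[OF W_gen[OF that(1)] a(1)] a(2)] by simp
      moreover have "len ?w = len a + len d" using len_mult_lmin[OF sub a(1,2)] a(3) by simp
      ultimately show ?thesis using that(2) by simp
    qed
    obtain m where m: "m = ord (s \<otimes> t)" "m > 0" "a = wp (alternating m s t)"
      "reduced (alternating m s t)" "reduced (alternating m t s)"
      using both_descents[OF S(1,2) False a(1)] desc ds dt by blast
    obtain k where k: "m = Suc k" using m(2) by (cases m) auto
    obtain es where es: "reduced es" "wp es = d" using reduced_exists ac(2) by blast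
    have one: "(s \<otimes> t) [^] m = \<one>" using m(1) S pow_ord_eq_1[of "s \<otimes> t"] by simp
    have al: "alternating m s t \<in> lists {s, t}" "alternating m t s \<in> lists {s, t}"
      by (simp_all add: alternating_in_lists)
    then have als: "alternating m s t \<in> lists S" "alternating m t s \<in> lists S" using sub by auto
    have r: "reduced (alternating m s t @ es)" "reduced (alternating m t s @ es)"
      using reduced_append_lmin[OF sub al(1) m(4) es(1)] reduced_append_lmin[OF sub al(2) m(5) es(1)]
        es(2) a(2) by auto
    have p: "wp (alternating m s t @ es) = ?w" "wp (alternating m t s @ es) = ?w"
      using a(3) m(3) es als alternating_eq[OF S(1,2) one] reduced_lists[OF es(1)]
      by (simp_all add: wp_append)
    have "zcong us (alternating m s t @ es)"
      using same[of us' s "alternating k t s @ es"] us k r(1) p(1) Suc.prems(1) Suc.hyps(2)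
      by (simp add: alternating_Suc)
    moreover have "zcong (alternating m s t @ es) (alternating m t s @ es)"
      using zcong_append[OF zcong_braid[OF S(1,2) m(1,2)] zcong_refl] .
    moreover have "zcong (alternating m t s @ es) vs"
      using same[of vs' t "alternating k s t @ es"] vs k r(2) p(2) Suc.prems n zcong_sym
      by (simp add: alternating_Suc)
    ultimately show ?thesis using zcong_trans by blast
  qed
qed

lemma zcong_descent:
  assumes "reduced ws" "s \<in> S" "len (s \<otimes> wp ws) < len (wp ws)"
  shows "\<exists>us. reduced (s # us) \<and> zcong ws (s # us)"
proof -
  have "wp ws \<in> carrier G" using reduced_lists[OF assms(1)] by simp
  then obtain us where "reduced (s # us)" "wp (s # us) = wp ws"
    using reduced_descent[OF assms(2) _ assms(3)] by blast
  then show ?thesis using matsumoto[OF assms(1)] by metis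
qed

text \<open>Matsumoto's theorem brings s to the front of \<open>ws\<close>, where ss = s absorbs
  another s.\<close>

lemma zcong_left_absorb:
  assumes "reduced ws" "s \<in> S" "len (s \<otimes> wp ws) < len (wp ws)"
  shows "zcong (s # ws) ws"
proof -
  obtain us where us: "zcong ws (s # us)" using zcong_descent[OF assms] by blast
  have "zcong (s # s # us) (s # us)"
    using zcong_append[OF zcong_idem[OF assms(2)] zcong_refl[of us]] by simp
  then show ?thesis using zcong_Cons[OF us] us zcong_trans zcong_sym by metis
qed

lemma reduced_rev: "reduced ws \<Longrightarrow> reduced (rev ws)"
  by (simp add: reduced_def wp_rev)

lemma right_descent_word:
  assumes "reduced ws" "s \<in> S" "len (wp ws \<otimes> s) < len (wp ws)"
  shows "\<exists>us. reduced (us @ [s]) \<and> zcong ws (us @ [s])"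
proof -
  have c: "wp ws \<in> carrier G" "ws \<in> lists S" using reduced_lists[OF assms(1)] by simp_all
  have "len (s \<otimes> inv (wp ws)) = len (inv (s \<otimes> inv (wp ws)))" using c assms(2) by simp
  then have "len (s \<otimes> inv (wp ws)) < len (inv (wp ws))"
    using assms c by (simp add: inv_mult_group)
  then obtain us where us: "reduced (s # us)" "wp (s # us) = inv (wp ws)"
    using reduced_descent[OF assms(2), of "inv (wp ws)"] c by auto
  then have "reduced (rev us @ [s])" using reduced_rev[OF us(1)] by simp
  moreover have "wp (rev us @ [s]) = wp ws"
    using wp_rev[OF reduced_lists[OF us(1)]] us(2) c by simp
  ultimately show ?thesis using matsumoto[OF assms(1)] by metis
qed

lemma zcong_right_absorb:
  assumes "reduced ws" "s \<in> S" "len (wp ws \<otimes> s) < len (wp ws)"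
  shows "zcong (ws @ [s]) ws"
proof -
  obtain us where us: "zcong ws (us @ [s])" using right_descent_word[OF assms] by blast
  have "zcong (us @ [s, s]) (us @ [s])"
    using zcong_append[OF zcong_refl[of us] zcong_idem[OF assms(2)]] .
  then show ?thesis using zcong_append[OF us zcong_refl[of "[s]"]] us zcong_trans zcong_sym
    by (metis append_Cons append_Nil append_assoc)
qed

lemma zcong_reduced: "ws \<in> lists S \<Longrightarrow> \<exists>us. reduced us \<and> zcong ws us"
proof (induction ws)
  case Nil
  have "reduced []" by (simp add: reduced_def)
  then show ?case using zcong_refl by blast
next
  case (Cons s ws)
  then obtain us where us: "reduced us" "zcong ws us" and s: "s \<in> S" by auto
  show ?case
  proof (cases "len (s \<otimes> wp us) < len (wp us)")
    case True
    then have "zcong (s # ws) us"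
      using zcong_left_absorb[OF us(1) s] zcong_Cons[OF us(2)] zcong_trans by blast
    then show ?thesis using us by blast
  next
    case False
    then have "reduced (s # us)" using reduced_Cons_iff[OF s us(1)] by simp
    then show ?thesis using zcong_Cons[OF us(2)] by blast
  qed
qed

text \<open>The descent action separates the classes: \<open>vs\<close> acts like \<open>us\<close>
  and so brings \<open>wp us\<close> down to 1. If \<open>vs\<close> is not the longer word,
  \<open>fold_dn_one\<close> identifies the elements; the other case is symmetric.\<close>

lemma zcong_reduced_unique:
  assumes "zcong us vs" "reduced us" "reduced vs" shows "wp us = wp vs"
proof -
  have *: "wp us = wp vs"
    if "zcong us vs" "reduced us" "reduced vs" "length vs \<le> length us" for us vs
  proof (rule fold_dn_one)
    have c: "us \<in> lists S" "wp us \<in> carrier G" using reduced_lists[OF that(2)] by simp_all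
    show "vs \<in> lists S" using that(3) by (rule reduced_lists)
    show "wp us \<in> carrier G" by (rule c)
    show "fold dn vs (wp us) = \<one>"
      using zcong_fold_dn[OF that(1) c] fold_dn_reduced[OF that(2)] by simp
    show "length vs \<le> len (wp us)" using that by (simp add: reduced_def)
  qed
  show ?thesis
    using *[OF assms] *[OF zcong_sym[OF assms(1)] assms(3,2)] by (metis nat_le_linear)
qed

text \<open>Converse of \<open>zcong_left_absorb\<close>. It turns absorption in the congruence into
  descents, which is how normal forms are seen to be maximal in their double cosets.\<close>

lemma absorbed_descent:
  assumes "reduced ws" "s \<in> S" "zcong (s # ws) ws" shows "len (s \<otimes> wp ws) < len (wp ws)"
proof (rule ccontr)
  assume "\<not> ?thesis"
  then have "reduced (s # ws)" using reduced_Cons_iff assms by simp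
  then have "s \<otimes> wp ws = wp ws" using zcong_reduced_unique[OF assms(3)] assms(1) by simp
  then show False using S_mult_neq[OF assms(2)] reduced_lists[OF assms(1)] by simp
qed

lemma absorbed_right_descent:
  assumes "reduced ws" "s \<in> S" "zcong (ws @ [s]) ws" shows "len (wp ws \<otimes> s) < len (wp ws)"
proof (rule ccontr)
  have ws: "ws \<in> lists S" using assms(1) by (rule reduced_lists)
  assume "\<not> ?thesis"
  moreover have eq: "wp (rev (ws @ [s])) = s \<otimes> inv (wp ws)" using ws assms(2) by (simp add: wp_rev)
  moreover have "len (s \<otimes> inv (wp ws)) = len (inv (s \<otimes> inv (wp ws)))" using ws assms(2) by simp
  ultimately have "\<not> len (s \<otimes> wp (rev ws)) < len (wp (rev ws))"
    using ws assms(2) by (simp add: inv_mult_group wp_rev)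
  then have "reduced (s # rev ws)" using reduced_Cons_iff[OF assms(2) reduced_rev[OF assms(1)]] by simp
  then have "reduced (ws @ [s])" using reduced_rev[of "s # rev ws"] by simp
  then have "wp (ws @ [s]) = wp ws" using zcong_reduced_unique[OF assms(3)] assms(1) by simp
  then have "wp ws \<otimes> s = wp ws" using ws assms(2) by (simp add: wp_append)
  then show False using S_not_one assms(2) ws by simp
qed

text \<open>By Matsumoto's theorem all reduced words of an element use the same letters, and one of
  them lies in I.\<close>

lemma reduced_in_W:
  assumes "I \<subseteq> S" "reduced ws" "wp ws \<in> W I" shows "ws \<in> lists I"
proof -
  obtain us where us: "reduced us" "us \<in> lists I" "wp us = wp ws"
    using W_reduced_word[OF assms(1,3)] by blast
  then show ?thesis using zcong_lists[OF matsumoto[OF us(1) assms(2) us(3)]] by blast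
qed


subsection \<open>Longest elements\<close>

text \<open>Stated by right descents instead of \<open>longest\<close>, since it serves to prove
  that longest elements are unique. Each s in I can be moved to the end of \<open>ws\<close>; there
  it acts last, so it is no descent of the result.\<close>

lemma fold_dn_full:
  assumes "I \<subseteq> S" "reduced ws" "wp ws \<in> W I" "\<And>s. s \<in> I \<Longrightarrow> len (wp ws \<otimes> s) < len (wp ws)"
    and v: "v \<in> carrier G"
  shows "fold dn ws v = dmin I v"
proof -
  have ws: "ws \<in> lists I" "ws \<in> lists S"
    using reduced_in_W[OF assms(1-3)] reduced_lists[OF assms(2)] .
  have c: "fold dn ws v \<in> carrier G" using fold_dn_closed[OF ws(2) v] .
  have "\<not> len (s \<otimes> fold dn ws v) < len (fold dn ws v)" if s: "s \<in> I" for s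
  proof -
    have sS: "s \<in> S" using s assms(1) by blast
    obtain us where us: "reduced (us @ [s])" "zcong ws (us @ [s])"
      using right_descent_word[OF assms(2) sS assms(4)[OF s]] by blast
    have usl: "us \<in> lists S" using reduced_lists[OF us(1)] by simp
    have "fold dn ws v = dn s (fold dn us v)" using zcong_fold_dn[OF us(2) ws(2) v] by simp
    then show ?thesis using dn_nondescent[OF sS fold_dn_closed[OF usl v]] by simp
  qed
  then have "fold dn ws v \<in> lmin I" using c by (simp add: lmin_def)
  then have "dmin I (fold dn ws v) = fold dn ws v" using dmin_fix[OF assms(1)] by blast
  then show ?thesis using fold_dn_coset[OF assms(1) ws(1) v] by simp
qed

lemma \<Lambda>_D: "I \<in> \<Lambda> \<Longrightarrow> I \<subseteq> S" "I \<in> \<Lambda> \<Longrightarrow> finite (W I)"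
  by (simp_all add: \<Lambda>_def)

lemma len_max_descents:
  assumes "I \<subseteq> S" "w \<in> W I" "\<And>v. v \<in> W I \<Longrightarrow> len v \<le> len w" "s \<in> I"
  shows "len (s \<otimes> w) < len w" and "len (w \<otimes> s) < len w"
proof -
  have w: "w \<in> carrier G" using W_closed assms(2,1) .
  have s: "s \<in> S" using assms by blast
  have *: "len (s \<otimes> v) < len v" if "v \<in> carrier G" "len (s \<otimes> v) \<le> len v" for v
    using len_mult_S_neq[OF s that(1)] that(2) by simp
  show "len (s \<otimes> w) < len w" using * w assms(3)[OF W_mult[OF W_gen[OF assms(4)] assms(2)]] by simp
  have "len (w \<otimes> s) \<le> len w" using assms(3)[OF W_mult[OF assms(2) W_gen[OF assms(4)]]] .
  moreover have "len (w \<otimes> s) = len (s \<otimes> inv w)"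
    using len_inv[of "w \<otimes> s"] w s by (simp add: inv_mult_group)
  ultimately show "len (w \<otimes> s) < len w" using *[of "inv w"] w by simp
qed

text \<open>Given two elements of maximal length, a reduced word of one brings the other down to
  \<open>dmin I v\<close>, which is 1 in W_I. As the lengths agree, \<open>fold_dn_one\<close>
  identifies them. This justifies the definite description in \<open>longest\<close>.\<close>

lemma longest_props:
  assumes "I \<in> \<Lambda>"
  shows longest_in: "longest I \<in> W I" and longest_max: "\<And>v. v \<in> W I \<Longrightarrow> len v \<le> len (longest I)"
    and longest_unique: "\<And>v. v \<in> W I \<Longrightarrow> len (longest I) \<le> len v \<Longrightarrow> v = longest I"
proof -
  note I = \<Lambda>_D[OF assms]
  have ex: "\<exists>w. w \<in> W I \<and> (\<forall>v \<in> W I. len v \<le> len w)"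
    using Max_in[of "len ` W I"] Max_ge[of "len ` W I"] I(2) W_one[of I] by fastforce
  have un: "v = w"
    if v: "v \<in> W I" "\<And>u. u \<in> W I \<Longrightarrow> len u \<le> len v" and w: "w \<in> W I" "\<And>u. u \<in> W I \<Longrightarrow> len u \<le> len w"
    for v w
  proof -
    have c: "v \<in> carrier G" "w \<in> carrier G" using W_closed v(1) w(1) I(1) by auto
    obtain ws where ws: "reduced ws" "wp ws = w" using reduced_exists[OF c(2)] by blast
    have "fold dn ws v = dmin I v"
      using fold_dn_full[OF I(1) ws(1) _ _ c(1)] len_max_descents(2)[OF I(1) w] ws(2) w(1) by simp
    then have "fold dn ws v = \<one>" using dmin_W[OF I(1) v(1)] by simp
    moreover have "length ws \<le> len v" using ws v(2)[OF w(1)] by (simp add: reduced_def)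
    ultimately show ?thesis using fold_dn_one[OF reduced_lists[OF ws(1)] c(1)] ws(2) by simp
  qed
  have "\<exists>!w. w \<in> W I \<and> (\<forall>v \<in> W I. len v \<le> len w)" using ex un by blast
  then have *: "longest I \<in> W I \<and> (\<forall>v \<in> W I. len v \<le> len (longest I))"
    unfolding longest_def by (rule theI')
  then show "longest I \<in> W I" and m: "\<And>v. v \<in> W I \<Longrightarrow> len v \<le> len (longest I)" by auto
  show "v = longest I" if "v \<in> W I" "len (longest I) \<le> len v" for v
  proof (rule un)
    show "len u \<le> len v" if "u \<in> W I" for u using m[OF that] \<open>len (longest I) \<le> len v\<close> by simp
  qed (use that * m in auto)
qed

lemma longest_closed: "I \<in> \<Lambda> \<Longrightarrow> longest I \<in> carrier G"
  using W_closed longest_in \<Lambda>_D(1) by metis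

lemma longest_descents:
  assumes "I \<in> \<Lambda>" "s \<in> I"
  shows "len (s \<otimes> longest I) < len (longest I)" "len (longest I \<otimes> s) < len (longest I)"
  using len_max_descents[OF \<Lambda>_D(1) longest_in longest_max] assms by auto

lemma fold_dn_longest:
  assumes "I \<in> \<Lambda>" "reduced ws" "wp ws = longest I" "v \<in> carrier G"
  shows "fold dn ws v = dmin I v"
  using fold_dn_full[OF \<Lambda>_D(1)[OF assms(1)] assms(2) _ _ assms(4)] assms(3)
    longest_in[OF assms(1)] longest_descents(2)[OF assms(1)] by simp

text \<open>Extends an associated expression from I to J. The suffix sits on the right while cosets
  are taken on the left, so w_J is inverted: w_J^(-1) = a d with a in W_I. The length l(w_I) + l(d)
  of w_I^(-1) d is at most l(w_J) = l(a) + l(d), so a^(-1) is as long as w_I.\<close>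

lemma longest_coset:
  assumes "J \<in> \<Lambda>" "I \<subseteq> J"
  obtains ds us where "reduced (ds @ us)" "wp (ds @ us) = longest J" "reduced us" "wp us = longest I"
proof -
  have I: "I \<in> \<Lambda>" using assms W_mono[OF assms(2)] by (auto simp: \<Lambda>_def intro: finite_subset)
  note JS = \<Lambda>_D(1)[OF assms(1)] and IS = \<Lambda>_D(1)[OF I]
  have c: "longest J \<in> carrier G" using longest_closed assms(1) .
  obtain a d where a: "a \<in> W I" "d \<in> lmin I" "inv (longest J) = a \<otimes> d"
    by (rule dmin_decomp[OF IS inv_closed[OF c]])
  have ac: "a \<in> carrier G" "d \<in> carrier G" using W_closed[OF a(1) IS] lmin_closed[OF a(2)] .
  have aJ: "a \<in> W J" using a(1) W_mono[OF assms(2)] by blast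
  have d: "d = inv a \<otimes> inv (longest J)" unfolding a(3) using ac by (simp add: m_assoc[symmetric])
  have dJ: "d \<in> W J"
    unfolding d using W_mult[OF W_inv[OF JS aJ] W_inv[OF JS longest_in[OF assms(1)]]] .
  have lI: "longest I \<in> W I" "longest I \<in> W J" "longest I \<in> carrier G"
    using longest_in[OF I] W_mono[OF assms(2)] longest_closed[OF I] by auto
  have "inv (longest I) \<otimes> d \<in> W J" using W_mult[OF W_inv[OF JS lI(2)] dJ] .
  then have "len (inv (longest I) \<otimes> d) \<le> len (longest J)" using longest_max[OF assms(1)] by blast
  moreover have "len (inv (longest I) \<otimes> d) = len (longest I) + len d"
    using len_mult_lmin[OF IS W_inv[OF IS lI(1)] a(2)] lI(3) by simp
  moreover have "len (longest J) = len a + len d"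
    using len_mult_lmin[OF IS a(1,2)] a(3) len_inv[OF c] by simp
  ultimately have "len (longest I) \<le> len (inv a)" using ac by simp
  then have ia: "inv a = longest I" using longest_unique[OF I W_inv[OF IS a(1)]] by blast
  obtain us where us: "reduced us" "wp us = a" using reduced_exists ac(1) by blast
  obtain ds where ds: "reduced ds" "wp ds = d" using reduced_exists ac(2) by blast
  have "reduced (us @ ds)"
    using reduced_append_lmin[OF IS reduced_in_W[OF IS us(1)] us(1) ds(1)] us ds a by simp
  then have "reduced (rev ds @ rev us)" using reduced_rev by fastforce
  moreover have "wp (rev (us @ ds)) = longest J"
    using wp_rev[of "us @ ds"] us ds a(3) c ac reduced_lists[OF us(1)] reduced_lists[OF ds(1)]
    by (simp add: wp_append inv_mult_group) (metis a(3) inv_inv inv_mult_group)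
  moreover have "wp (rev us) = longest I" using wp_rev[OF reduced_lists[OF us(1)]] us(2) ia by simp
  ultimately show ?thesis using that[of "rev ds" "rev us"] reduced_rev[OF us(1)] by simp
qed

lemma longest_empty: "longest {} = \<one>"
  using longest_in[of "{}"] by (simp add: \<Lambda>_def)

lemma longest_singleton: assumes "s \<in> S" shows "{s} \<in> \<Lambda>" "longest {s} = s"
proof -
  have "(s \<otimes> s) [^] (1::nat) = \<one>" using assms S_involution by simp
  then have "finite (W {s})" using dihedral_finite[OF assms assms, of 1] by simp
  then show L: "{s} \<in> \<Lambda>" using assms by (simp add: \<Lambda>_def)
  have "len v \<le> 1" if "v \<in> W {s}" for v
    using dihedral_len(1)[OF assms assms, of 1 v] that assms S_involution by simp
  then have "len (longest {s}) \<le> len s" using longest_in[OF L] assms by simp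
  then show "longest {s} = s" using longest_unique[OF L W_gen] by simp
qed

end


context hecke_algebra
begin

sublocale H: ring H
  by (rule H_ring)

sublocale HM: module Zq H
  by (rule H_module)


subsection \<open>Coefficients in the standard basis\<close>

abbreviation qq :: "int poly" where
  "qq \<equiv> [:0, 1:]"

definition cf :: "'h \<Rightarrow> 'w \<Rightarrow> int poly" where
  "cf x = (THE c. finite {w. c w \<noteq> 0} \<and> {w. c w \<noteq> 0} \<subseteq> carrier G \<and>
    x = finsum H (\<lambda>w. c w \<odot>\<^bsub>H\<^esub> T w) {w. c w \<noteq> 0})"

definition lin :: "('w \<Rightarrow> int poly) \<Rightarrow> 'h" where
  "lin c = finsum H (\<lambda>w. c w \<odot>\<^bsub>H\<^esub> T w) {w. c w \<noteq> 0}"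

definition fsupp :: "('w \<Rightarrow> int poly) \<Rightarrow> bool" where
  "fsupp c \<longleftrightarrow> finite {w. c w \<noteq> 0} \<and> {w. c w \<noteq> 0} \<subseteq> carrier G"

text \<open>Setting q = 0 identifies H modulo q with the integer functions of finite support on
  W.\<close>

definition c0 :: "'h \<Rightarrow> 'w \<Rightarrow> int" where
  "c0 x w = poly (cf x w) 0"

lemma smult_closed [simp]: "x \<in> carrier H \<Longrightarrow> a \<odot>\<^bsub>H\<^esub> x \<in> carrier H"
  using HM.smult_closed[of a x] by simp

lemma smult_add: "x \<in> carrier H \<Longrightarrow> y \<in> carrier H \<Longrightarrow> a \<odot>\<^bsub>H\<^esub> (x \<oplus>\<^bsub>H\<^esub> y) = a \<odot>\<^bsub>H\<^esub> x \<oplus>\<^bsub>H\<^esub> a \<odot>\<^bsub>H\<^esub> y"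
  using HM.smult_r_distr[of a x y] by simp

lemma add_smult: "x \<in> carrier H \<Longrightarrow> (a + b) \<odot>\<^bsub>H\<^esub> x = a \<odot>\<^bsub>H\<^esub> x \<oplus>\<^bsub>H\<^esub> b \<odot>\<^bsub>H\<^esub> x"
  using HM.smult_l_distr[of a b x] by simp

lemma smult_smult: "x \<in> carrier H \<Longrightarrow> a \<odot>\<^bsub>H\<^esub> (b \<odot>\<^bsub>H\<^esub> x) = (a * b) \<odot>\<^bsub>H\<^esub> x"
  using HM.smult_assoc1[of a b x] by simp

lemma one_smult [simp]: "x \<in> carrier H \<Longrightarrow> 1 \<odot>\<^bsub>H\<^esub> x = x"
  using HM.smult_one[of x] by simp

lemma zero_smult [simp]: "x \<in> carrier H \<Longrightarrow> 0 \<odot>\<^bsub>H\<^esub> x = \<zero>\<^bsub>H\<^esub>"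
  using HM.smult_l_null[of x] by simp

lemma smult_zero [simp]: "a \<odot>\<^bsub>H\<^esub> \<zero>\<^bsub>H\<^esub> = \<zero>\<^bsub>H\<^esub>"
  using HM.smult_r_null[of a] by simp

lemma cf_props:
  assumes "x \<in> carrier H" shows fsupp_cf: "fsupp (cf x)" and lin_cf: "lin (cf x) = x"
  using theI'[OF T_basis[OF assms]] unfolding cf_def[symmetric] fsupp_def lin_def by auto

lemma lin_closed [simp]: "fsupp c \<Longrightarrow> lin c \<in> carrier H"
  unfolding lin_def fsupp_def by (intro H.finsum_closed) (auto simp: T_closed)

lemma cf_lin: assumes "fsupp c" shows "cf (lin c) = c"
proof -
  have "fsupp c \<and> lin c = finsum H (\<lambda>w. c w \<odot>\<^bsub>H\<^esub> T w) {w. c w \<noteq> 0}"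
    using assms by (simp add: lin_def)
  then show ?thesis
    using T_basis[OF lin_closed[OF assms]] theI'[OF T_basis[OF lin_closed[OF assms]]]
    unfolding cf_def[symmetric] fsupp_def by blast
qed

lemma lin_superset:
  assumes "finite A" "A \<subseteq> carrier G" "{w. c w \<noteq> 0} \<subseteq> A"
  shows "lin c = finsum H (\<lambda>w. c w \<odot>\<^bsub>H\<^esub> T w) A"
  unfolding lin_def
  using assms T_closed
  by (intro H.add.finprod_mono_neutral_cong_left) (auto simp: Pi_iff subset_iff)

lemma lin_add: assumes "fsupp c" "fsupp d" shows "lin (\<lambda>w. c w + d w) = lin c \<oplus>\<^bsub>H\<^esub> lin d"
proof -
  let ?A = "{w. c w \<noteq> 0} \<union> {w. d w \<noteq> 0}"
  have A: "finite ?A" "?A \<subseteq> carrier G" using assms by (auto simp: fsupp_def)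
  have "lin (\<lambda>w. c w + d w) = finsum H (\<lambda>w. (c w + d w) \<odot>\<^bsub>H\<^esub> T w) ?A"
    using A by (intro lin_superset) auto
  also have "\<dots> = finsum H (\<lambda>w. c w \<odot>\<^bsub>H\<^esub> T w \<oplus>\<^bsub>H\<^esub> d w \<odot>\<^bsub>H\<^esub> T w) ?A"
    using A by (intro H.finsum_cong') (auto simp: T_closed add_smult subset_iff)
  also have "\<dots> = finsum H (\<lambda>w. c w \<odot>\<^bsub>H\<^esub> T w) ?A \<oplus>\<^bsub>H\<^esub> finsum H (\<lambda>w. d w \<odot>\<^bsub>H\<^esub> T w) ?A"
    using A by (intro H.finsum_addf) (auto simp: T_closed subset_iff)
  also have "finsum H (\<lambda>w. c w \<odot>\<^bsub>H\<^esub> T w) ?A = lin c"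
    using A by (intro lin_superset[symmetric]) auto
  also have "finsum H (\<lambda>w. d w \<odot>\<^bsub>H\<^esub> T w) ?A = lin d"
    using A by (intro lin_superset[symmetric]) auto
  finally show ?thesis .
qed

lemma lin_smult: assumes "fsupp c" shows "lin (\<lambda>w. a * c w) = a \<odot>\<^bsub>H\<^esub> lin c"
proof -
  let ?A = "{w. c w \<noteq> 0}"
  have A: "finite ?A" "?A \<subseteq> carrier G" using assms by (auto simp: fsupp_def)
  have "lin (\<lambda>w. a * c w) = finsum H (\<lambda>w. (a * c w) \<odot>\<^bsub>H\<^esub> T w) ?A"
    using A by (intro lin_superset) auto
  also have "\<dots> = finsum H (\<lambda>w. a \<odot>\<^bsub>H\<^esub> (c w \<odot>\<^bsub>H\<^esub> T w)) ?A"
    using A by (intro H.finsum_cong') (auto simp: T_closed smult_smult subset_iff)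
  also have "\<dots> = a \<odot>\<^bsub>H\<^esub> lin c"
    unfolding lin_def using A by (intro HM.finsum_smult_ldistr[symmetric]) (auto simp: T_closed subset_iff)
  finally show ?thesis .
qed

lemma fsupp_add: "fsupp c \<Longrightarrow> fsupp d \<Longrightarrow> fsupp (\<lambda>w. c w + d w)"
  unfolding fsupp_def
  by (auto intro!: finite_subset[of _ "{w. c w \<noteq> 0} \<union> {w. d w \<noteq> 0}"] simp: subset_iff) force

lemma fsupp_smult: "fsupp c \<Longrightarrow> fsupp (\<lambda>w. a * c w)"
  unfolding fsupp_def by (auto intro: finite_subset[of _ "{w. c w \<noteq> 0}"] simp: subset_iff)

lemma cf_add: assumes "x \<in> carrier H" "y \<in> carrier H" shows "cf (x \<oplus>\<^bsub>H\<^esub> y) w = cf x w + cf y w"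
proof -
  have "x \<oplus>\<^bsub>H\<^esub> y = lin (\<lambda>w. cf x w + cf y w)"
    using lin_add[OF fsupp_cf fsupp_cf] lin_cf assms by simp
  then show ?thesis using cf_lin fsupp_add fsupp_cf assms by simp
qed

lemma cf_smult: assumes "x \<in> carrier H" shows "cf (a \<odot>\<^bsub>H\<^esub> x) w = a * cf x w"
proof -
  have "a \<odot>\<^bsub>H\<^esub> x = lin (\<lambda>w. a * cf x w)"
    using lin_smult[OF fsupp_cf] lin_cf assms by simp
  then show ?thesis using cf_lin fsupp_smult fsupp_cf assms by simp
qed

lemma cf_inject: "x \<in> carrier H \<Longrightarrow> y \<in> carrier H \<Longrightarrow> (\<And>w. cf x w = cf y w) \<Longrightarrow> x = y"
  using lin_cf ext by metis

lemma cf_outside: "x \<in> carrier H \<Longrightarrow> w \<notin> carrier G \<Longrightarrow> cf x w = 0"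
  using fsupp_cf unfolding fsupp_def by blast

lemma cf_zero [simp]: "cf \<zero>\<^bsub>H\<^esub> w = 0"
  using cf_smult[of "\<zero>\<^bsub>H\<^esub>" 0 w] by simp

lemma cf_T: assumes "v \<in> carrier G" shows "cf (T v) w = (if w = v then 1 else 0)"
proof -
  have fs: "fsupp (\<lambda>w. if w = v then 1 else 0)" using assms by (auto simp: fsupp_def)
  have "lin (\<lambda>w. if w = v then 1 else 0) =
      finsum H (\<lambda>w. (if w = v then 1 else 0) \<odot>\<^bsub>H\<^esub> T w) {v}"
    using assms by (intro lin_superset) auto
  also have "\<dots> = T v" using assms by (simp add: T_closed)
  finally show ?thesis using cf_lin[OF fs] by simp
qed

lemma cf_finsum:
  assumes "f \<in> A \<rightarrow> carrier H" shows "cf (finsum H f A) w = (\<Sum>a\<in>A. cf (f a) w)"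
proof (cases "finite A")
  case True
  then show ?thesis using assms
    by (induction A) (auto simp: cf_add Pi_iff)
qed simp

lemma H_induct [consumes 1, case_names zero add smult_T]:
  assumes "x \<in> carrier H" "P \<zero>\<^bsub>H\<^esub>"
    "\<And>x y. x \<in> carrier H \<Longrightarrow> y \<in> carrier H \<Longrightarrow> P x \<Longrightarrow> P y \<Longrightarrow> P (x \<oplus>\<^bsub>H\<^esub> y)"
    "\<And>a w. w \<in> carrier G \<Longrightarrow> P (a \<odot>\<^bsub>H\<^esub> T w)"
  shows "P x"
proof -
  have *: "P (finsum H (\<lambda>w. c w \<odot>\<^bsub>H\<^esub> T w) A)" if "finite A" "A \<subseteq> carrier G" for c A
    using that
  proof (induction A)
    case (insert a A)
    have "(\<lambda>w. c w \<odot>\<^bsub>H\<^esub> T w) \<in> A \<rightarrow> carrier H" using insert by (auto simp: T_closed subset_iff)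
    then show ?case using insert T_closed by (auto intro!: assms(3,4) H.finsum_closed)
  qed (simp add: assms(2))
  show ?thesis using *[of "{w. cf x w \<noteq> 0}" "cf x"] fsupp_cf[OF assms(1)] lin_cf[OF assms(1)]
    by (simp add: fsupp_def lin_def)
qed

lemma c0_add: "x \<in> carrier H \<Longrightarrow> y \<in> carrier H \<Longrightarrow> c0 (x \<oplus>\<^bsub>H\<^esub> y) w = c0 x w + c0 y w"
  by (simp add: c0_def cf_add)

lemma c0_smult: "x \<in> carrier H \<Longrightarrow> c0 (a \<odot>\<^bsub>H\<^esub> x) w = poly a 0 * c0 x w"
  by (simp add: c0_def cf_smult)

lemma c0_zero [simp]: "c0 \<zero>\<^bsub>H\<^esub> w = 0"
  by (simp add: c0_def)

lemma c0_T: "v \<in> carrier G \<Longrightarrow> c0 (T v) w = (if w = v then 1 else 0)"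
  by (simp add: c0_def cf_T)

lemma c0_outside: "x \<in> carrier H \<Longrightarrow> w \<notin> carrier G \<Longrightarrow> c0 x w = 0"
  by (simp add: c0_def cf_outside)

lemma c0_finite: assumes "x \<in> carrier H" shows "finite {w. c0 x w \<noteq> 0}"
proof (rule finite_subset)
  show "{w. c0 x w \<noteq> 0} \<subseteq> {w. cf x w \<noteq> 0}" by (auto simp: c0_def)
  show "finite {w. cf x w \<noteq> 0}" using fsupp_cf[OF assms] by (simp add: fsupp_def)
qed

lemma smult_q_inject:
  assumes "x \<in> carrier H" "y \<in> carrier H" "qq \<odot>\<^bsub>H\<^esub> x = qq \<odot>\<^bsub>H\<^esub> y" shows "x = y"
proof (rule cf_inject[OF assms(1,2)])
  fix w
  have "qq * cf x w = qq * cf y w" using cf_smult assms by metis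
  then show "cf x w = cf y w" by (metis mult_left_cancel pCons_eq_0_iff zero_neq_one)
qed

section \<open>Products of basis elements\<close>

lemma T_mult:
  assumes "v \<in> carrier G" "w \<in> carrier G" "len (v \<otimes> w) = len v + len w"
  shows "T v \<otimes>\<^bsub>H\<^esub> T w = T (v \<otimes> w)"
proof -
  obtain us where us: "reduced us" "wp us = v" using reduced_exists assms(1) by blast
  obtain vs where vs: "reduced vs" "wp vs = w" using reduced_exists assms(2) by blast
  have l: "us \<in> lists S" "vs \<in> lists S" using us vs reduced_lists by auto
  have TS: "set (map T ws) \<subseteq> carrier H" if "ws \<in> lists S" for ws
    using that T_closed by auto
  have "reduced (us @ vs)" using us vs l assms(3) by (simp add: reduced_def wp_append)
  then have "T (wp (us @ vs)) = word_prod H (map T (us @ vs))" by (rule T_reduced)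
  also have "\<dots> = word_prod H (map T us) \<otimes>\<^bsub>H\<^esub> word_prod H (map T vs)"
    using H.word_prod_append[OF TS[OF l(1)] TS[OF l(2)]] by simp
  also have "\<dots> = T v \<otimes>\<^bsub>H\<^esub> T w" using T_reduced[OF us(1)] T_reduced[OF vs(1)] us vs by simp
  finally show ?thesis using us vs l by (simp add: wp_append)
qed

lemma T_one: "T \<one> = \<one>\<^bsub>H\<^esub>"
  using T_reduced[of "[]"] by (simp add: reduced_def)

lemma len_right_cases:
  assumes "s \<in> S" "w \<in> carrier G"
  shows "len (w \<otimes> s) = Suc (len w) \<or> len w = Suc (len (w \<otimes> s))"
proof -
  have "len (w \<otimes> s) = len (s \<otimes> inv w)"
    using len_inv[of "w \<otimes> s"] assms by (simp add: inv_mult_group)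
  then show ?thesis using len_up[of s "inv w"] len_down[of s "inv w"] assms by fastforce
qed

lemma T_mult_S_up:
  assumes "s \<in> S" "w \<in> carrier G" "len w < len (w \<otimes> s)" shows "T w \<otimes>\<^bsub>H\<^esub> T s = T (w \<otimes> s)"
  using T_mult[of w s] len_right_cases[OF assms(1,2)] assms by auto

lemma T_mult_S_down:
  assumes "s \<in> S" "w \<in> carrier G" "len (w \<otimes> s) < len w"
  shows "T w \<otimes>\<^bsub>H\<^esub> T s = (qq - 1) \<odot>\<^bsub>H\<^esub> T w \<oplus>\<^bsub>H\<^esub> qq \<odot>\<^bsub>H\<^esub> T (w \<otimes> s)"
proof -
  have c: "T w \<in> carrier H" "T (w \<otimes> s) \<in> carrier H" "T s \<in> carrier H" using assms T_closed by auto
  have w: "T w = T (w \<otimes> s) \<otimes>\<^bsub>H\<^esub> T s"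
    using T_mult_S_up[of s "w \<otimes> s"] assms S_cancel_right[of s w] by simp
  then have "T w \<otimes>\<^bsub>H\<^esub> T s = T (w \<otimes> s) \<otimes>\<^bsub>H\<^esub> (T s \<otimes>\<^bsub>H\<^esub> T s)"
    using c by (simp add: H.m_assoc)
  also have "\<dots> = (qq - 1) \<odot>\<^bsub>H\<^esub> (T (w \<otimes> s) \<otimes>\<^bsub>H\<^esub> T s) \<oplus>\<^bsub>H\<^esub> qq \<odot>\<^bsub>H\<^esub> T (w \<otimes> s)"
    using c T_quadratic[OF assms(1)] by (simp add: H.r_distr H_smult_r)
  finally show ?thesis using w by simp
qed

text \<open>At q = 0 the quadratic relation reads T_s T_s = - T_s, so T_w T_s is T_(ws) if ws is
  longer and - T_w otherwise. Either way the result is supported on an element with right descent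
  s.\<close>

lemma c0_mult_S:
  assumes "x \<in> carrier H" "s \<in> S" "v \<in> carrier G"
  shows "c0 (x \<otimes>\<^bsub>H\<^esub> T s) v = (if len (v \<otimes> s) < len v then c0 x (v \<otimes> s) - c0 x v else 0)"
  using assms(1)
proof (induction rule: H_induct)
  case zero
  then show ?case using assms T_closed by simp
next
  case (add x y)
  then show ?case using assms T_closed by (simp add: H.l_distr c0_add)
next
  case (smult_T a w)
  have s: "s \<in> carrier G" using assms by simp
  have eq: "v \<otimes> s = w \<longleftrightarrow> v = w \<otimes> s"
    using S_cancel_right[OF assms(2)] assms(3) smult_T by metis
  have "c0 (T w \<otimes>\<^bsub>H\<^esub> T s) v = (if len (v \<otimes> s) < len v then c0 (T w) (v \<otimes> s) - c0 (T w) v else 0)"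
  proof (cases "len w < len (w \<otimes> s)")
    case True
    then have "c0 (T w \<otimes>\<^bsub>H\<^esub> T s) v = (if v = w \<otimes> s then 1 else 0)"
      using T_mult_S_up[OF assms(2) smult_T] smult_T s by (simp add: c0_T)
    then show ?thesis using True eq smult_T s S_cancel_right[OF assms(2) smult_T] by (auto simp: c0_T)
  next
    case False
    then have d: "len (w \<otimes> s) < len w" using len_right_cases[OF assms(2) smult_T] by auto
    then have "c0 (T w \<otimes>\<^bsub>H\<^esub> T s) v = - (if v = w then 1 else 0)"
      using T_mult_S_down[OF assms(2) smult_T] smult_T s T_closed by (simp add: c0_add c0_smult c0_T)
    then show ?thesis using d eq smult_T s S_cancel_right[OF assms(2) smult_T] by (auto simp: c0_T)
  qed
  then show ?case using smult_T assms T_closed by (simp add: H_smult_l c0_smult algebra_simps)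
qed

text \<open>At q = 0 the hypothesis becomes x T_s = 0. By \<open>c0_mult_S\<close> the coefficient
  of this product at an element with right descent s is a difference of two values of
  \<open>c0 x\<close>.\<close>

lemma right_invariant:
  assumes "x \<in> carrier H" "s \<in> S" "v \<in> carrier G" "x \<otimes>\<^bsub>H\<^esub> T s = qq \<odot>\<^bsub>H\<^esub> x"
  shows "c0 x (v \<otimes> s) = c0 x v"
proof -
  have *: "c0 x (u \<otimes> s) = c0 x u" if "u \<in> carrier G" "len (u \<otimes> s) < len u" for u
    using c0_mult_S[OF assms(1,2) that(1)] that(2) assms(1) by (simp add: assms(4) c0_smult)
  show ?thesis
  proof (cases "len (v \<otimes> s) < len v")
    case True
    then show ?thesis using * assms by simp
  next
    case False
    then have "len v < len (v \<otimes> s)" using len_right_cases[OF assms(2,3)] by auto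
    then show ?thesis using *[of "v \<otimes> s"] assms S_cancel_right[OF assms(2,3)] by simp
  qed
qed


subsection \<open>The elements \<open>x\<^sub>I\<close>\<close>

lemma x_par_closed [simp]: "I \<subseteq> S \<Longrightarrow> x_par I \<in> carrier H"
  unfolding x_par_def by (intro H.finsum_closed) (auto simp: T_closed W_closed)

text \<open>The elements of W_I pair off as w and the longer ws, and (T_w + T_(ws)) T_s = q (T_w +
  T_(ws)) by the quadratic relation.\<close>

lemma x_par_mult_S:
  assumes "I \<in> \<Lambda>" "s \<in> I"
  shows "x_par I \<otimes>\<^bsub>H\<^esub> T s = qq \<odot>\<^bsub>H\<^esub> x_par I"
proof -
  note I = \<Lambda>_D[OF assms(1)]
  have s: "s \<in> S" "s \<in> carrier G" "s \<in> W I" using assms I W_gen by auto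
  let ?A = "{w \<in> W I. len w < len (w \<otimes> s)}"
  let ?B = "(\<lambda>w. w \<otimes> s) ` ?A"
  have Wc: "w \<in> carrier G" if "w \<in> W I" for w using W_closed[OF that I(1)] .
  have un: "W I = ?A \<union> ?B"
  proof (intro equalityI subsetI)
    fix w assume w: "w \<in> W I"
    show "w \<in> ?A \<union> ?B"
    proof (cases "len w < len (w \<otimes> s)")
      case False
      then have "len (w \<otimes> s) < len w" using len_right_cases[OF s(1) Wc[OF w]] by auto
      then have "w \<otimes> s \<in> ?A" using W_mult[OF w s(3)] S_cancel_right[OF s(1) Wc[OF w]] by simp
      then have "w \<otimes> s \<otimes> s \<in> ?B" by (rule imageI)
      then show ?thesis using S_cancel_right[OF s(1) Wc[OF w]] by simp
    qed (use w in simp)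
  qed (auto intro: W_mult s(3))
  have disj: "?A \<inter> ?B = {}" using S_cancel_right[OF s(1) Wc] by fastforce
  have fin: "finite ?A" "finite ?B" using I(2) by auto
  have inj: "inj_on (\<lambda>w. w \<otimes> s) ?A" using Wc s by (auto intro!: inj_onI)
  have TA: "T \<in> ?A \<rightarrow> carrier H" "T \<in> ?B \<rightarrow> carrier H"
    "(\<lambda>w. T (w \<otimes> s)) \<in> ?A \<rightarrow> carrier H"
    using Wc s T_closed by auto
  let ?f = "\<lambda>w. T w \<oplus>\<^bsub>H\<^esub> T (w \<otimes> s)"
  have "x_par I = finsum H T ?A \<oplus>\<^bsub>H\<^esub> finsum H T ?B"
    unfolding x_par_def by (subst un) (rule H.finsum_Un_disjoint[OF fin disj TA(1,2)])
  also have "finsum H T ?B = finsum H (\<lambda>w. T (w \<otimes> s)) ?A"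
    using TA(2) by (intro H.finsum_reindex inj) auto
  finally have x: "x_par I = finsum H ?f ?A" using H.finsum_addf[OF TA(1,3)] by simp
  have "?f w \<otimes>\<^bsub>H\<^esub> T s = qq \<odot>\<^bsub>H\<^esub> ?f w" if w: "w \<in> ?A" for w
  proof -
    have wc: "w \<in> carrier G" "w \<otimes> s \<in> carrier G" using w Wc s by auto
    then have c: "T w \<in> carrier H" "T (w \<otimes> s) \<in> carrier H" "T s \<in> carrier H" using T_closed s by auto
    have "?f w \<otimes>\<^bsub>H\<^esub> T s = T (w \<otimes> s) \<oplus>\<^bsub>H\<^esub> ((qq - 1) \<odot>\<^bsub>H\<^esub> T (w \<otimes> s) \<oplus>\<^bsub>H\<^esub> qq \<odot>\<^bsub>H\<^esub> T w)"
      using T_mult_S_up[OF s(1) wc(1)] T_mult_S_down[OF s(1) wc(2)] w c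
        S_cancel_right[OF s(1) wc(1)] by (simp add: H.l_distr)
    also have "\<dots> = (1 + (qq - 1)) \<odot>\<^bsub>H\<^esub> T (w \<otimes> s) \<oplus>\<^bsub>H\<^esub> qq \<odot>\<^bsub>H\<^esub> T w"
      unfolding add_smult[OF c(2)] using c by (simp add: H.a_assoc)
    also have "\<dots> = qq \<odot>\<^bsub>H\<^esub> ?f w" using c by (simp add: smult_add H.a_comm)
    finally show ?thesis .
  qed
  then have "finsum H (\<lambda>w. ?f w \<otimes>\<^bsub>H\<^esub> T s) ?A = finsum H (\<lambda>w. qq \<odot>\<^bsub>H\<^esub> ?f w) ?A"
    using TA by (intro H.finsum_cong') (auto simp: Pi_iff)
  then show ?thesis unfolding x
    using H.finsum_ldistr[OF fin(1), of "T s" ?f] HM.finsum_smult_ldistr[OF fin(1), of qq ?f] TA s T_closed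
    by (simp add: Pi_iff)
qed

lemma x_par_mult_T:
  assumes "I \<in> \<Lambda>" "a \<in> W I" shows "x_par I \<otimes>\<^bsub>H\<^esub> T a = qq ^ len a \<odot>\<^bsub>H\<^esub> x_par I"
proof -
  note I = \<Lambda>_D[OF assms(1)]
  have x: "x_par I \<in> carrier H" using I by simp
  have "x_par I \<otimes>\<^bsub>H\<^esub> T (wp us) = qq ^ length us \<odot>\<^bsub>H\<^esub> x_par I" if "reduced us" "us \<in> lists I" for us
    using that
  proof (induction us)
    case Nil
    then show ?case using x T_one by simp
  next
    case (Cons s us)
    have s: "s \<in> I" "s \<in> S" "us \<in> lists S" "us \<in> lists I" using Cons.prems I by auto
    have r: "reduced us" using reduced_tl[OF Cons.prems(1)] .
    have c: "T s \<in> carrier H" "T (wp us) \<in> carrier H" using s T_closed by auto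
    have "T (wp (s # us)) = T s \<otimes>\<^bsub>H\<^esub> T (wp us)"
      using T_mult[of s "wp us"] Cons.prems(1) r s by (simp add: reduced_def)
    then have "x_par I \<otimes>\<^bsub>H\<^esub> T (wp (s # us)) = (x_par I \<otimes>\<^bsub>H\<^esub> T s) \<otimes>\<^bsub>H\<^esub> T (wp us)"
      using c x by (simp add: H.m_assoc)
    also have "\<dots> = qq \<odot>\<^bsub>H\<^esub> (x_par I \<otimes>\<^bsub>H\<^esub> T (wp us))"
      using x_par_mult_S[OF assms(1) s(1)] c x by (simp add: H_smult_l)
    also have "\<dots> = (qq * qq ^ length us) \<odot>\<^bsub>H\<^esub> x_par I"
      unfolding Cons.IH[OF r s(4)] using x by (rule smult_smult)
    finally show ?case by simp
  qed
  moreover obtain us where "reduced us" "us \<in> lists I" "wp us = a"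
    using W_reduced_word[OF I(1) assms(2)] by blast
  ultimately show ?thesis by (auto simp: reduced_def)
qed

lemma cf_x_par_T:
  assumes "I \<in> \<Lambda>" "d \<in> lmin I" "v \<in> carrier G"
  shows "cf (x_par I \<otimes>\<^bsub>H\<^esub> T d) v = (if dmin I v = d then 1 else 0)"
proof -
  note I = \<Lambda>_D[OF assms(1)]
  have d: "d \<in> carrier G" using lmin_closed assms(2) .
  have Wc: "w \<in> carrier G" if "w \<in> W I" for w using W_closed[OF that I(1)] .
  have "x_par I \<otimes>\<^bsub>H\<^esub> T d = finsum H (\<lambda>a. T a \<otimes>\<^bsub>H\<^esub> T d) (W I)"
    unfolding x_par_def using I(2) Wc T_closed d by (intro H.finsum_ldistr) auto
  also have "\<dots> = finsum H (\<lambda>a. T (a \<otimes> d)) (W I)"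
    using Wc d T_closed len_mult_lmin[OF I(1) _ assms(2)] T_mult
    by (intro H.finsum_cong') auto
  finally have "cf (x_par I \<otimes>\<^bsub>H\<^esub> T d) v = (\<Sum>a\<in>W I. cf (T (a \<otimes> d)) v)"
    using Wc d T_closed by (simp add: cf_finsum Pi_iff)
  also have "\<dots> = (\<Sum>a\<in>W I. if v = a \<otimes> d then 1 else 0)"
    using Wc d by (intro sum.cong) (auto simp: cf_T)
  also have "\<dots> = (if dmin I v = d then 1 else 0)"
  proof (cases "dmin I v = d")
    case True
    obtain b e where b: "b \<in> W I" "e \<in> lmin I" "v = b \<otimes> e" "dmin I v = e"
      by (rule dmin_decomp[OF I(1) assms(3)])
    then have eq: "v = a \<otimes> d \<longleftrightarrow> a = b" if "a \<in> W I" for a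
      using True d Wc[OF that] Wc[OF b(1)] by auto
    then have "(\<Sum>a\<in>W I. if v = a \<otimes> d then 1 else 0) = (\<Sum>a\<in>W I. if a = b then 1 else (0 :: int poly))"
      by (intro sum.cong) auto
    then show ?thesis using True b(1) I(2) by simp
  next
    case False
    then have "v \<noteq> a \<otimes> d" if "a \<in> W I" for a using dmin_eqI[OF I(1) that assms(2)] by auto
    then show ?thesis using False by (intro HOL.trans[OF sum.neutral]) auto
  qed
  finally show ?thesis .
qed

text \<open>For w = a d with d minimal, x_I T_w = q^l(a) x_I T_d is q^l(a) times the indicator
  function of W_I d. The formula collects these contributions over the coset of v.\<close>

lemma cf_x_par_mult:
  assumes "I \<in> \<Lambda>" "y \<in> carrier H" "v \<in> carrier G"
  shows "cf (x_par I \<otimes>\<^bsub>H\<^esub> y) v = (\<Sum>b\<in>W I. qq ^ len b * cf y (b \<otimes> dmin I v))"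
  using assms(2)
proof (induction rule: H_induct)
  case zero
  then show ?case using \<Lambda>_D[OF assms(1)] by simp
next
  case (add x y)
  then show ?case using \<Lambda>_D[OF assms(1)] by (simp add: H.r_distr cf_add sum.distrib distrib_left)
next
  case (smult_T c w)
  note I = \<Lambda>_D[OF assms(1)]
  have x: "x_par I \<in> carrier H" using I by simp
  obtain a d where a: "a \<in> W I" "d \<in> lmin I" "w = a \<otimes> d" "dmin I w = d"
    by (rule dmin_decomp[OF I(1) smult_T])
  have Wc: "w \<in> carrier G" if "w \<in> W I" for w using W_closed[OF that I(1)] .
  have d: "d \<in> carrier G" using lmin_closed a(2) .
  have Tc: "T a \<in> carrier H" "T d \<in> carrier H" "T w \<in> carrier H" using T_closed Wc a d smult_T by auto
  have "T w = T a \<otimes>\<^bsub>H\<^esub> T d" unfolding a(3)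
    using T_mult[OF Wc[OF a(1)] d len_mult_lmin[OF I(1) a(1,2)]] by simp
  then have "x_par I \<otimes>\<^bsub>H\<^esub> T w = (x_par I \<otimes>\<^bsub>H\<^esub> T a) \<otimes>\<^bsub>H\<^esub> T d"
    using x Tc by (simp add: H.m_assoc)
  also have "\<dots> = qq ^ len a \<odot>\<^bsub>H\<^esub> (x_par I \<otimes>\<^bsub>H\<^esub> T d)"
    using x_par_mult_T[OF assms(1) a(1)] x Tc by (simp add: H_smult_l)
  finally have L: "cf (x_par I \<otimes>\<^bsub>H\<^esub> T w) v = (if dmin I v = d then qq ^ len a else 0)"
    using cf_x_par_T[OF assms(1) a(2) assms(3)] x Tc by (simp add: cf_smult)
  have dv: "dmin I v \<in> lmin I" "dmin I v \<in> carrier G"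
    using dmin_lmin[OF I(1) assms(3)] lmin_closed by auto
  have "(\<Sum>b\<in>W I. qq ^ len b * cf (T w) (b \<otimes> dmin I v)) =
      (\<Sum>b\<in>W I. if b = a \<and> dmin I v = d then qq ^ len a else 0)"
  proof (intro sum.cong HOL.refl)
    fix b assume b: "b \<in> W I"
    have "b \<otimes> dmin I v = w \<longleftrightarrow> b = a \<and> dmin I v = d"
      using lmin_unique[OF I(1) b dv(1) a(1,2)] a(3) Wc[OF b] Wc[OF a(1)] d by auto
    then show "qq ^ len b * cf (T w) (b \<otimes> dmin I v) = (if b = a \<and> dmin I v = d then qq ^ len a else 0)"
      using smult_T by (auto simp: cf_T)
  qed
  also have "\<dots> = (if dmin I v = d then qq ^ len a else 0)"
    using I(2) a(1) by (cases "dmin I v = d") auto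
  finally have "cf (x_par I \<otimes>\<^bsub>H\<^esub> T w) v = (\<Sum>b\<in>W I. qq ^ len b * cf (T w) (b \<otimes> dmin I v))"
    using L by simp
  then show ?case using x Tc by (simp add: H_smult_r cf_smult sum_distrib_left ac_simps)
qed

text \<open>At q = 0 the weight q^l(b) survives only for b = 1, where 0^0 = 1. So left
  multiplication by x_I becomes composition with \<open>dmin I\<close>.\<close>

lemma c0_x_par_mult:
  assumes "I \<in> \<Lambda>" "y \<in> carrier H" "v \<in> carrier G"
  shows "c0 (x_par I \<otimes>\<^bsub>H\<^esub> y) v = c0 y (dmin I v)"
proof -
  note I = \<Lambda>_D[OF assms(1)]
  have "c0 (x_par I \<otimes>\<^bsub>H\<^esub> y) v = (\<Sum>b\<in>W I. 0 ^ len b * c0 y (b \<otimes> dmin I v))"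
    unfolding c0_def cf_x_par_mult[OF assms] by (simp add: poly_sum)
  also have "\<dots> = (\<Sum>b\<in>W I. if b = \<one> then c0 y (dmin I v) else 0)"
    using I(1) assms(3) len_eq_0[OF W_closed[OF _ I(1)]]
    by (intro sum.cong) (auto simp: zero_power)
  also have "\<dots> = c0 y (dmin I v)" using I(2) W_one by simp
  finally show ?thesis .
qed

lemma q_divides:
  assumes "h \<in> carrier H" "\<And>w. c0 h w = 0"
  shows "\<exists>h' \<in> carrier H. h = qq \<odot>\<^bsub>H\<^esub> h'"
proof -
  have dvd: "qq dvd cf h w" for w
    using assms(2)[of w] poly_eq_0_iff_dvd[of "cf h w" 0] by (simp add: c0_def)
  let ?c = "\<lambda>w. cf h w div qq"
  have eq: "qq * ?c w = cf h w" for w using dvd[of w] by (rule dvd_mult_div_cancel)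
  have fs: "fsupp ?c"
    using fsupp_cf[OF assms(1)] unfolding fsupp_def
    by (auto intro: finite_subset[of _ "{w. cf h w \<noteq> 0}"] simp: subset_iff) force
  have "h = qq \<odot>\<^bsub>H\<^esub> lin ?c"
  proof (rule cf_inject[OF assms(1) smult_closed[OF lin_closed[OF fs]]])
    fix w
    show "cf h w = cf (qq \<odot>\<^bsub>H\<^esub> lin ?c) w"
      unfolding cf_smult[OF lin_closed[OF fs]] cf_lin[OF fs] eq ..
  qed
  then show ?thesis using fs lin_closed by blast
qed

text \<open>Dividing by q in H is easy; the point is that the quotient can be taken in x_I H. The
  coefficients of h, hence those of h/q, are constant on the cosets W_I v, and such an element is
  x_I times its restriction to the minimal representatives.\<close>

lemma q_divides_xH:
  assumes "I \<in> \<Lambda>" "h \<in> xH I" "\<And>w. c0 h w = 0"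
  shows "\<exists>h' \<in> xH I. h = qq \<odot>\<^bsub>H\<^esub> h'"
proof -
  note I = \<Lambda>_D[OF assms(1)]
  have x: "x_par I \<in> carrier H" using I by simp
  obtain z where z: "z \<in> carrier H" "h = x_par I \<otimes>\<^bsub>H\<^esub> z" using assms(2) unfolding xH_def by auto
  have h: "h \<in> carrier H" using z x by simp
  obtain k where k: "k \<in> carrier H" "h = qq \<odot>\<^bsub>H\<^esub> k" using q_divides[OF h assms(3)] by blast
  let ?c = "\<lambda>w. if w \<in> lmin I then cf k w else 0"
  have fs: "fsupp ?c"
    using fsupp_cf[OF k(1)] unfolding fsupp_def
    by (auto intro: finite_subset[of _ "{w. cf k w \<noteq> 0}"] simp: subset_iff)
  let ?y = "x_par I \<otimes>\<^bsub>H\<^esub> lin ?c"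
  have y: "?y \<in> carrier H" using x lin_closed[OF fs] by simp
  have "h = qq \<odot>\<^bsub>H\<^esub> ?y"
  proof (rule cf_inject[OF h smult_closed[OF y]])
    fix v
    show "cf h v = cf (qq \<odot>\<^bsub>H\<^esub> ?y) v"
    proof (cases "v \<in> carrier G")
      case True
      have dv: "dmin I v \<in> lmin I" "dmin I v \<in> carrier G"
        using dmin_lmin[OF I(1) True] lmin_closed by auto
      have "cf h v = cf h (dmin I v)"
        unfolding z(2) cf_x_par_mult[OF assms(1) z(1) True] cf_x_par_mult[OF assms(1) z(1) dv(2)]
        using dmin_fix[OF I(1) dv(1)] by simp
      also have "\<dots> = qq * cf k (dmin I v)" unfolding k(2) using k(1) by (rule cf_smult)
      finally have L: "cf h v = qq * cf k (dmin I v)" .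
      have "cf ?y v = (\<Sum>b\<in>W I. qq ^ len b * ?c (b \<otimes> dmin I v))"
        unfolding cf_x_par_mult[OF assms(1) lin_closed[OF fs] True] cf_lin[OF fs] ..
      also have "\<dots> = (\<Sum>b\<in>W I. if b = \<one> then cf k (dmin I v) else 0)"
      proof (intro sum.cong HOL.refl)
        fix b assume b: "b \<in> W I"
        \<comment> \<open>The coset has a single minimal element, so of the weighted sum only the
          term of weight q^0 remains.\<close>
        have "b = \<one>" if l: "b \<otimes> dmin I v \<in> lmin I"
        proof -
          have "b \<otimes> dmin I v = \<one> \<otimes> (b \<otimes> dmin I v)" using W_closed[OF b I(1)] dv by simp
          then have "dmin I v = b \<otimes> dmin I v" using lmin_unique[OF I(1) b dv(1) W_one l] by blast
          then show ?thesis using W_closed[OF b I(1)] dv by simp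
        qed
        then have "?c (b \<otimes> dmin I v) = 0" if "b \<noteq> \<one>" using that by meson
        then show "qq ^ len b * ?c (b \<otimes> dmin I v) = (if b = \<one> then cf k (dmin I v) else 0)"
          using dv by (cases "b = \<one>") simp_all
      qed
      also have "\<dots> = cf k (dmin I v)" using I(2) W_one by simp
      finally show ?thesis using L cf_smult[OF y] by simp
    next
      case False
      then show ?thesis using cf_outside[OF h] cf_outside[OF smult_closed[OF y]] by simp
    qed
  qed
  moreover have "?y \<in> xH I" unfolding xH_def using lin_closed[OF fs] by blast
  ultimately show ?thesis by blast
qed

section \<open>Minimal coset representatives and the elements h_{J,I}\<close>

text \<open>\<open>min_coset_reps\<close> concerns cosets w W_I, \<open>lmin\<close> concerns W_I w;
  inversion preserves length and exchanges the two.\<close>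

lemma min_coset_reps_iff:
  assumes "I \<subseteq> S" "d \<in> carrier G"
  shows "d \<in> min_coset_reps J I \<longleftrightarrow> d \<in> W J \<and> inv d \<in> lmin I"
proof -
  have eq: "len (b \<otimes> inv d) = len (d \<otimes> inv b)" if "b \<in> W I" for b
    using len_inv[of "b \<otimes> inv d"] W_closed[OF that assms(1)] assms(2) by (simp add: inv_mult_group)
  have "(\<forall>v \<in> d <# W I. len d \<le> len v) \<longleftrightarrow> (\<forall>b \<in> W I. len d \<le> len (d \<otimes> b))"
    by (auto simp: l_coset_def)
  also have "\<dots> \<longleftrightarrow> (\<forall>b \<in> W I. len d \<le> len (d \<otimes> inv b))"
  proof (intro iffI ballI)
    fix b assume *: "\<forall>b\<in>W I. len d \<le> len (d \<otimes> inv b)" and b: "b \<in> W I"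
    show "len d \<le> len (d \<otimes> b)" using *[rule_format, OF W_inv[OF assms(1) b]] W_closed[OF b assms(1)] by simp
  qed (use W_inv[OF assms(1)] in blast)
  also have "\<dots> \<longleftrightarrow> (\<forall>b \<in> W I. len (inv d) \<le> len (b \<otimes> inv d))"
    using eq assms(2) by simp
  finally show ?thesis unfolding min_coset_reps_def lmin_iff[OF assms(1)] using assms(2) by simp
qed

lemma min_coset_reps_closed: "J \<subseteq> S \<Longrightarrow> d \<in> min_coset_reps J I \<Longrightarrow> d \<in> carrier G"
  unfolding min_coset_reps_def using W_closed by blast

lemma h_par_closed [simp]: "J \<subseteq> S \<Longrightarrow> h_par J I \<in> carrier H"
  unfolding h_par_def using min_coset_reps_closed T_closed by (intro H.finsum_closed) auto

text \<open>W_J is the disjoint union of the cosets d W_I over the minimal representatives d, and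
  T_(da) = T_d T_a there because lengths add.\<close>

lemma h_par_mult_x_par:
  assumes "J \<in> \<Lambda>" "I \<subseteq> J"
  shows "h_par J I \<otimes>\<^bsub>H\<^esub> x_par I = x_par J"
proof -
  note J = \<Lambda>_D[OF assms(1)]
  have IS: "I \<subseteq> S" using J assms(2) by blast
  have WI: "W I \<subseteq> W J" "finite (W I)" using W_mono[OF assms(2)] J(2) finite_subset by auto
  let ?D = "min_coset_reps J I"
  have D: "d \<in> W J" "d \<in> carrier G" "inv d \<in> lmin I" if "d \<in> ?D" for d
    using min_coset_reps_closed[OF J(1) that] min_coset_reps_iff[OF IS, of d J] that by auto
  have Wc: "a \<in> carrier G" if "a \<in> W I" for a using W_closed[OF that IS] .
  have finD: "finite ?D" using D(1) J(2) by (meson finite_subset subsetI)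
  let ?C = "\<lambda>d. (\<lambda>a. d \<otimes> a) ` W I"
  have un: "W J = (\<Union>d\<in>?D. ?C d)"
  proof (intro equalityI subsetI)
    fix w assume w: "w \<in> W J"
    have wc: "w \<in> carrier G" using W_closed[OF w J(1)] .
    obtain a d where a: "a \<in> W I" "d \<in> lmin I" "inv w = a \<otimes> d"
      by (rule dmin_decomp[OF IS inv_closed[OF wc]])
    have dc: "d \<in> carrier G" using lmin_closed a(2) .
    have "d = inv a \<otimes> inv w" unfolding a(3) using Wc[OF a(1)] dc by (simp add: m_assoc[symmetric])
    then have dJ: "d \<in> W J" using W_mult[OF subsetD[OF WI(1) W_inv[OF IS a(1)]] W_inv[OF J(1) w]] by simp
    have "inv d \<in> ?D" using min_coset_reps_iff[OF IS, of "inv d" J] W_inv[OF J(1) dJ] a(2) dc by simp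
    moreover have "w = inv d \<otimes> inv a"
      using arg_cong[OF a(3), of "\<lambda>x. inv x"] wc Wc[OF a(1)] dc by (simp add: inv_mult_group)
    ultimately show "w \<in> (\<Union>d\<in>?D. ?C d)" using W_inv[OF IS a(1)] by blast
  next
    fix w assume "w \<in> (\<Union>d\<in>?D. ?C d)"
    then show "w \<in> W J" using D(1) WI(1) W_mult by blast
  qed
  have disj: "?C d \<inter> ?C e = {}" if "d \<in> ?D" "e \<in> ?D" "d \<noteq> e" for d e
  proof (rule ccontr)
    assume "\<not> ?thesis"
    then obtain a b where ab: "a \<in> W I" "b \<in> W I" "d \<otimes> a = e \<otimes> b" by auto
    have "inv a \<otimes> inv d = inv b \<otimes> inv e"
      using arg_cong[OF ab(3), of "\<lambda>x. inv x"] Wc[OF ab(1)] Wc[OF ab(2)] D(2)[OF that(1)] D(2)[OF that(2)]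
      by (simp add: inv_mult_group)
    then have "inv d = inv e"
      using lmin_unique[OF IS W_inv[OF IS ab(1)] D(3)[OF that(1)] W_inv[OF IS ab(2)] D(3)[OF that(2)]] by blast
    then show False using that D(2) by (metis inv_inv)
  qed
  have TJ: "T w \<in> carrier H" if "w \<in> W J" for w using T_closed W_closed[OF that J(1)] by blast
  have "x_par J = finsum H (\<lambda>d. finsum H T (?C d)) ?D"
    unfolding x_par_def un
  proof (rule H.add.finprod_UN_disjoint[OF finD])
    show "pairwise (\<lambda>d e. disjnt (?C d) (?C e)) ?D" using disj by (simp add: pairwise_def disjnt_def)
    show "T w \<in> carrier H" if "d \<in> ?D" "w \<in> ?C d" for d w
      using that un by (intro TJ) blast
  qed (use WI(2) in simp)
  also have "\<dots> = finsum H (\<lambda>d. T d \<otimes>\<^bsub>H\<^esub> x_par I) ?D"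
  proof (intro H.finsum_cong')
    fix d assume d: "d \<in> ?D"
    have "finsum H T (?C d) = finsum H (\<lambda>a. T (d \<otimes> a)) (W I)"
      using TJ un d D(2) Wc by (intro H.finsum_reindex) (auto intro!: inj_onI)
    also have "\<dots> = finsum H (\<lambda>a. T d \<otimes>\<^bsub>H\<^esub> T a) (W I)"
    proof (intro H.finsum_cong')
      fix a assume a: "a \<in> W I"
      have "len (d \<otimes> a) = len (inv a \<otimes> inv d)"
        using len_inv[of "d \<otimes> a"] Wc[OF a] D(2)[OF d] by (simp add: inv_mult_group)
      also have "\<dots> = len d + len a"
        using len_mult_lmin[OF IS W_inv[OF IS a] D(3)[OF d]] Wc[OF a] D(2)[OF d] by simp
      finally show "T (d \<otimes> a) = T d \<otimes>\<^bsub>H\<^esub> T a" using T_mult Wc[OF a] D(2)[OF d] by simp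
    qed (use Wc D(2)[OF d] T_closed in auto)
    also have "\<dots> = T d \<otimes>\<^bsub>H\<^esub> x_par I"
      unfolding x_par_def using WI(2) Wc D(2)[OF d] T_closed by (intro H.finsum_rdistr[symmetric]) auto
    finally show "finsum H T (?C d) = T d \<otimes>\<^bsub>H\<^esub> x_par I" .
  qed (use D(2) T_closed IS in auto)
  also have "\<dots> = h_par J I \<otimes>\<^bsub>H\<^esub> x_par I"
    unfolding h_par_def using finD D(2) T_closed IS by (intro H.finsum_ldistr[symmetric]) auto
  finally show ?thesis by simp
qed

end


context hecke_algebra
begin

subsection \<open>The endomorphism algebra\<close>

lemma xH_carrier: "I \<subseteq> S \<Longrightarrow> h \<in> xH I \<Longrightarrow> h \<in> carrier H"
  unfolding xH_def by auto

lemma xH_I: "a \<in> carrier H \<Longrightarrow> x_par I \<otimes>\<^bsub>H\<^esub> a \<in> xH I"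
  unfolding xH_def by auto

lemma xH_E: assumes "h \<in> xH I" obtains a where "a \<in> carrier H" "h = x_par I \<otimes>\<^bsub>H\<^esub> a"
  using assms unfolding xH_def by auto

lemma xH_add:
  assumes "I \<subseteq> S" "h \<in> xH I" "k \<in> xH I" shows "h \<oplus>\<^bsub>H\<^esub> k \<in> xH I"
proof -
  obtain a where a: "a \<in> carrier H" "h = x_par I \<otimes>\<^bsub>H\<^esub> a" using assms(2) by (rule xH_E)
  obtain b where b: "b \<in> carrier H" "k = x_par I \<otimes>\<^bsub>H\<^esub> b" using assms(3) by (rule xH_E)
  have "h \<oplus>\<^bsub>H\<^esub> k = x_par I \<otimes>\<^bsub>H\<^esub> (a \<oplus>\<^bsub>H\<^esub> b)" using a b assms(1) by (simp add: H.r_distr)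
  then show ?thesis using xH_I a b by simp
qed

lemma xH_mult:
  assumes "I \<subseteq> S" "h \<in> xH I" "b \<in> carrier H" shows "h \<otimes>\<^bsub>H\<^esub> b \<in> xH I"
proof -
  obtain a where a: "a \<in> carrier H" "h = x_par I \<otimes>\<^bsub>H\<^esub> a" using assms(2) by (rule xH_E)
  then have "h \<otimes>\<^bsub>H\<^esub> b = x_par I \<otimes>\<^bsub>H\<^esub> (a \<otimes>\<^bsub>H\<^esub> b)" using assms by (simp add: H.m_assoc)
  then show ?thesis using xH_I a assms by simp
qed

lemma xH_smult:
  assumes "I \<subseteq> S" "h \<in> xH I" shows "c \<odot>\<^bsub>H\<^esub> h \<in> xH I"
proof -
  obtain a where a: "a \<in> carrier H" "h = x_par I \<otimes>\<^bsub>H\<^esub> a" using assms(2) by (rule xH_E)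
  then have "c \<odot>\<^bsub>H\<^esub> h = x_par I \<otimes>\<^bsub>H\<^esub> (c \<odot>\<^bsub>H\<^esub> a)" using assms by (simp add: H_smult_r)
  then show ?thesis using xH_I a by simp
qed

lemma xH_zero: "I \<subseteq> S \<Longrightarrow> \<zero>\<^bsub>H\<^esub> \<in> xH I"
  using xH_I[of "\<zero>\<^bsub>H\<^esub>" I] by simp

lemma x_par_in_xH: "I \<subseteq> S \<Longrightarrow> x_par I \<in> xH I"
  using xH_I[of "\<one>\<^bsub>H\<^esub>" I] by simp

lemma xH_invariant:
  assumes "I \<in> \<Lambda>" "h \<in> xH I" "w \<in> carrier G" shows "c0 h (dmin I w) = c0 h w"
proof -
  note I = \<Lambda>_D(1)[OF assms(1)]
  obtain a where a: "a \<in> carrier H" "h = x_par I \<otimes>\<^bsub>H\<^esub> a" using assms(2) by (rule xH_E)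
  show ?thesis unfolding a(2)
    using c0_x_par_mult[OF assms(1) a(1)] assms(3) I dmin_fix[OF I dmin_lmin[OF I assms(3)]] by simp
qed

text \<open>Makes the inclusion \<open>u\<close> well defined. Here x_I has to be the left factor of
  x_J, so W_J is split into cosets W_I d, the mirror image of
  \<open>h_par_mult_x_par\<close>.\<close>

lemma xH_mono:
  assumes "J \<in> \<Lambda>" "I \<subseteq> J" shows "xH J \<subseteq> xH I"
proof -
  note J = \<Lambda>_D[OF assms(1)]
  have I: "I \<in> \<Lambda>" "I \<subseteq> S" using assms J W_mono[OF assms(2)] by (auto simp: \<Lambda>_def intro: finite_subset)
  have WI: "W I \<subseteq> W J" using W_mono[OF assms(2)] .
  let ?D = "W J \<inter> lmin I"
  have fin: "finite ?D" using J by simp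
  have TD: "T \<in> ?D \<rightarrow> carrier H" using T_closed lmin_closed by auto
  have xI: "x_par I \<in> carrier H" using I by simp
  have f: "finsum H T ?D \<in> carrier H" using TD by (rule H.finsum_closed)
  have "x_par J = x_par I \<otimes>\<^bsub>H\<^esub> finsum H T ?D"
  proof (rule cf_inject)
    fix w
    show "cf (x_par J) w = cf (x_par I \<otimes>\<^bsub>H\<^esub> finsum H T ?D) w"
    proof (cases "w \<in> carrier G")
      case True
      obtain a d where a: "a \<in> W I" "d \<in> lmin I" "w = a \<otimes> d" "dmin I w = d"
        by (rule dmin_decomp[OF I(2) True])
      have ac: "a \<in> carrier G" "d \<in> carrier G" using W_closed[OF a(1) I(2)] lmin_closed[OF a(2)] .
      have "w \<in> W J \<longleftrightarrow> d \<in> W J"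
      proof
        assume "w \<in> W J"
        then have "inv a \<otimes> w \<in> W J" using WI W_inv[OF I(2) a(1)] W_mult by blast
        then show "d \<in> W J" unfolding a(3) using ac by (simp add: m_assoc[symmetric])
      next
        assume "d \<in> W J"
        then show "w \<in> W J" unfolding a(3) using WI a(1) W_mult by blast
      qed
      then have wd: "w \<in> W J \<longleftrightarrow> d \<in> ?D" using a(2) by simp
      have "x_par I \<otimes>\<^bsub>H\<^esub> finsum H T ?D = finsum H (\<lambda>e. x_par I \<otimes>\<^bsub>H\<^esub> T e) ?D"
        using fin xI TD by (rule H.finsum_rdistr)
      then have "cf (x_par I \<otimes>\<^bsub>H\<^esub> finsum H T ?D) w = (\<Sum>e\<in>?D. cf (x_par I \<otimes>\<^bsub>H\<^esub> T e) w)"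
        using xI TD by (simp add: cf_finsum Pi_iff)
      also have "\<dots> = (\<Sum>e\<in>?D. if d = e then 1 else 0)"
        using a(4) True I(1) by (intro sum.cong) (auto simp: cf_x_par_T)
      also have "\<dots> = (if w \<in> W J then 1 else 0)" using fin wd by simp
      also have "\<dots> = (\<Sum>e\<in>W J. if w = e then 1 else 0)" using J(2) by simp
      also have "\<dots> = (\<Sum>e\<in>W J. cf (T e) w)"
        using W_closed J(1) by (intro sum.cong) (auto simp: cf_T)
      also have "\<dots> = cf (x_par J) w"
        unfolding x_par_def using W_closed J(1) T_closed by (subst cf_finsum) auto
      finally show ?thesis by simp
    next
      case False
      then show ?thesis using cf_outside J(1) xI f by simp
    qed
  qed (use J xI f in auto)
  then have xJ: "x_par J \<in> xH I" using xH_I[OF f] by simp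
  show ?thesis
  proof
    fix h assume "h \<in> xH J"
    then obtain a where a: "a \<in> carrier H" "h = x_par J \<otimes>\<^bsub>H\<^esub> a" by (rule xH_E)
    then show "h \<in> xH I" using xH_mult[OF I(2) xJ] by simp
  qed
qed

section \<open>The direct sum and its endomorphism ring\<close>

definition vadd where "vadd v w = (\<lambda>I\<in>\<Lambda>. v I \<oplus>\<^bsub>H\<^esub> w I)"

definition vmult where "vmult v a = (\<lambda>I\<in>\<Lambda>. v I \<otimes>\<^bsub>H\<^esub> a)"

definition vsmult where "vsmult c v = (\<lambda>I\<in>\<Lambda>. c \<odot>\<^bsub>H\<^esub> v I)"

lemma V_xH: "v \<in> xH_sum \<Longrightarrow> I \<in> \<Lambda> \<Longrightarrow> v I \<in> xH I"
  unfolding xH_sum_def by auto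

lemma V_carrier [simp]: "v \<in> xH_sum \<Longrightarrow> I \<in> \<Lambda> \<Longrightarrow> v I \<in> carrier H"
  using V_xH xH_carrier \<Lambda>_D(1) by blast

lemma V_I: "(\<And>I. I \<in> \<Lambda> \<Longrightarrow> f I \<in> xH I) \<Longrightarrow> (\<lambda>I\<in>\<Lambda>. f I) \<in> xH_sum"
  unfolding xH_sum_def by auto

lemma V_ext: "v \<in> xH_sum \<Longrightarrow> w \<in> xH_sum \<Longrightarrow> (\<And>I. I \<in> \<Lambda> \<Longrightarrow> v I = w I) \<Longrightarrow> v = w"
  unfolding xH_sum_def by (rule PiE_ext)

lemma vadd_closed [simp]: "v \<in> xH_sum \<Longrightarrow> w \<in> xH_sum \<Longrightarrow> vadd v w \<in> xH_sum"
  unfolding vadd_def using V_xH xH_add \<Lambda>_D(1) by (intro V_I) blast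

lemma vmult_closed [simp]: "v \<in> xH_sum \<Longrightarrow> a \<in> carrier H \<Longrightarrow> vmult v a \<in> xH_sum"
  unfolding vmult_def using V_xH xH_mult \<Lambda>_D(1) by (intro V_I) blast

lemma vsmult_closed [simp]: "v \<in> xH_sum \<Longrightarrow> vsmult c v \<in> xH_sum"
  unfolding vsmult_def using V_xH xH_smult \<Lambda>_D(1) by (intro V_I) blast

lemma Eq_carrier_iff: "F \<in> carrier E\<^sub>q \<longleftrightarrow> F \<in> xH_sum \<rightarrow>\<^sub>E xH_sum \<and>
    (\<forall>v \<in> xH_sum. \<forall>w \<in> xH_sum. F (vadd v w) = vadd (F v) (F w)) \<and>
    (\<forall>v \<in> xH_sum. \<forall>a \<in> carrier H. F (vmult v a) = vmult (F v) a)"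
  by (simp add: E\<^sub>q_def vadd_def vmult_def)

lemma Eq_closed [simp]: "F \<in> carrier E\<^sub>q \<Longrightarrow> v \<in> xH_sum \<Longrightarrow> F v \<in> xH_sum"
  by (auto simp: Eq_carrier_iff)

lemma Eq_add: "F \<in> carrier E\<^sub>q \<Longrightarrow> v \<in> xH_sum \<Longrightarrow> w \<in> xH_sum \<Longrightarrow> F (vadd v w) = vadd (F v) (F w)"
  by (auto simp: Eq_carrier_iff)

lemma Eq_mult: "F \<in> carrier E\<^sub>q \<Longrightarrow> v \<in> xH_sum \<Longrightarrow> a \<in> carrier H \<Longrightarrow> F (vmult v a) = vmult (F v) a"
  by (auto simp: Eq_carrier_iff)

lemma Eq_ext:
  assumes "F \<in> carrier E\<^sub>q" "F' \<in> carrier E\<^sub>q"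
    "\<And>v I. v \<in> xH_sum \<Longrightarrow> I \<in> \<Lambda> \<Longrightarrow> F v I = F' v I"
  shows "F = F'"
proof (rule PiE_ext)
  show "F \<in> xH_sum \<rightarrow>\<^sub>E xH_sum" "F' \<in> xH_sum \<rightarrow>\<^sub>E xH_sum" using assms by (auto simp: Eq_carrier_iff)
  fix v assume v: "v \<in> xH_sum"
  show "F v = F' v" using assms v by (intro V_ext) auto
qed

lemma Eq_I:
  assumes "\<And>v I. v \<in> xH_sum \<Longrightarrow> I \<in> \<Lambda> \<Longrightarrow> f v I \<in> xH I"
    "\<And>v w I. v \<in> xH_sum \<Longrightarrow> w \<in> xH_sum \<Longrightarrow> I \<in> \<Lambda> \<Longrightarrow> f (vadd v w) I = f v I \<oplus>\<^bsub>H\<^esub> f w I"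
    "\<And>v a I. v \<in> xH_sum \<Longrightarrow> a \<in> carrier H \<Longrightarrow> I \<in> \<Lambda> \<Longrightarrow> f (vmult v a) I = f v I \<otimes>\<^bsub>H\<^esub> a"
  shows "(\<lambda>v\<in>xH_sum. \<lambda>I\<in>\<Lambda>. f v I) \<in> carrier E\<^sub>q"
proof -
  have "(\<lambda>I\<in>\<Lambda>. f (vadd v w) I) = vadd (\<lambda>I\<in>\<Lambda>. f v I) (\<lambda>I\<in>\<Lambda>. f w I)"
    if "v \<in> xH_sum" "w \<in> xH_sum" for v w
    unfolding vadd_def using assms(2) that by (intro restrict_ext) (simp add: vadd_def)
  moreover have "(\<lambda>I\<in>\<Lambda>. f (vmult v a) I) = vmult (\<lambda>I\<in>\<Lambda>. f v I) a"
    if "v \<in> xH_sum" "a \<in> carrier H" for v a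
    unfolding vmult_def using assms(3) that by (intro restrict_ext) (simp add: vmult_def)
  moreover have "(\<lambda>I\<in>\<Lambda>. f v I) \<in> xH_sum" if "v \<in> xH_sum" for v
    using assms(1) that by (intro V_I)
  ultimately show ?thesis by (simp add: Eq_carrier_iff)
qed

lemma Eq_mult_apply: "v \<in> xH_sum \<Longrightarrow> (F \<otimes>\<^bsub>E\<^sub>q\<^esub> F') v = F (F' v)"
  by (simp add: E\<^sub>q_def compose_def)

lemma Eq_one_apply: "v \<in> xH_sum \<Longrightarrow> \<one>\<^bsub>E\<^sub>q\<^esub> v = v"
  by (simp add: E\<^sub>q_def)

lemma Eq_zero_apply: "v \<in> xH_sum \<Longrightarrow> I \<in> \<Lambda> \<Longrightarrow> \<zero>\<^bsub>E\<^sub>q\<^esub> v I = \<zero>\<^bsub>H\<^esub>"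
  by (simp add: E\<^sub>q_def)

lemma Eq_add_apply: "v \<in> xH_sum \<Longrightarrow> I \<in> \<Lambda> \<Longrightarrow> (F \<oplus>\<^bsub>E\<^sub>q\<^esub> F') v I = F v I \<oplus>\<^bsub>H\<^esub> F' v I"
  by (simp add: E\<^sub>q_def)

lemma Eq_smult_apply: "v \<in> xH_sum \<Longrightarrow> I \<in> \<Lambda> \<Longrightarrow> (c \<odot>\<^bsub>E\<^sub>q\<^esub> F) v I = c \<odot>\<^bsub>H\<^esub> F v I"
  by (simp add: E\<^sub>q_def)

lemma Eq_mult_closed:
  assumes "F \<in> carrier E\<^sub>q" "F' \<in> carrier E\<^sub>q" shows "F \<otimes>\<^bsub>E\<^sub>q\<^esub> F' \<in> carrier E\<^sub>q"
proof -
  have "compose xH_sum F F' \<in> xH_sum \<rightarrow>\<^sub>E xH_sum"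
    using assms by (auto simp: compose_def)
  then have "compose xH_sum F F' \<in> carrier E\<^sub>q"
    using assms unfolding Eq_carrier_iff by (auto simp: compose_def Pi_iff PiE_def)
  then show ?thesis by (simp add: E\<^sub>q_def)
qed

lemma Eq_one_closed: "\<one>\<^bsub>E\<^sub>q\<^esub> \<in> carrier E\<^sub>q"
  unfolding Eq_carrier_iff by (simp add: E\<^sub>q_def)

lemma Eq_zero_closed: "\<zero>\<^bsub>E\<^sub>q\<^esub> \<in> carrier E\<^sub>q"
proof -
  have "\<zero>\<^bsub>E\<^sub>q\<^esub> = (\<lambda>v\<in>xH_sum. \<lambda>I\<in>\<Lambda>. \<zero>\<^bsub>H\<^esub>)" by (simp add: E\<^sub>q_def)
  also have "\<dots> \<in> carrier E\<^sub>q" using xH_zero \<Lambda>_D(1) by (intro Eq_I) auto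
  finally show ?thesis .
qed

lemma Eq_add_closed:
  assumes F: "F \<in> carrier E\<^sub>q" and F': "F' \<in> carrier E\<^sub>q" shows "F \<oplus>\<^bsub>E\<^sub>q\<^esub> F' \<in> carrier E\<^sub>q"
proof -
  have "F \<oplus>\<^bsub>E\<^sub>q\<^esub> F' = (\<lambda>v\<in>xH_sum. \<lambda>I\<in>\<Lambda>. F v I \<oplus>\<^bsub>H\<^esub> F' v I)" by (simp add: E\<^sub>q_def)
  also have "\<dots> \<in> carrier E\<^sub>q"
  proof (rule Eq_I)
    fix v I assume v: "v \<in> xH_sum" and I: "I \<in> \<Lambda>"
    show "F v I \<oplus>\<^bsub>H\<^esub> F' v I \<in> xH I"
      using V_xH[OF Eq_closed[OF F v] I] V_xH[OF Eq_closed[OF F' v] I] xH_add \<Lambda>_D(1)[OF I] by simp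
    have c: "F v I \<in> carrier H" "F' v I \<in> carrier H" using v I F F' by auto
    show "F (vmult v a) I \<oplus>\<^bsub>H\<^esub> F' (vmult v a) I = (F v I \<oplus>\<^bsub>H\<^esub> F' v I) \<otimes>\<^bsub>H\<^esub> a"
      if a: "a \<in> carrier H" for a
      using Eq_mult[OF F v a] Eq_mult[OF F' v a] c a I by (simp add: vmult_def H.l_distr)
    fix w assume w: "w \<in> xH_sum"
    have "F w I \<in> carrier H" "F' w I \<in> carrier H" using w I F F' by auto
    then show "F (vadd v w) I \<oplus>\<^bsub>H\<^esub> F' (vadd v w) I = (F v I \<oplus>\<^bsub>H\<^esub> F' v I) \<oplus>\<^bsub>H\<^esub> (F w I \<oplus>\<^bsub>H\<^esub> F' w I)"
      using Eq_add[OF F v w] Eq_add[OF F' v w] c I by (simp add: vadd_def H.a_ac)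
  qed
  finally show ?thesis .
qed

lemma Eq_smult_closed:
  assumes F: "F \<in> carrier E\<^sub>q" shows "c \<odot>\<^bsub>E\<^sub>q\<^esub> F \<in> carrier E\<^sub>q"
proof -
  have "c \<odot>\<^bsub>E\<^sub>q\<^esub> F = (\<lambda>v\<in>xH_sum. \<lambda>I\<in>\<Lambda>. c \<odot>\<^bsub>H\<^esub> F v I)" by (simp add: E\<^sub>q_def)
  also have "\<dots> \<in> carrier E\<^sub>q"
  proof (rule Eq_I)
    fix v I assume v: "v \<in> xH_sum" and I: "I \<in> \<Lambda>"
    show "c \<odot>\<^bsub>H\<^esub> F v I \<in> xH I" using V_xH[OF Eq_closed[OF F v] I] xH_smult \<Lambda>_D(1)[OF I] by simp
    have c: "F v I \<in> carrier H" using v I F by auto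
    show "c \<odot>\<^bsub>H\<^esub> F (vmult v a) I = (c \<odot>\<^bsub>H\<^esub> F v I) \<otimes>\<^bsub>H\<^esub> a" if a: "a \<in> carrier H" for a
      using Eq_mult[OF F v a] c a I by (simp add: vmult_def H_smult_l)
    fix w assume w: "w \<in> xH_sum"
    have "F w I \<in> carrier H" using w I F by auto
    then show "c \<odot>\<^bsub>H\<^esub> F (vadd v w) I = c \<odot>\<^bsub>H\<^esub> F v I \<oplus>\<^bsub>H\<^esub> c \<odot>\<^bsub>H\<^esub> F w I"
      using Eq_add[OF F v w] c I by (simp add: vadd_def smult_add)
  qed
  finally show ?thesis .
qed

lemma Eq_neg:
  assumes F: "F \<in> carrier E\<^sub>q" shows "(-1) \<odot>\<^bsub>E\<^sub>q\<^esub> F \<oplus>\<^bsub>E\<^sub>q\<^esub> F = \<zero>\<^bsub>E\<^sub>q\<^esub>"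
proof (rule Eq_ext)
  fix v I assume v: "v \<in> xH_sum" and I: "I \<in> \<Lambda>"
  have c: "F v I \<in> carrier H" using v I F by auto
  have "(-1) \<odot>\<^bsub>H\<^esub> F v I \<oplus>\<^bsub>H\<^esub> F v I = (-1 + 1) \<odot>\<^bsub>H\<^esub> F v I" unfolding add_smult[OF c] using c by simp
  then show "((-1) \<odot>\<^bsub>E\<^sub>q\<^esub> F \<oplus>\<^bsub>E\<^sub>q\<^esub> F) v I = \<zero>\<^bsub>E\<^sub>q\<^esub> v I"
    using v I c by (simp add: Eq_add_apply Eq_smult_apply Eq_zero_apply)
qed (use F Eq_smult_closed Eq_add_closed Eq_zero_closed in auto)

lemma Eq_ring: "ring E\<^sub>q"
proof (rule ringI)
  note cl = Eq_mult_closed Eq_one_closed Eq_zero_closed Eq_add_closed Eq_smult_closed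
  note ap = Eq_mult_apply Eq_one_apply Eq_zero_apply Eq_add_apply
  show "abelian_group E\<^sub>q"
  proof (rule abelian_groupI)
    fix F assume F: "F \<in> carrier E\<^sub>q"
    show "\<exists>F' \<in> carrier E\<^sub>q. F' \<oplus>\<^bsub>E\<^sub>q\<^esub> F = \<zero>\<^bsub>E\<^sub>q\<^esub>" using Eq_neg[OF F] cl(5)[OF F] by blast
    show "\<zero>\<^bsub>E\<^sub>q\<^esub> \<oplus>\<^bsub>E\<^sub>q\<^esub> F = F" by (rule Eq_ext) (use F cl in \<open>auto simp: ap\<close>)
    fix F' assume F': "F' \<in> carrier E\<^sub>q"
    show "F \<oplus>\<^bsub>E\<^sub>q\<^esub> F' \<in> carrier E\<^sub>q" using F F' cl by blast
    show "F \<oplus>\<^bsub>E\<^sub>q\<^esub> F' = F' \<oplus>\<^bsub>E\<^sub>q\<^esub> F"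
      by (rule Eq_ext) (use F F' cl in \<open>auto simp: ap H.a_comm\<close>)
    fix F'' assume F'': "F'' \<in> carrier E\<^sub>q"
    show "(F \<oplus>\<^bsub>E\<^sub>q\<^esub> F') \<oplus>\<^bsub>E\<^sub>q\<^esub> F'' = F \<oplus>\<^bsub>E\<^sub>q\<^esub> (F' \<oplus>\<^bsub>E\<^sub>q\<^esub> F'')"
      by (rule Eq_ext) (use F F' F'' cl in \<open>auto simp: ap H.a_assoc\<close>)
  qed (rule cl)
  show "Group.monoid E\<^sub>q"
  proof (rule monoidI)
    fix F assume F: "F \<in> carrier E\<^sub>q"
    show "\<one>\<^bsub>E\<^sub>q\<^esub> \<otimes>\<^bsub>E\<^sub>q\<^esub> F = F" by (rule Eq_ext) (use F cl in \<open>auto simp: ap\<close>)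
    show "F \<otimes>\<^bsub>E\<^sub>q\<^esub> \<one>\<^bsub>E\<^sub>q\<^esub> = F" by (rule Eq_ext) (use F cl in \<open>auto simp: ap\<close>)
    fix F' assume F': "F' \<in> carrier E\<^sub>q"
    show "F \<otimes>\<^bsub>E\<^sub>q\<^esub> F' \<in> carrier E\<^sub>q" using F F' cl by blast
    fix F'' assume F'': "F'' \<in> carrier E\<^sub>q"
    show "(F \<otimes>\<^bsub>E\<^sub>q\<^esub> F') \<otimes>\<^bsub>E\<^sub>q\<^esub> F'' = F \<otimes>\<^bsub>E\<^sub>q\<^esub> (F' \<otimes>\<^bsub>E\<^sub>q\<^esub> F'')"
      by (rule Eq_ext) (use F F' F'' cl in \<open>auto simp: ap\<close>)
  qed (rule cl)
  fix F F' F'' assume F: "F \<in> carrier E\<^sub>q" "F' \<in> carrier E\<^sub>q" "F'' \<in> carrier E\<^sub>q"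
  show "(F \<oplus>\<^bsub>E\<^sub>q\<^esub> F') \<otimes>\<^bsub>E\<^sub>q\<^esub> F'' = F \<otimes>\<^bsub>E\<^sub>q\<^esub> F'' \<oplus>\<^bsub>E\<^sub>q\<^esub> F' \<otimes>\<^bsub>E\<^sub>q\<^esub> F''"
    by (rule Eq_ext) (use F cl in \<open>auto simp: ap\<close>)
  show "F'' \<otimes>\<^bsub>E\<^sub>q\<^esub> (F \<oplus>\<^bsub>E\<^sub>q\<^esub> F') = F'' \<otimes>\<^bsub>E\<^sub>q\<^esub> F \<oplus>\<^bsub>E\<^sub>q\<^esub> F'' \<otimes>\<^bsub>E\<^sub>q\<^esub> F'"
  proof (rule Eq_ext)
    fix v I assume v: "v \<in> xH_sum" and I: "I \<in> \<Lambda>"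
    have "(F \<oplus>\<^bsub>E\<^sub>q\<^esub> F') v = vadd (F v) (F' v)"
      by (rule V_ext[OF Eq_closed[OF cl(4)[OF F(1,2)] v] vadd_closed[OF Eq_closed[OF F(1) v] Eq_closed[OF F(2) v]]])
        (simp add: ap v vadd_def)
    then show "(F'' \<otimes>\<^bsub>E\<^sub>q\<^esub> (F \<oplus>\<^bsub>E\<^sub>q\<^esub> F')) v I = (F'' \<otimes>\<^bsub>E\<^sub>q\<^esub> F \<oplus>\<^bsub>E\<^sub>q\<^esub> F'' \<otimes>\<^bsub>E\<^sub>q\<^esub> F') v I"
      using v I F Eq_add[OF F(3), of "F v" "F' v"] by (simp add: ap vadd_def)
  qed (use F cl in auto)
qed

sublocale Eq: ring E\<^sub>q
  by (rule Eq_ring)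

lemma Eq_neg_eq: "F \<in> carrier E\<^sub>q \<Longrightarrow> \<ominus>\<^bsub>E\<^sub>q\<^esub> F = (-1) \<odot>\<^bsub>E\<^sub>q\<^esub> F"
  using Eq_neg Eq_smult_closed Eq.minus_equality by blast

lemma Eq_minus_apply:
  assumes "F \<in> carrier E\<^sub>q" "F' \<in> carrier E\<^sub>q" "v \<in> xH_sum" "I \<in> \<Lambda>"
  shows "c0 ((F \<ominus>\<^bsub>E\<^sub>q\<^esub> F') v I) w = c0 (F v I) w - c0 (F' v I) w"
  using assms by (simp add: a_minus_def Eq_neg_eq Eq_add_apply Eq_smult_apply c0_add c0_smult)

text \<open>Endomorphisms are only required to be additive and H-linear on the right; the scalar c
  acts as right multiplication by c times the unit.\<close>

lemma Eq_smult: assumes "F \<in> carrier E\<^sub>q" "v \<in> xH_sum" shows "F (vsmult c v) = vsmult c (F v)"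
proof -
  have *: "vsmult c u = vmult u (c \<odot>\<^bsub>H\<^esub> \<one>\<^bsub>H\<^esub>)" if "u \<in> xH_sum" for u
    unfolding vsmult_def vmult_def using that by (intro restrict_ext) (simp add: H_smult_r)
  show ?thesis using *[OF assms(2)] *[of "F v"] Eq_mult[OF assms, of "c \<odot>\<^bsub>H\<^esub> \<one>\<^bsub>H\<^esub>"] assms by simp
qed


subsection \<open>Reduction modulo \<open>q\<close>\<close>

lemma V_q_divides:
  assumes "v \<in> xH_sum" "\<And>I w. I \<in> \<Lambda> \<Longrightarrow> c0 (v I) w = 0"
  shows "\<exists>u \<in> xH_sum. v = vsmult qq u"
proof -
  have "\<forall>I \<in> \<Lambda>. \<exists>h' \<in> xH I. v I = qq \<odot>\<^bsub>H\<^esub> h'"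
    using q_divides_xH V_xH[OF assms(1)] assms(2) by blast
  then obtain u where u: "\<And>I. I \<in> \<Lambda> \<Longrightarrow> u I \<in> xH I" "\<And>I. I \<in> \<Lambda> \<Longrightarrow> v I = qq \<odot>\<^bsub>H\<^esub> u I"
    by metis
  have r: "restrict u \<Lambda> \<in> xH_sum" using u(1) by (intro V_I)
  moreover have "v = vsmult qq (restrict u \<Lambda>)"
    by (rule V_ext[OF assms(1) vsmult_closed[OF r]]) (simp add: u(2) vsmult_def)
  ultimately show ?thesis by blast
qed

lemma Eq_c0_zero:
  assumes "F \<in> carrier E\<^sub>q" "v \<in> xH_sum" "\<And>I w. I \<in> \<Lambda> \<Longrightarrow> c0 (v I) w = 0" "K \<in> \<Lambda>"
  shows "c0 (F v K) w = 0"
proof -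
  obtain u where u: "u \<in> xH_sum" "v = vsmult qq u" using V_q_divides[OF assms(2,3)] by blast
  then have "F v = vsmult qq (F u)" using Eq_smult[OF assms(1)] by simp
  then show ?thesis using assms(1,4) u(1) by (simp add: vsmult_def c0_smult)
qed

text \<open>F/q is chosen pointwise. As H has no q-torsion (\<open>smult_q_inject\<close>), it
  inherits additivity and H-linearity from F.\<close>

lemma Eq_q_divides:
  assumes F: "F \<in> carrier E\<^sub>q" and 0: "\<And>v I w. v \<in> xH_sum \<Longrightarrow> I \<in> \<Lambda> \<Longrightarrow> c0 (F v I) w = 0"
  shows "\<exists>F' \<in> carrier E\<^sub>q. F = qq \<odot>\<^bsub>E\<^sub>q\<^esub> F'"
proof -
  have "\<forall>v \<in> xH_sum. \<exists>u \<in> xH_sum. F v = vsmult qq u"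
    using V_q_divides[OF Eq_closed[OF F]] 0 by blast
  then obtain f where f: "\<And>v. v \<in> xH_sum \<Longrightarrow> f v \<in> xH_sum" "\<And>v. v \<in> xH_sum \<Longrightarrow> F v = vsmult qq (f v)"
    by metis
  have fI: "F v I = qq \<odot>\<^bsub>H\<^esub> f v I" if "v \<in> xH_sum" "I \<in> \<Lambda>" for v I
    using f(2)[OF that(1)] that(2) by (simp add: vsmult_def)
  let ?F = "\<lambda>v\<in>xH_sum. \<lambda>I\<in>\<Lambda>. f v I"
  have c: "?F \<in> carrier E\<^sub>q"
  proof (rule Eq_I)
    fix v I assume v: "v \<in> xH_sum" and I: "I \<in> \<Lambda>"
    show "f v I \<in> xH I" using f(1)[OF v] I by (rule V_xH)
    have fc: "f v I \<in> carrier H" using f(1)[OF v] I by simp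
    show "f (vmult v a) I = f v I \<otimes>\<^bsub>H\<^esub> a" if a: "a \<in> carrier H" for a
    proof (rule smult_q_inject)
      show "f (vmult v a) I \<in> carrier H" using f(1) v a I by simp
      show "f v I \<otimes>\<^bsub>H\<^esub> a \<in> carrier H" using fc a by simp
      have "F (vmult v a) I = F v I \<otimes>\<^bsub>H\<^esub> a" using Eq_mult[OF F v a] I by (simp add: vmult_def)
      then show "qq \<odot>\<^bsub>H\<^esub> f (vmult v a) I = qq \<odot>\<^bsub>H\<^esub> (f v I \<otimes>\<^bsub>H\<^esub> a)"
        using fI[OF v I] fI[OF vmult_closed[OF v a] I] fc a by (simp add: H_smult_l)
    qed
    fix w assume w: "w \<in> xH_sum"
    have fw: "f w I \<in> carrier H" using f(1)[OF w] I by simp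
    show "f (vadd v w) I = f v I \<oplus>\<^bsub>H\<^esub> f w I"
    proof (rule smult_q_inject)
      show "f (vadd v w) I \<in> carrier H" using f(1) v w I by simp
      show "f v I \<oplus>\<^bsub>H\<^esub> f w I \<in> carrier H" using fc fw by simp
      have "F (vadd v w) I = F v I \<oplus>\<^bsub>H\<^esub> F w I" using Eq_add[OF F v w] I by (simp add: vadd_def)
      then show "qq \<odot>\<^bsub>H\<^esub> f (vadd v w) I = qq \<odot>\<^bsub>H\<^esub> (f v I \<oplus>\<^bsub>H\<^esub> f w I)"
        using fI[OF v I] fI[OF w I] fI[OF vadd_closed[OF v w] I] fc fw by (simp add: smult_add)
    qed
  qed
  have "F = qq \<odot>\<^bsub>E\<^sub>q\<^esub> ?F"
    by (rule Eq_ext) (use F c Eq_smult_closed fI in \<open>auto simp: Eq_smult_apply\<close>)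
  then show ?thesis using c by blast
qed

definition vsingle :: "'w set \<Rightarrow> 'h \<Rightarrow> 'w set \<Rightarrow> 'h" where
  "vsingle J y = (\<lambda>I\<in>\<Lambda>. if I = J then y else \<zero>\<^bsub>H\<^esub>)"

lemma vsingle_closed: "J \<in> \<Lambda> \<Longrightarrow> y \<in> xH J \<Longrightarrow> vsingle J y \<in> xH_sum"
  unfolding vsingle_def using xH_zero \<Lambda>_D(1) by (intro V_I) auto

lemma vsingle_mult:
  assumes "J \<in> \<Lambda>" "y \<in> carrier H" "a \<in> carrier H"
  shows "vmult (vsingle J y) a = vsingle J (y \<otimes>\<^bsub>H\<^esub> a)"
  unfolding vsingle_def vmult_def using assms by (intro restrict_ext) auto

text \<open>If q divides F(x_J), it divides F(x_J a) = F(x_J) a. A general vector is a finite sum of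
  its components, as \<Lambda> is finite.\<close>

lemma Eq_determined:
  assumes fin: "finite \<Lambda>" and F: "F \<in> carrier E\<^sub>q"
    and gen: "\<And>J K w. J \<in> \<Lambda> \<Longrightarrow> K \<in> \<Lambda> \<Longrightarrow> c0 (F (vsingle J (x_par J)) K) w = 0"
    and v: "v \<in> xH_sum" and K: "K \<in> \<Lambda>"
  shows "c0 (F v K) w = 0"
proof -
  have single: "c0 (F (vsingle J y) K) w = 0" if J: "J \<in> \<Lambda>" and y: "y \<in> xH J" for J y w
  proof -
    note JS = \<Lambda>_D(1)[OF J]
    obtain a where a: "a \<in> carrier H" "y = x_par J \<otimes>\<^bsub>H\<^esub> a" using y by (rule xH_E)
    let ?v = "vsingle J (x_par J)"
    have vc: "?v \<in> xH_sum" using vsingle_closed[OF J x_par_in_xH[OF JS]] .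
    obtain u where u: "u \<in> xH_sum" "F ?v = vsmult qq u"
      using V_q_divides[OF Eq_closed[OF F vc]] gen[OF J] by blast
    have "vsingle J y = vmult ?v a" using vsingle_mult[OF J _ a(1), of "x_par J"] a JS by simp
    then have "F (vsingle J y) = vmult (vsmult qq u) a" using Eq_mult[OF F vc a(1)] u(2) by simp
    then have "F (vsingle J y) K = qq \<odot>\<^bsub>H\<^esub> (u K \<otimes>\<^bsub>H\<^esub> a)"
      using K u(1) a(1) by (simp add: vmult_def vsmult_def H_smult_l)
    then show ?thesis using u(1) K a(1) by (simp add: c0_smult)
  qed
  \<comment> \<open>The truncation of v to the components in A; components are then added one at a
    time.\<close>
  let ?r = "\<lambda>A. \<lambda>I\<in>\<Lambda>. if I \<in> A then v I else \<zero>\<^bsub>H\<^esub>"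
  have r: "?r A \<in> xH_sum" for A
    using V_xH[OF v] xH_zero \<Lambda>_D(1) by (intro V_I) auto
  have "c0 (F (?r A) K) w = 0" if "A \<subseteq> \<Lambda>" for A w
    using finite_subset[OF that fin] that
  proof (induction A arbitrary: w)
    case empty
    show ?case by (rule Eq_c0_zero[OF F r _ K]) simp
  next
    case (insert J A)
    have J: "J \<in> \<Lambda>" and AL: "A \<subseteq> \<Lambda>" using insert.prems by simp_all
    have s: "vsingle J (v J) \<in> xH_sum" using vsingle_closed[OF J V_xH[OF v J]] .
    have "?r (insert J A) = vadd (vsingle J (v J)) (?r A)"
      unfolding vadd_def vsingle_def using insert.hyps v by (intro restrict_ext) auto
    then have "F (?r (insert J A)) = vadd (F (vsingle J (v J))) (F (?r A))"
      using Eq_add[OF F s r] by simp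
    then have "c0 (F (?r (insert J A)) K) w = c0 (F (vsingle J (v J)) K) w + c0 (F (?r A) K) w"
      using K Eq_closed[OF F s] Eq_closed[OF F r[of A]] by (simp add: vadd_def c0_add)
    also have "\<dots> = 0 + 0" unfolding single[OF J V_xH[OF v J]] insert.IH[OF AL] ..
    finally show ?case by (simp only: add_0)
  qed
  from this[of \<Lambda> w] have "c0 (F (?r \<Lambda>) K) w = 0" by simp
  moreover have "?r \<Lambda> = v" using r v by (intro V_ext) auto
  ultimately show ?thesis by simp
qed

text \<open>F carries x_J T_s = q x_J over to F(x_J), where \<open>right_invariant\<close> evaluates
  it modulo q.\<close>

lemma Eq_right_invariant:
  assumes F: "F \<in> carrier E\<^sub>q" and J: "J \<in> \<Lambda>" and K: "K \<in> \<Lambda>" and s: "s \<in> J" and w: "w \<in> carrier G"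
  shows "c0 (F (vsingle J (x_par J)) K) (w \<otimes> s) = c0 (F (vsingle J (x_par J)) K) w"
proof -
  note JS = \<Lambda>_D(1)[OF J]
  let ?v = "vsingle J (x_par J)"
  have x: "x_par J \<in> carrier H" and sS: "s \<in> S" using JS s by auto
  have Ts: "T s \<in> carrier H" using T_closed sS by simp
  have v: "?v \<in> xH_sum" using vsingle_closed[OF J x_par_in_xH[OF JS]] .
  have "vmult ?v (T s) = vsmult qq ?v"
    unfolding vsingle_mult[OF J x Ts] x_par_mult_S[OF J s]
    unfolding vsingle_def vsmult_def using x by (intro restrict_ext) auto
  then have "vmult (F ?v) (T s) = vsmult qq (F ?v)"
    using Eq_mult[OF F v Ts] Eq_smult[OF F v] by simp
  then have "vmult (F ?v) (T s) K = vsmult qq (F ?v) K" by simp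
  then have "F ?v K \<otimes>\<^bsub>H\<^esub> T s = qq \<odot>\<^bsub>H\<^esub> F ?v K" using K by (simp add: vmult_def vsmult_def)
  then show ?thesis using Eq_closed[OF F v] K by (intro right_invariant[OF _ sS w]) auto
qed

lemma Eq_left_invariant:
  assumes F: "F \<in> carrier E\<^sub>q" and v: "v \<in> xH_sum" and K: "K \<in> \<Lambda>" and s: "s \<in> K" and w: "w \<in> carrier G"
  shows "c0 (F v K) (s \<otimes> w) = c0 (F v K) w"
proof -
  note KS = \<Lambda>_D(1)[OF K]
  have x: "F v K \<in> xH K" using V_xH[OF Eq_closed[OF F v] K] .
  have "s \<in> carrier G" using s KS by auto
  then show ?thesis
    using xH_invariant[OF K x, of "s \<otimes> w"] xH_invariant[OF K x w] dmin_mult[OF KS W_gen[OF s] w] w by simp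
qed

section \<open>The maps u, d and 1 as elements of the endomorphism ring\<close>

lemma component_map_closed:
  assumes IJ: "I \<in> \<Lambda>" "J \<in> \<Lambda>" and f: "\<And>y. y \<in> xH J \<Longrightarrow> f y \<in> xH I"
    "\<And>y z. y \<in> xH J \<Longrightarrow> z \<in> xH J \<Longrightarrow> f (y \<oplus>\<^bsub>H\<^esub> z) = f y \<oplus>\<^bsub>H\<^esub> f z"
    "\<And>y a. y \<in> xH J \<Longrightarrow> a \<in> carrier H \<Longrightarrow> f (y \<otimes>\<^bsub>H\<^esub> a) = f y \<otimes>\<^bsub>H\<^esub> a"
  shows "component_map I J f \<in> carrier E\<^sub>q"
  unfolding component_map_def
proof (rule Eq_I)
  fix v K assume v: "v \<in> xH_sum" and K: "K \<in> \<Lambda>"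
  have vJ: "v J \<in> xH J" using V_xH[OF v IJ(2)] .
  show "(if K = I then f (v J) else \<zero>\<^bsub>H\<^esub>) \<in> xH K" using f(1)[OF vJ] xH_zero \<Lambda>_D(1)[OF K] by simp
  show "(if K = I then f (vmult v a J) else \<zero>\<^bsub>H\<^esub>) = (if K = I then f (v J) else \<zero>\<^bsub>H\<^esub>) \<otimes>\<^bsub>H\<^esub> a"
    if "a \<in> carrier H" for a using f(3)[OF vJ that] that IJ by (simp add: vmult_def)
  fix w assume w: "w \<in> xH_sum"
  have wJ: "w J \<in> xH J" using V_xH[OF w IJ(2)] .
  show "(if K = I then f (vadd v w J) else \<zero>\<^bsub>H\<^esub>) =
      (if K = I then f (v J) else \<zero>\<^bsub>H\<^esub>) \<oplus>\<^bsub>H\<^esub> (if K = I then f (w J) else \<zero>\<^bsub>H\<^esub>)"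
    using f(2)[OF vJ wJ] IJ by (simp add: vadd_def)
qed

lemma inclusion_closed:
  assumes "J \<in> \<Lambda>" "I \<subseteq> J" "I \<in> \<Lambda>" shows "component_map I J (\<lambda>a. a) \<in> carrier E\<^sub>q"
  using xH_mono[OF assms(1,2)] assms by (intro component_map_closed) auto

lemma h_par_map_closed:
  assumes J: "J \<in> \<Lambda>" and IJ: "I \<subseteq> J" and I: "I \<in> \<Lambda>"
  shows "component_map J I (\<lambda>a. h_par J I \<otimes>\<^bsub>H\<^esub> a) \<in> carrier E\<^sub>q"
proof (rule component_map_closed)
  note JS = \<Lambda>_D(1)[OF J] and IS = \<Lambda>_D(1)[OF I]
  have h: "h_par J I \<in> carrier H" using JS by simp
  fix y assume y: "y \<in> xH I"
  have yc: "y \<in> carrier H" using xH_carrier[OF IS y] .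
  obtain a where a: "a \<in> carrier H" "y = x_par I \<otimes>\<^bsub>H\<^esub> a" using y by (rule xH_E)
  have "h_par J I \<otimes>\<^bsub>H\<^esub> y = x_par J \<otimes>\<^bsub>H\<^esub> a"
    unfolding a(2) h_par_mult_x_par[OF J IJ, symmetric] using h a IS by (simp add: H.m_assoc)
  then show "h_par J I \<otimes>\<^bsub>H\<^esub> y \<in> xH J" using xH_I[OF a(1)] by simp
  show "h_par J I \<otimes>\<^bsub>H\<^esub> (y \<otimes>\<^bsub>H\<^esub> b) = h_par J I \<otimes>\<^bsub>H\<^esub> y \<otimes>\<^bsub>H\<^esub> b" if "b \<in> carrier H" for b
    using h yc that by (simp add: H.m_assoc)
  fix z assume "z \<in> xH I"
  then show "h_par J I \<otimes>\<^bsub>H\<^esub> (y \<oplus>\<^bsub>H\<^esub> z) = h_par J I \<otimes>\<^bsub>H\<^esub> y \<oplus>\<^bsub>H\<^esub> h_par J I \<otimes>\<^bsub>H\<^esub> z"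
    using h yc xH_carrier[OF IS] by (simp add: H.r_distr)
qed (use J I in auto)

text \<open>For y = x_I a one has h y = x_J a. At q = 0 this is \<open>c0 a\<close> after
  \<open>dmin J\<close>; since \<open>dmin I\<close> fixes \<open>dmin J w\<close>, a may be
  replaced by y.\<close>

lemma c0_h_par_mult:
  assumes J: "J \<in> \<Lambda>" and IJ: "I \<subseteq> J" and I: "I \<in> \<Lambda>" and y: "y \<in> xH I" and w: "w \<in> carrier G"
  shows "c0 (h_par J I \<otimes>\<^bsub>H\<^esub> y) w = c0 y (dmin J w)"
proof -
  note JS = \<Lambda>_D(1)[OF J] and IS = \<Lambda>_D(1)[OF I]
  have h: "h_par J I \<in> carrier H" using JS by simp
  obtain a where a: "a \<in> carrier H" "y = x_par I \<otimes>\<^bsub>H\<^esub> a" using y by (rule xH_E)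
  have dc: "dmin J w \<in> carrier G" using JS w by simp
  have "h_par J I \<otimes>\<^bsub>H\<^esub> y = x_par J \<otimes>\<^bsub>H\<^esub> a"
    unfolding a(2) h_par_mult_x_par[OF J IJ, symmetric] using h a IS by (simp add: H.m_assoc)
  then have "c0 (h_par J I \<otimes>\<^bsub>H\<^esub> y) w = c0 a (dmin J w)" using c0_x_par_mult[OF J a(1) w] by simp
  also have "\<dots> = c0 y (dmin J w)"
    unfolding a(2) c0_x_par_mult[OF I a(1) dc] dmin_dmin[OF IJ JS w] ..
  finally show ?thesis .
qed

end


subsection \<open>Monoid rings\<close>

lemma monoid_ring_simps [simp]:
  "carrier (monoid_ring M) = {f. Poly_Mapping.keys f \<subseteq> carrier M}"
  "f \<otimes>\<^bsub>monoid_ring M\<^esub> g = frag_extend (\<lambda>x. frag_extend (\<lambda>y. frag_of (x \<otimes>\<^bsub>M\<^esub> y)) g) f"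
  "\<one>\<^bsub>monoid_ring M\<^esub> = frag_of \<one>\<^bsub>M\<^esub>"
  "\<zero>\<^bsub>monoid_ring M\<^esub> = 0"
  "f \<oplus>\<^bsub>monoid_ring M\<^esub> g = f + g"
  by (simp_all add: monoid_ring_def)

lemma keys_add_subset:
  "Poly_Mapping.keys f \<subseteq> A \<Longrightarrow> Poly_Mapping.keys g \<subseteq> A \<Longrightarrow> Poly_Mapping.keys (f + g) \<subseteq> A"
  using Poly_Mapping.keys_add[of f g] by blast

lemma keys_diff_subset:
  "Poly_Mapping.keys f \<subseteq> A \<Longrightarrow> Poly_Mapping.keys g \<subseteq> A \<Longrightarrow> Poly_Mapping.keys (f - g) \<subseteq> A"
  using keys_diff[of f g] by blast

lemma keys_extend_subset:
  "Poly_Mapping.keys f \<subseteq> A \<Longrightarrow> (\<And>x. x \<in> A \<Longrightarrow> Poly_Mapping.keys (b x) \<subseteq> B) \<Longrightarrow>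
    Poly_Mapping.keys (frag_extend b f) \<subseteq> B"
  using keys_frag_extend[of b f] by blast

lemma frag_extend_cong_keys:
  "Poly_Mapping.keys f \<subseteq> A \<Longrightarrow> (\<And>x. x \<in> A \<Longrightarrow> b x = c x) \<Longrightarrow> frag_extend b f = frag_extend c f"
  by (rule frag_extend_eq) blast

lemma frag_extend_add_fun: "frag_extend (\<lambda>x. b x + c x) f = frag_extend b f + frag_extend c f"
  unfolding frag_extend_def by (simp add: frag_cmul_distrib2 sum.distrib)

lemma frag_extend_frag_extend:
  "frag_extend b (frag_extend c f) = frag_extend (\<lambda>x. frag_extend b (c x)) f"
proof -
  have "Poly_Mapping.keys f \<subseteq> UNIV" by simp
  then show ?thesis by (induction f rule: frag_induction) (auto simp: frag_extend_diff)
qed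

context Group.monoid
begin

lemma monoid_ring_ring: "ring (monoid_ring G)"
proof (rule ringI)
  have mc: "Poly_Mapping.keys (frag_extend (\<lambda>x. frag_extend (\<lambda>y. frag_of (x \<otimes> y)) g) f) \<subseteq> carrier G"
    if "Poly_Mapping.keys f \<subseteq> carrier G" "Poly_Mapping.keys g \<subseteq> carrier G" for f g
    using that by (intro keys_extend_subset[of _ "carrier G"]) auto
  show "abelian_group (monoid_ring G)"
  proof (rule abelian_groupI)
    fix f assume "f \<in> carrier (monoid_ring G)"
    then show "\<exists>g \<in> carrier (monoid_ring G). g \<oplus>\<^bsub>monoid_ring G\<^esub> f = \<zero>\<^bsub>monoid_ring G\<^esub>"
      by (intro bexI[of _ "- f"]) auto
  qed (auto simp: add_ac keys_add_subset intro: subsetD[OF Poly_Mapping.keys_add, THEN UnE])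
  show "Group.monoid (monoid_ring G)"
  proof (rule monoidI)
    fix f g h assume *: "f \<in> carrier (monoid_ring G)" "g \<in> carrier (monoid_ring G)" "h \<in> carrier (monoid_ring G)"
    show "f \<otimes>\<^bsub>monoid_ring G\<^esub> g \<in> carrier (monoid_ring G)" using mc * by simp
    show "\<one>\<^bsub>monoid_ring G\<^esub> \<otimes>\<^bsub>monoid_ring G\<^esub> f = f"
    proof -
      have "frag_extend (\<lambda>y. frag_of (\<one> \<otimes> y)) f = frag_extend frag_of f"
        using * by (intro frag_extend_cong_keys[of _ "carrier G"]) auto
      then show ?thesis using frag_expansion[of f] by simp
    qed
    show "f \<otimes>\<^bsub>monoid_ring G\<^esub> \<one>\<^bsub>monoid_ring G\<^esub> = f"
    proof -
      have "frag_extend (\<lambda>x. frag_of (x \<otimes> \<one>)) f = frag_extend frag_of f"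
        using * by (intro frag_extend_cong_keys[of _ "carrier G"]) auto
      then show ?thesis using frag_expansion[of f] by simp
    qed
    show "f \<otimes>\<^bsub>monoid_ring G\<^esub> g \<otimes>\<^bsub>monoid_ring G\<^esub> h = f \<otimes>\<^bsub>monoid_ring G\<^esub> (g \<otimes>\<^bsub>monoid_ring G\<^esub> h)"
    proof -
      have "frag_extend (\<lambda>y. frag_extend (\<lambda>z. frag_of (x \<otimes> y \<otimes> z)) h) g =
          frag_extend (\<lambda>y. frag_extend (\<lambda>z. frag_of (x \<otimes> (y \<otimes> z))) h) g" if "x \<in> carrier G" for x
        using * that by (intro frag_extend_cong_keys[of _ "carrier G"]) (auto simp: m_assoc)
      then show ?thesis using *(1)
        by (simp add: frag_extend_frag_extend) (rule frag_extend_cong_keys[of _ "carrier G"], simp_all)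
    qed
  qed simp
  fix f g h assume *: "f \<in> carrier (monoid_ring G)" "g \<in> carrier (monoid_ring G)" "h \<in> carrier (monoid_ring G)"
  show "(f \<oplus>\<^bsub>monoid_ring G\<^esub> g) \<otimes>\<^bsub>monoid_ring G\<^esub> h =
      f \<otimes>\<^bsub>monoid_ring G\<^esub> h \<oplus>\<^bsub>monoid_ring G\<^esub> g \<otimes>\<^bsub>monoid_ring G\<^esub> h"
    by (simp add: frag_extend_add)
  show "h \<otimes>\<^bsub>monoid_ring G\<^esub> (f \<oplus>\<^bsub>monoid_ring G\<^esub> g) =
      h \<otimes>\<^bsub>monoid_ring G\<^esub> f \<oplus>\<^bsub>monoid_ring G\<^esub> h \<otimes>\<^bsub>monoid_ring G\<^esub> g"
    by (simp add: frag_extend_add frag_extend_add_fun)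
qed

lemma monoid_ring_minus [simp]: assumes "f \<in> carrier (monoid_ring G)" "g \<in> carrier (monoid_ring G)"
  shows "f \<ominus>\<^bsub>monoid_ring G\<^esub> g = f - g"
proof -
  interpret MR: ring "monoid_ring G" by (rule monoid_ring_ring)
  have "\<ominus>\<^bsub>monoid_ring G\<^esub> g = - g" using assms by (intro MR.minus_equality) auto
  then show ?thesis by (simp add: a_minus_def)
qed

end

text \<open>The analogue of \<open>frag_extend\<close> with values in a ring given by a
  carrier.\<close>

definition (in ring) ext_mor :: "('x \<Rightarrow> 'a) \<Rightarrow> ('x \<Rightarrow>\<^sub>0 int) \<Rightarrow> 'a" where
  "ext_mor g f = finsum R (\<lambda>x. [Poly_Mapping.lookup f x] \<cdot> g x) (Poly_Mapping.keys f)"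

context ring
begin

lemma ext_mor_superset:
  assumes "finite A" "Poly_Mapping.keys f \<subseteq> A" "\<And>x. x \<in> A \<Longrightarrow> g x \<in> carrier R"
  shows "ext_mor g f = finsum R (\<lambda>x. [Poly_Mapping.lookup f x] \<cdot> g x) A"
  unfolding ext_mor_def using assms
  by (intro add.finprod_mono_neutral_cong_left) (auto simp: in_keys_iff add_pow_int_ge)

lemma ext_mor_closed:
  assumes "Poly_Mapping.keys f \<subseteq> X" "\<And>x. x \<in> X \<Longrightarrow> g x \<in> carrier R"
  shows "ext_mor g f \<in> carrier R"
  unfolding ext_mor_def using assms by (intro finsum_closed) auto

lemma ext_mor_0 [simp]: "ext_mor g 0 = \<zero>"
  by (simp add: ext_mor_def)

lemma ext_mor_of: "g x \<in> carrier R \<Longrightarrow> ext_mor g (frag_of x) = g x"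
  by (simp add: ext_mor_def)

lemma ext_mor_add:
  assumes f: "Poly_Mapping.keys f \<subseteq> X" and h: "Poly_Mapping.keys h \<subseteq> X"
    and g: "\<And>x. x \<in> X \<Longrightarrow> g x \<in> carrier R"
  shows "ext_mor g (f + h) = ext_mor g f \<oplus> ext_mor g h"
proof -
  let ?A = "Poly_Mapping.keys f \<union> Poly_Mapping.keys h"
  have gA: "g x \<in> carrier R" if "x \<in> ?A" for x using f h g that by blast
  have "ext_mor g (f + h) = finsum R (\<lambda>x. [Poly_Mapping.lookup (f + h) x] \<cdot> g x) ?A"
    using gA Poly_Mapping.keys_add[of f h] by (intro ext_mor_superset) auto
  also have "\<dots> = finsum R (\<lambda>x. [Poly_Mapping.lookup f x] \<cdot> g x \<oplus> [Poly_Mapping.lookup h x] \<cdot> g x) ?A"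
    using gA by (intro finsum_cong') (auto simp: lookup_add add.int_pow_mult)
  also have "\<dots> = finsum R (\<lambda>x. [Poly_Mapping.lookup f x] \<cdot> g x) ?A \<oplus>
      finsum R (\<lambda>x. [Poly_Mapping.lookup h x] \<cdot> g x) ?A"
    using gA by (intro finsum_addf) auto
  also have "finsum R (\<lambda>x. [Poly_Mapping.lookup f x] \<cdot> g x) ?A = ext_mor g f"
    using gA by (intro ext_mor_superset[symmetric]) auto
  also have "finsum R (\<lambda>x. [Poly_Mapping.lookup h x] \<cdot> g x) ?A = ext_mor g h"
    using gA by (intro ext_mor_superset[symmetric]) auto
  finally show ?thesis .
qed

lemma ext_mor_diff:
  assumes f: "Poly_Mapping.keys f \<subseteq> X" and h: "Poly_Mapping.keys h \<subseteq> X"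
    and g: "\<And>x. x \<in> X \<Longrightarrow> g x \<in> carrier R"
  shows "ext_mor g (f - h) = ext_mor g f \<ominus> ext_mor g h"
proof -
  have d: "Poly_Mapping.keys (f - h) \<subseteq> X" using keys_diff_subset[OF f h] .
  have "ext_mor g f = ext_mor g (f - h) \<oplus> ext_mor g h"
    using ext_mor_add[OF d h g] by simp
  then show ?thesis
    using ext_mor_closed[OF d g] ext_mor_closed[OF h g] by (simp add: a_minus_def a_assoc r_neg)
qed

text \<open>The universal property of the monoid ring. Multiplicativity is bilinear, so it is
  checked for a basis element on the left (\<open>m1\<close>) and then for a general left factor
  (\<open>m\<close>).\<close>

lemma ext_mor_hom:
  assumes M: "Group.monoid M" and g: "\<And>x. x \<in> carrier M \<Longrightarrow> g x \<in> carrier R"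
    and gm: "\<And>x y. x \<in> carrier M \<Longrightarrow> y \<in> carrier M \<Longrightarrow> g (x \<otimes>\<^bsub>M\<^esub> y) = g x \<otimes> g y"
    and g1: "g \<one>\<^bsub>M\<^esub> = \<one>"
  shows "ring_hom_ring (monoid_ring M) R (ext_mor g)"
proof -
  interpret M: Group.monoid M by (rule M)
  have keys_mult: "Poly_Mapping.keys (frag_extend (\<lambda>y. frag_of (x \<otimes>\<^bsub>M\<^esub> y)) h) \<subseteq> carrier M"
    if "x \<in> carrier M" "Poly_Mapping.keys h \<subseteq> carrier M" for x h
    using that by (intro keys_extend_subset[of _ "carrier M"]) auto
  have m1: "Poly_Mapping.keys h \<subseteq> carrier M \<and>
      ext_mor g (frag_extend (\<lambda>y. frag_of (x \<otimes>\<^bsub>M\<^esub> y)) h) = g x \<otimes> ext_mor g h"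
    if x: "x \<in> carrier M" and h: "Poly_Mapping.keys h \<subseteq> carrier M" for x h
    using h
  proof (induction h rule: frag_induction)
    case zero
    then show ?case using g x by simp
  next
    case (one y)
    then show ?case using x g gm by (simp add: ext_mor_of)
  next
    case (diff a b)
    then show ?case
      using ext_mor_diff[of a "carrier M" b g] ext_mor_closed[of a "carrier M" g] ext_mor_closed[of b "carrier M" g]
        ext_mor_diff[OF keys_mult[OF x] keys_mult[OF x], of a b g] g x
      by (simp add: frag_extend_diff keys_diff_subset a_minus_def r_distr r_minus)
  qed
  have m: "Poly_Mapping.keys f \<subseteq> carrier M \<and>
      ext_mor g (f \<otimes>\<^bsub>monoid_ring M\<^esub> h) = ext_mor g f \<otimes> ext_mor g h"
    if f: "Poly_Mapping.keys f \<subseteq> carrier M" and h: "Poly_Mapping.keys h \<subseteq> carrier M" for f h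
    using f
  proof (induction f rule: frag_induction)
    case zero
    then show ?case using ext_mor_closed[OF h g] by simp
  next
    case (one y)
    then show ?case using m1 h g by (simp add: ext_mor_of)
  next
    case (diff a b)
    have ml: "Poly_Mapping.keys (frag_extend (\<lambda>x. frag_extend (\<lambda>y. frag_of (x \<otimes>\<^bsub>M\<^esub> y)) h) k) \<subseteq> carrier M"
      if "Poly_Mapping.keys k \<subseteq> carrier M" for k
      using that keys_mult h by (intro keys_extend_subset[of _ "carrier M"]) auto
    show ?case using diff
        ext_mor_diff[of a "carrier M" b g] ext_mor_closed[of a "carrier M" g] ext_mor_closed[of b "carrier M" g]
        ext_mor_diff[OF ml ml, of a b g] g ext_mor_closed[OF h g]
      by (simp add: frag_extend_diff keys_diff_subset a_minus_def l_distr l_minus)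
  qed
  show ?thesis
  proof (rule ring_hom_ringI[OF M.monoid_ring_ring ring_axioms])
    fix f h assume "f \<in> carrier (monoid_ring M)" "h \<in> carrier (monoid_ring M)"
    then have fh: "Poly_Mapping.keys f \<subseteq> carrier M" "Poly_Mapping.keys h \<subseteq> carrier M" by simp_all
    show "ext_mor g f \<in> carrier R" using ext_mor_closed fh g by blast
    show "ext_mor g (f \<otimes>\<^bsub>monoid_ring M\<^esub> h) = ext_mor g f \<otimes> ext_mor g h" using m[OF fh] by blast
    show "ext_mor g (f \<oplus>\<^bsub>monoid_ring M\<^esub> h) = ext_mor g f \<oplus> ext_mor g h"
      using ext_mor_add[OF fh g] by simp
  next
    show "ext_mor g \<one>\<^bsub>monoid_ring M\<^esub> = \<one>" using g1 by (simp add: ext_mor_of)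
  qed
qed

end


subsection \<open>The coefficient rings\<close>

lemma R_denom_nonzero: "1 + [:0, 1:] * g \<noteq> (0 :: int poly)"
proof
  assume "1 + [:0, 1:] * g = 0"
  then have "poly (1 + [:0, 1:] * g) 0 = 0" by (simp only: poly_0)
  then show False by simp
qed

lemma R_carrier_E:
  assumes "r \<in> R_carrier" obtains f g where "r = Fract f (1 + [:0, 1:] * g)"
  using assms unfolding R_carrier_def by blast

text \<open>The denominators 1 + q g are the polynomials with constant term 1, a description that is
  visibly closed under products.\<close>

lemma R_carrier_I: "poly d 0 = 1 \<Longrightarrow> Fract f d \<in> R_carrier"
proof -
  assume "poly d 0 = 1"
  then have "[:0, 1:] dvd d - 1" using poly_eq_0_iff_dvd[of "d - 1" 0] by simp
  then obtain g where "d - 1 = [:0, 1:] * g" by (rule dvdE)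
  then have "d = 1 + [:0, 1:] * g" by (simp add: algebra_simps)
  then show ?thesis unfolding R_carrier_def by blast
qed

text \<open>Cross-multiplying two representations and evaluating at 0 shows that the constant term
  of the numerator does not depend on the representation, as the denominators evaluate to 1.\<close>

lemma R_to_Z_Fract:
  assumes "poly d 0 = 1" shows "R_to_Z (Fract f d) = poly f 0"
proof -
  have d: "d \<noteq> 0" using assms by auto
  have "n = poly f 0"
    if "Fract f d = Fract f' (1 + [:0, 1:] * g')" "n = poly f' 0" for n f' g'
  proof -
    have "f * (1 + [:0, 1:] * g') = f' * d" using that(1) eq_fract(1)[OF d R_denom_nonzero] by blast
    then have "poly (f * (1 + [:0, 1:] * g')) 0 = poly (f' * d) 0" by simp
    then show ?thesis using that(2) assms by simp
  qed
  moreover have "\<exists>f' g'. Fract f d = Fract f' (1 + [:0, 1:] * g') \<and> poly f 0 = poly f' 0"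
  proof -
    obtain f' g' where *: "Fract f d = Fract f' (1 + [:0, 1:] * g')"
      using R_carrier_I[OF assms] by (rule R_carrier_E)
    have "f * (1 + [:0, 1:] * g') = f' * d" using * eq_fract(1)[OF d R_denom_nonzero] by blast
    then have "poly (f * (1 + [:0, 1:] * g')) 0 = poly (f' * d) 0" by simp
    then show ?thesis using * assms by (intro exI[of _ f'] exI[of _ g']) simp
  qed
  ultimately show ?thesis unfolding R_to_Z_def by (intro the_equality) blast+
qed

lemma R_carrier_rep:
  assumes "r \<in> R_carrier" obtains f d where "r = Fract f d" "poly d 0 = 1" "d \<noteq> 0" "R_to_Z r = poly f 0"
proof -
  obtain f g where r: "r = Fract f (1 + [:0, 1:] * g)" using assms by (rule R_carrier_E)
  show thesis
    by (rule that[OF r _ R_denom_nonzero]) (use r in \<open>simp_all add: R_to_Z_Fract\<close>)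
qed

lemma R_add:
  assumes "r \<in> R_carrier" "s \<in> R_carrier"
  shows "r + s \<in> R_carrier" "R_to_Z (r + s) = R_to_Z r + R_to_Z s"
proof -
  obtain f d where r: "r = Fract f d" "poly d 0 = 1" "d \<noteq> 0" "R_to_Z r = poly f 0"
    using assms(1) by (rule R_carrier_rep)
  obtain f' d' where s: "s = Fract f' d'" "poly d' 0 = 1" "d' \<noteq> 0" "R_to_Z s = poly f' 0"
    using assms(2) by (rule R_carrier_rep)
  have *: "r + s = Fract (f * d' + f' * d) (d * d')" using r s by simp
  have d: "poly (d * d') 0 = 1" using r s by simp
  show "r + s \<in> R_carrier" unfolding * using d by (rule R_carrier_I)
  show "R_to_Z (r + s) = R_to_Z r + R_to_Z s" unfolding * R_to_Z_Fract[OF d] using r s by simp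
qed

lemma R_mult:
  assumes "r \<in> R_carrier" "s \<in> R_carrier"
  shows "r * s \<in> R_carrier" "R_to_Z (r * s) = R_to_Z r * R_to_Z s"
proof -
  obtain f d where r: "r = Fract f d" "poly d 0 = 1" "d \<noteq> 0" "R_to_Z r = poly f 0"
    using assms(1) by (rule R_carrier_rep)
  obtain f' d' where s: "s = Fract f' d'" "poly d' 0 = 1" "d' \<noteq> 0" "R_to_Z s = poly f' 0"
    using assms(2) by (rule R_carrier_rep)
  have *: "r * s = Fract (f * f') (d * d')" using r s by simp
  have d: "poly (d * d') 0 = 1" using r s by simp
  show "r * s \<in> R_carrier" unfolding * using d by (rule R_carrier_I)
  show "R_to_Z (r * s) = R_to_Z r * R_to_Z s" unfolding * R_to_Z_Fract[OF d] using r s by simp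
qed

lemma R_one: "1 \<in> R_carrier" "R_to_Z 1 = 1"
  using R_carrier_I[of 1 1] R_to_Z_Fract[of 1 1] by (simp_all add: One_fract_def)

lemma R_from_Zq: "Zq_to_R a \<in> R_carrier" "R_to_Z (Zq_to_R a) = Zq_to_Z a"
  unfolding Zq_to_R_def Zq_to_Z_def using R_carrier_I[of 1 a] R_to_Z_Fract[of 1 a] by simp_all

lemma R_ring_simps [simp]:
  "carrier R_ring = R_carrier" "r \<otimes>\<^bsub>R_ring\<^esub> s = r * s" "\<one>\<^bsub>R_ring\<^esub> = 1" "r \<oplus>\<^bsub>R_ring\<^esub> s = r + s"
  by (simp_all add: R_ring_def)

lemma R_ring_monoid: "Group.monoid R_ring"
  by (rule monoidI) (auto simp: R_mult R_one mult.assoc)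

lemma Z_monoid: "Group.monoid \<Z>"
  by (rule monoidI) auto


subsection \<open>Base change\<close>

text \<open>One statement for general B serves both \<open>R_ring\<close> and \<open>\<Z>\<close>.
  The last clause is the universal property: a map out of the base change has to be checked only on
  the three kinds of relations.\<close>

lemma tensor_ideal_ideal:
  assumes "Group.monoid B" "Group.monoid M"
    and "\<And>b c. b \<in> carrier B \<Longrightarrow> c \<in> carrier B \<Longrightarrow> b \<oplus>\<^bsub>B\<^esub> c \<in> carrier B"
    and "\<And>x y. x \<in> carrier M \<Longrightarrow> y \<in> carrier M \<Longrightarrow> x \<oplus>\<^bsub>M\<^esub> y \<in> carrier M"
    and "\<And>a x. a \<in> carrier A \<Longrightarrow> x \<in> carrier M \<Longrightarrow> a \<odot>\<^bsub>M\<^esub> x \<in> carrier M"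
    and "\<And>a. a \<in> carrier A \<Longrightarrow> \<phi> a \<in> carrier B"
  shows "ideal (tensor_ideal A \<phi> B M) (monoid_ring (B \<times>\<times> M))"
    and "b \<in> carrier B \<Longrightarrow> c \<in> carrier B \<Longrightarrow> x \<in> carrier M \<Longrightarrow>
      frag_of (b \<oplus>\<^bsub>B\<^esub> c, x) - frag_of (b, x) - frag_of (c, x) \<in> tensor_ideal A \<phi> B M"
    and "b \<in> carrier B \<Longrightarrow> x \<in> carrier M \<Longrightarrow> y \<in> carrier M \<Longrightarrow>
      frag_of (b, x \<oplus>\<^bsub>M\<^esub> y) - frag_of (b, x) - frag_of (b, y) \<in> tensor_ideal A \<phi> B M"
    and "a \<in> carrier A \<Longrightarrow> b \<in> carrier B \<Longrightarrow> x \<in> carrier M \<Longrightarrow>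
      frag_of (b \<otimes>\<^bsub>B\<^esub> \<phi> a, x) - frag_of (b, a \<odot>\<^bsub>M\<^esub> x) \<in> tensor_ideal A \<phi> B M"
    and "ideal K (monoid_ring (B \<times>\<times> M)) \<Longrightarrow>
      (\<And>b c x. b \<in> carrier B \<Longrightarrow> c \<in> carrier B \<Longrightarrow> x \<in> carrier M \<Longrightarrow>
        frag_of (b \<oplus>\<^bsub>B\<^esub> c, x) - frag_of (b, x) - frag_of (c, x) \<in> K) \<Longrightarrow>
      (\<And>b x y. b \<in> carrier B \<Longrightarrow> x \<in> carrier M \<Longrightarrow> y \<in> carrier M \<Longrightarrow>
        frag_of (b, x \<oplus>\<^bsub>M\<^esub> y) - frag_of (b, x) - frag_of (b, y) \<in> K) \<Longrightarrow>
      (\<And>a b x. a \<in> carrier A \<Longrightarrow> b \<in> carrier B \<Longrightarrow> x \<in> carrier M \<Longrightarrow>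
        frag_of (b \<otimes>\<^bsub>B\<^esub> \<phi> a, x) - frag_of (b, a \<odot>\<^bsub>M\<^esub> x) \<in> K) \<Longrightarrow>
      tensor_ideal A \<phi> B M \<subseteq> K"
proof -
  interpret BM: Group.monoid "B \<times>\<times> M" using assms(1,2) by (rule DirProd_monoid)
  interpret MR: ring "monoid_ring (B \<times>\<times> M)" by (rule BM.monoid_ring_ring)
  interpret B: Group.monoid B by fact
  let ?g = "{frag_of (b \<oplus>\<^bsub>B\<^esub> c, x) - frag_of (b, x) - frag_of (c, x) | b c x.
        b \<in> carrier B \<and> c \<in> carrier B \<and> x \<in> carrier M} \<union>
     {frag_of (b, x \<oplus>\<^bsub>M\<^esub> y) - frag_of (b, x) - frag_of (b, y) | b x y.
        b \<in> carrier B \<and> x \<in> carrier M \<and> y \<in> carrier M} \<union>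
     {frag_of (b \<otimes>\<^bsub>B\<^esub> \<phi> a, x) - frag_of (b, a \<odot>\<^bsub>M\<^esub> x) | a b x.
        a \<in> carrier A \<and> b \<in> carrier B \<and> x \<in> carrier M}"
  have T: "tensor_ideal A \<phi> B M = Idl\<^bsub>monoid_ring (B \<times>\<times> M)\<^esub> ?g" by (simp add: tensor_ideal_def)
  have sub: "?g \<subseteq> carrier (monoid_ring (B \<times>\<times> M))"
  proof -
    define C :: "(_ \<Rightarrow>\<^sub>0 int) set" where "C = {f. Poly_Mapping.keys f \<subseteq> carrier B \<times> carrier M}"
    have dc: "f - h \<in> C" if "f \<in> C" "h \<in> C" for f h
      using that keys_diff_subset unfolding C_def by blast
    have fc: "frag_of (b, x) \<in> C" if "b \<in> carrier B" "x \<in> carrier M" for b x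
      using that unfolding C_def by simp
    have "?g \<subseteq> C" by (auto intro!: dc fc B.m_closed assms)
    then show ?thesis by (simp add: C_def)
  qed
  show "ideal (tensor_ideal A \<phi> B M) (monoid_ring (B \<times>\<times> M))"
    unfolding T using sub by (rule MR.genideal_ideal)
  note self = subsetD[OF MR.genideal_self[OF sub]]
  show "b \<in> carrier B \<Longrightarrow> c \<in> carrier B \<Longrightarrow> x \<in> carrier M \<Longrightarrow>
      frag_of (b \<oplus>\<^bsub>B\<^esub> c, x) - frag_of (b, x) - frag_of (c, x) \<in> tensor_ideal A \<phi> B M"
    unfolding T by (rule self) blast
  show "b \<in> carrier B \<Longrightarrow> x \<in> carrier M \<Longrightarrow> y \<in> carrier M \<Longrightarrow>
      frag_of (b, x \<oplus>\<^bsub>M\<^esub> y) - frag_of (b, x) - frag_of (b, y) \<in> tensor_ideal A \<phi> B M"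
    unfolding T by (rule self) blast
  show "a \<in> carrier A \<Longrightarrow> b \<in> carrier B \<Longrightarrow> x \<in> carrier M \<Longrightarrow>
      frag_of (b \<otimes>\<^bsub>B\<^esub> \<phi> a, x) - frag_of (b, a \<odot>\<^bsub>M\<^esub> x) \<in> tensor_ideal A \<phi> B M"
    unfolding T by (rule self) blast
  assume K: "ideal K (monoid_ring (B \<times>\<times> M))"
    and k: "\<And>b c x. b \<in> carrier B \<Longrightarrow> c \<in> carrier B \<Longrightarrow> x \<in> carrier M \<Longrightarrow>
        frag_of (b \<oplus>\<^bsub>B\<^esub> c, x) - frag_of (b, x) - frag_of (c, x) \<in> K"
      "\<And>b x y. b \<in> carrier B \<Longrightarrow> x \<in> carrier M \<Longrightarrow> y \<in> carrier M \<Longrightarrow>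
        frag_of (b, x \<oplus>\<^bsub>M\<^esub> y) - frag_of (b, x) - frag_of (b, y) \<in> K"
      "\<And>a b x. a \<in> carrier A \<Longrightarrow> b \<in> carrier B \<Longrightarrow> x \<in> carrier M \<Longrightarrow>
        frag_of (b \<otimes>\<^bsub>B\<^esub> \<phi> a, x) - frag_of (b, a \<odot>\<^bsub>M\<^esub> x) \<in> K"
  have "?g \<subseteq> K" using k by auto
  then show "tensor_ideal A \<phi> B M \<subseteq> K" unfolding T using K by (intro MR.genideal_minimal)
qed

lemma (in ideal) coset_eq_iff:
  assumes "a \<in> carrier R" "b \<in> carrier R" shows "I +> a = I +> b \<longleftrightarrow> a \<ominus> b \<in> I"
  using quotient_eq_iff_same_a_r_cos[OF is_ideal assms] by simp

context hecke_algebra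
begin

abbreviation MR where "MR \<equiv> monoid_ring (R_ring \<times>\<times> E\<^sub>q)"
abbreviation MZ where "MZ \<equiv> monoid_ring (\<Z> \<times>\<times> E\<^sub>q)"
abbreviation TR where "TR \<equiv> tensor_ideal Zq Zq_to_R R_ring E\<^sub>q"
abbreviation TZ where "TZ \<equiv> tensor_ideal Zq Zq_to_Z \<Z> E\<^sub>q"

lemma RE_monoid: "Group.monoid (R_ring \<times>\<times> E\<^sub>q)"
  by (rule DirProd_monoid[OF R_ring_monoid Eq.monoid_axioms])

lemma ZE_monoid: "Group.monoid (\<Z> \<times>\<times> E\<^sub>q)"
  by (rule DirProd_monoid[OF Z_monoid Eq.monoid_axioms])

sublocale MRr: ring MR
  by (rule monoid.monoid_ring_ring[OF RE_monoid])

sublocale MZr: ring MZ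
  by (rule monoid.monoid_ring_ring[OF ZE_monoid])

lemma R_conditions: "\<And>b c. b \<in> carrier R_ring \<Longrightarrow> c \<in> carrier R_ring \<Longrightarrow> b \<oplus>\<^bsub>R_ring\<^esub> c \<in> carrier R_ring"
  "\<And>a. a \<in> carrier Zq \<Longrightarrow> Zq_to_R a \<in> carrier R_ring"
  by (simp_all add: R_add R_from_Zq)

lemmas TR_props = tensor_ideal_ideal[where A = Zq and \<phi> = Zq_to_R and B = R_ring and M = E\<^sub>q,
  OF R_ring_monoid Eq.monoid_axioms R_conditions(1) Eq_add_closed Eq_smult_closed R_conditions(2)]

lemmas TZ_props = tensor_ideal_ideal[where A = Zq and \<phi> = Zq_to_Z and B = \<Z> and M = E\<^sub>q,
  OF Z_monoid Eq.monoid_axioms _ Eq_add_closed Eq_smult_closed]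

lemma TZ_ideal: "ideal TZ MZ"
  by (rule TZ_props(1)) auto

lemma TZ_gens:
  "x \<in> carrier E\<^sub>q \<Longrightarrow> frag_of (b + c, x) - frag_of (b, x) - frag_of (c, x) \<in> TZ"
  "x \<in> carrier E\<^sub>q \<Longrightarrow> y \<in> carrier E\<^sub>q \<Longrightarrow> frag_of (b, x \<oplus>\<^bsub>E\<^sub>q\<^esub> y) - frag_of (b, x) - frag_of (b, y) \<in> TZ"
  "x \<in> carrier E\<^sub>q \<Longrightarrow> frag_of (b * poly a 0, x) - frag_of (b, a \<odot>\<^bsub>E\<^sub>q\<^esub> x) \<in> TZ"
  using TZ_props(2)[of b c x] TZ_props(3)[of b x y] TZ_props(4)[of a b x] by (simp_all add: Zq_to_Z_def)

sublocale TZi: ideal TZ MZ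
  by (rule TZ_ideal)

section \<open>From coefficients in R to integer coefficients\<close>

definition scal :: "(int poly fract \<times> _ \<Rightarrow>\<^sub>0 int) \<Rightarrow> (int \<times> _ \<Rightarrow>\<^sub>0 int)" where
  "scal = frag_extend (\<lambda>(b, x). frag_of (R_to_Z b, x))"

lemma scal_hom: "ring_hom_ring MR MZ scal"
proof -
  let ?g = "\<lambda>(b, x). frag_of (R_to_Z b, x)"
  have hom: "ring_hom_ring MR MZ (MZr.ext_mor ?g)"
    by (rule MZr.ext_mor_hom[OF RE_monoid]) (auto simp: R_mult R_one)
  \<comment> \<open>The homomorphism property is known for \<open>ext_mor\<close>; on the carrier
    both linear extensions agree, so it passes to \<open>scal\<close>.\<close>
  have eq: "Poly_Mapping.keys f \<subseteq> carrier (R_ring \<times>\<times> E\<^sub>q) \<and> MZr.ext_mor ?g f = scal f"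
    if "Poly_Mapping.keys f \<subseteq> carrier (R_ring \<times>\<times> E\<^sub>q)" for f
    using that
  proof (induction f rule: frag_induction)
    case zero
    then show ?case by (simp add: scal_def)
  next
    case (one x)
    then show ?case by (cases x) (simp add: scal_def MZr.ext_mor_of)
  next
    case (diff a b)
    have g: "?g x \<in> carrier MZ" if "x \<in> carrier (R_ring \<times>\<times> E\<^sub>q)" for x using that by auto
    have cl: "MZr.ext_mor ?g a \<in> carrier MZ" "MZr.ext_mor ?g b \<in> carrier MZ"
      using MZr.ext_mor_closed[OF conjunct1[OF diff(1)], of ?g] MZr.ext_mor_closed[OF conjunct1[OF diff(2)], of ?g] g
      by blast+
    have "MZr.ext_mor ?g (a - b) = MZr.ext_mor ?g a \<ominus>\<^bsub>MZ\<^esub> MZr.ext_mor ?g b"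
      using diff g by (intro MZr.ext_mor_diff[of _ "carrier (R_ring \<times>\<times> E\<^sub>q)"]) auto
    also have "\<dots> = scal a - scal b"
      using monoid.monoid_ring_minus[OF ZE_monoid cl] diff by simp
    finally show ?case using diff by (simp add: scal_def frag_extend_diff keys_diff_subset)
  qed
  show ?thesis
  proof (rule ring_hom_ringI2[OF MRr.ring_axioms MZr.ring_axioms])
    have h: "MZr.ext_mor ?g \<in> ring_hom MR MZ" using hom by (rule ring_hom_ring.homh)
    show "scal \<in> ring_hom MR MZ"
      by (rule MRr.ring_hom_restrict[OF h]) (use eq in simp)
  qed
qed


lemma scal_of [simp]: "scal (frag_of (r, F)) = frag_of (R_to_Z r, F)"
  by (simp add: scal_def)

lemma scal_diff: "scal (f - g) = scal f - scal g"
  by (simp add: scal_def frag_extend_diff)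

lemma scal_add: "scal (f + g) = scal f + scal g"
  by (simp add: scal_def frag_extend_add)

text \<open>Makes \<open>scalar_map\<close> well defined on cosets. The preimage of
  \<open>TZ\<close> is an ideal, so only generators need checking; the scalar relations match
  because \<open>R_to_Z (Zq_to_R a) = Zq_to_Z a\<close>.\<close>

lemma scal_TR: assumes "f \<in> TR" shows "scal f \<in> TZ"
proof -
  let ?K = "{f \<in> carrier MR. scal f \<in> TZ}"
  have K: "ideal ?K MR" using ring_hom_ring.ideal_vimage[OF scal_hom TZ_ideal] .
  have car: "frag_of (r, x) \<in> carrier MR" if "r \<in> R_carrier" "x \<in> carrier E\<^sub>q" for r x
    using that by simp
  have dif: "f - g \<in> carrier MR" if "f \<in> carrier MR" "g \<in> carrier MR" for f g
    using that keys_diff_subset by (simp del: Poly_Mapping.keys_diff)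
  have "TR \<subseteq> ?K"
  proof (rule TR_props(5))
    show "ideal ?K MR" by (rule K)
  next
    fix b c x assume *: "b \<in> carrier R_ring" "c \<in> carrier R_ring" "x \<in> carrier E\<^sub>q"
    have "scal (frag_of (b \<oplus>\<^bsub>R_ring\<^esub> c, x) - frag_of (b, x) - frag_of (c, x)) \<in> TZ"
      using TZ_gens(1)[OF *(3)] * by (simp add: scal_diff R_add)
    then show "frag_of (b \<oplus>\<^bsub>R_ring\<^esub> c, x) - frag_of (b, x) - frag_of (c, x) \<in> ?K"
      using * by (intro CollectI conjI dif car) (auto simp: R_add)
  next
    fix b x y assume *: "b \<in> carrier R_ring" "x \<in> carrier E\<^sub>q" "y \<in> carrier E\<^sub>q"
    have "scal (frag_of (b, x \<oplus>\<^bsub>E\<^sub>q\<^esub> y) - frag_of (b, x) - frag_of (b, y)) \<in> TZ"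
      using TZ_gens(2)[OF *(2,3)] by (simp add: scal_diff)
    then show "frag_of (b, x \<oplus>\<^bsub>E\<^sub>q\<^esub> y) - frag_of (b, x) - frag_of (b, y) \<in> ?K"
      using * by (intro CollectI conjI dif car) auto
  next
    fix a b x assume *: "a \<in> carrier Zq" "b \<in> carrier R_ring" "x \<in> carrier E\<^sub>q"
    have "scal (frag_of (b \<otimes>\<^bsub>R_ring\<^esub> Zq_to_R a, x) - frag_of (b, a \<odot>\<^bsub>E\<^sub>q\<^esub> x)) \<in> TZ"
      using TZ_gens(3)[OF *(3)] * by (simp add: scal_diff R_mult R_from_Zq Zq_to_Z_def)
    then show "frag_of (b \<otimes>\<^bsub>R_ring\<^esub> Zq_to_R a, x) - frag_of (b, a \<odot>\<^bsub>E\<^sub>q\<^esub> x) \<in> ?K"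
      using * by (intro CollectI conjI dif car) (auto simp: R_mult R_from_Zq Eq_smult_closed)
  qed (auto simp: R_conditions Eq_add_closed Eq_smult_closed)
  then show ?thesis using assms by blast
qed

text \<open>
  The map \<open>F \<mapsto> 1 \<otimes> F\<close> identifies \<open>E\<^sub>0\<close> with \<open>E\<^sub>q / q E\<^sub>q\<close>; the inverse is induced by
  \<open>n \<otimes> F \<mapsto> n F\<close>.
\<close>

definition iota where "iota F = TZ +>\<^bsub>MZ\<^esub> frag_of (1, F)"

lemma E0_eq: "E\<^sub>0 = MZ Quot TZ"
  by (simp add: E\<^sub>0_def base_change_def)

lemma E0_ring: "ring E\<^sub>0"
  unfolding E0_eq by (rule TZi.quotient_is_ring)

lemma MZ_frag [simp]: "F \<in> carrier E\<^sub>q \<Longrightarrow> frag_of (n, F) \<in> carrier MZ"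
  by simp

lemma MZ_minus: "f \<in> carrier MZ \<Longrightarrow> g \<in> carrier MZ \<Longrightarrow> f \<ominus>\<^bsub>MZ\<^esub> g = f - g"
  by (rule monoid.monoid_ring_minus[OF ZE_monoid])

lemma coset_frag_eq:
  assumes "f \<in> carrier MZ" "g \<in> carrier MZ" "f - g \<in> TZ"
  shows "TZ +>\<^bsub>MZ\<^esub> f = TZ +>\<^bsub>MZ\<^esub> g"
  using TZi.coset_eq_iff[OF assms(1,2)] assms MZ_minus by simp

lemma coset_hom: "ring_hom_ring MZ E\<^sub>0 ((+>\<^bsub>MZ\<^esub>) TZ)"
  unfolding E0_eq by (rule TZi.rcos_ring_hom_ring)

lemma tensor_scalar:
  assumes "F \<in> carrier E\<^sub>q" shows "TZ +>\<^bsub>MZ\<^esub> frag_of (poly a 0, F) = iota (a \<odot>\<^bsub>E\<^sub>q\<^esub> F)"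
  unfolding iota_def using TZ_gens(3)[OF assms, of 1 a] assms Eq_smult_closed
  by (intro coset_frag_eq) auto

lemma iota_hom: "ring_hom_ring E\<^sub>q E\<^sub>0 iota"
proof (rule ring_hom_ringI[OF Eq.ring_axioms E0_ring])
  interpret h: ring_hom_ring MZ E\<^sub>0 "(+>\<^bsub>MZ\<^esub>) TZ" by (rule coset_hom)
  fix F F' assume F: "F \<in> carrier E\<^sub>q" "F' \<in> carrier E\<^sub>q"
  show "iota F \<in> carrier E\<^sub>0" unfolding iota_def using F by (intro h.hom_closed MZ_frag)
  have "iota F \<otimes>\<^bsub>E\<^sub>0\<^esub> iota F' = TZ +>\<^bsub>MZ\<^esub> (frag_of (1, F) \<otimes>\<^bsub>MZ\<^esub> frag_of (1, F'))"
    unfolding iota_def using F by (intro h.hom_mult[symmetric] MZ_frag)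
  then show "iota (F \<otimes>\<^bsub>E\<^sub>q\<^esub> F') = iota F \<otimes>\<^bsub>E\<^sub>0\<^esub> iota F'" by (simp add: iota_def)
  have "iota F \<oplus>\<^bsub>E\<^sub>0\<^esub> iota F' = TZ +>\<^bsub>MZ\<^esub> (frag_of (1, F) \<oplus>\<^bsub>MZ\<^esub> frag_of (1, F'))"
    unfolding iota_def using F by (intro h.hom_add[symmetric] MZ_frag)
  also have "\<dots> = iota (F \<oplus>\<^bsub>E\<^sub>q\<^esub> F')" unfolding iota_def
  proof (rule coset_frag_eq[symmetric])
    show "frag_of (1, F) \<oplus>\<^bsub>MZ\<^esub> frag_of (1, F') \<in> carrier MZ"
      using F by (intro MZr.add.m_closed MZ_frag)
    show "frag_of (1, F \<oplus>\<^bsub>E\<^sub>q\<^esub> F') - (frag_of (1, F) \<oplus>\<^bsub>MZ\<^esub> frag_of (1, F')) \<in> TZ"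
      using TZ_gens(2)[OF F, of 1] by (simp add: algebra_simps)
  qed (use F Eq_add_closed in auto)
  finally show "iota (F \<oplus>\<^bsub>E\<^sub>q\<^esub> F') = iota F \<oplus>\<^bsub>E\<^sub>0\<^esub> iota F'" by simp
next
  interpret h: ring_hom_ring MZ E\<^sub>0 "(+>\<^bsub>MZ\<^esub>) TZ" by (rule coset_hom)
  show "iota \<one>\<^bsub>E\<^sub>q\<^esub> = \<one>\<^bsub>E\<^sub>0\<^esub>" using h.hom_one by (simp add: iota_def)
qed

text \<open>n \<otimes> F = 1 \<otimes> n F, where n acts on \<open>E\<^sub>q\<close> as the
  constant polynomial \<open>[:n:]\<close>; sums and differences follow from additivity.\<close>

lemma iota_surj: "iota ` carrier E\<^sub>q = carrier E\<^sub>0"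
proof
  interpret i: ring_hom_ring E\<^sub>q E\<^sub>0 iota by (rule iota_hom)
  interpret h: ring_hom_ring MZ E\<^sub>0 "(+>\<^bsub>MZ\<^esub>) TZ" by (rule coset_hom)
  show "iota ` carrier E\<^sub>q \<subseteq> carrier E\<^sub>0" by auto
  have *: "f \<in> carrier MZ \<and> (\<exists>F \<in> carrier E\<^sub>q. TZ +>\<^bsub>MZ\<^esub> f = iota F)"
    if "Poly_Mapping.keys f \<subseteq> carrier (\<Z> \<times>\<times> E\<^sub>q)" for f
    using that
  proof (induction f rule: frag_induction)
    case zero
    have z: "TZ +>\<^bsub>MZ\<^esub> 0 = iota \<zero>\<^bsub>E\<^sub>q\<^esub>" using h.hom_zero i.hom_zero by simp
    show ?case by (intro conjI bexI[of _ "\<zero>\<^bsub>E\<^sub>q\<^esub>"] z Eq.zero_closed) simp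
  next
    case (one x)
    then obtain n F where x: "x = (n, F)" "F \<in> carrier E\<^sub>q" by auto
    have "TZ +>\<^bsub>MZ\<^esub> frag_of x = iota ([:n:] \<odot>\<^bsub>E\<^sub>q\<^esub> F)" using tensor_scalar[OF x(2), of "[:n:]"] x(1) by simp
    then show ?case using Eq_smult_closed[OF x(2)] MZ_frag[OF x(2)] x(1) by blast
  next
    case (diff a b)
    then obtain F F' where F: "F \<in> carrier E\<^sub>q" "F' \<in> carrier E\<^sub>q"
      "TZ +>\<^bsub>MZ\<^esub> a = iota F" "TZ +>\<^bsub>MZ\<^esub> b = iota F'" by blast
    have ab: "a \<in> carrier MZ" "b \<in> carrier MZ" using diff by auto
    have "TZ +>\<^bsub>MZ\<^esub> (a - b) = TZ +>\<^bsub>MZ\<^esub> (a \<oplus>\<^bsub>MZ\<^esub> \<ominus>\<^bsub>MZ\<^esub> b)"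
      using MZ_minus[OF ab] by (simp add: a_minus_def)
    also have "\<dots> = (TZ +>\<^bsub>MZ\<^esub> a) \<oplus>\<^bsub>E\<^sub>0\<^esub> (TZ +>\<^bsub>MZ\<^esub> (\<ominus>\<^bsub>MZ\<^esub> b))"
      using ab by (intro h.hom_add MZr.a_inv_closed)
    also have "TZ +>\<^bsub>MZ\<^esub> (\<ominus>\<^bsub>MZ\<^esub> b) = \<ominus>\<^bsub>E\<^sub>0\<^esub> (TZ +>\<^bsub>MZ\<^esub> b)" using ab by (intro h.hom_a_inv)
    also have "(TZ +>\<^bsub>MZ\<^esub> a) \<oplus>\<^bsub>E\<^sub>0\<^esub> \<ominus>\<^bsub>E\<^sub>0\<^esub> (TZ +>\<^bsub>MZ\<^esub> b) = iota (F \<ominus>\<^bsub>E\<^sub>q\<^esub> F')"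
      unfolding F(3,4) a_minus_def using F by simp
    finally have "TZ +>\<^bsub>MZ\<^esub> (a - b) = iota (F \<ominus>\<^bsub>E\<^sub>q\<^esub> F')" .
    moreover have "a - b \<in> carrier MZ" using ab keys_diff_subset by simp
    ultimately show ?case using Eq.minus_closed[OF F(1,2)] by blast
  qed
  show "carrier E\<^sub>0 \<subseteq> iota ` carrier E\<^sub>q"
  proof
    fix X assume "X \<in> carrier E\<^sub>0"
    then obtain f where f: "f \<in> carrier MZ" "X = TZ +>\<^bsub>MZ\<^esub> f"
      unfolding E0_eq FactRing_def A_RCOSETS_def' by auto
    then show "X \<in> iota ` carrier E\<^sub>q" using *[of f] by auto
  qed
qed

section \<open>The ideal generated by q and the kernel of reduction\<close>

definition qE where "qE = {[:0, 1:] \<odot>\<^bsub>E\<^sub>q\<^esub> F | F. F \<in> carrier E\<^sub>q}"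

lemma Eq_smult_smult: "F \<in> carrier E\<^sub>q \<Longrightarrow> a \<odot>\<^bsub>E\<^sub>q\<^esub> (b \<odot>\<^bsub>E\<^sub>q\<^esub> F) = (a * b) \<odot>\<^bsub>E\<^sub>q\<^esub> F"
  by (rule Eq_ext) (auto simp: Eq_smult_apply Eq_smult_closed smult_smult)

lemma Eq_smult_add: "F \<in> carrier E\<^sub>q \<Longrightarrow> F' \<in> carrier E\<^sub>q \<Longrightarrow>
    a \<odot>\<^bsub>E\<^sub>q\<^esub> (F \<oplus>\<^bsub>E\<^sub>q\<^esub> F') = a \<odot>\<^bsub>E\<^sub>q\<^esub> F \<oplus>\<^bsub>E\<^sub>q\<^esub> a \<odot>\<^bsub>E\<^sub>q\<^esub> F'"
  by (rule Eq_ext) (auto simp: Eq_smult_apply Eq_smult_closed Eq_add_apply Eq_add_closed smult_add)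

lemma Eq_add_smult: "F \<in> carrier E\<^sub>q \<Longrightarrow>
    (a + b) \<odot>\<^bsub>E\<^sub>q\<^esub> F = a \<odot>\<^bsub>E\<^sub>q\<^esub> F \<oplus>\<^bsub>E\<^sub>q\<^esub> b \<odot>\<^bsub>E\<^sub>q\<^esub> F"
  by (rule Eq_ext) (auto simp: Eq_smult_apply Eq_smult_closed Eq_add_apply Eq_add_closed add_smult)

lemma Eq_one_smult: "F \<in> carrier E\<^sub>q \<Longrightarrow> 1 \<odot>\<^bsub>E\<^sub>q\<^esub> F = F"
  by (rule Eq_ext) (auto simp: Eq_smult_apply Eq_smult_closed)

lemma Eq_smult_mult:
  assumes "F \<in> carrier E\<^sub>q" "F' \<in> carrier E\<^sub>q"
  shows "(a \<odot>\<^bsub>E\<^sub>q\<^esub> F) \<otimes>\<^bsub>E\<^sub>q\<^esub> F' = a \<odot>\<^bsub>E\<^sub>q\<^esub> (F \<otimes>\<^bsub>E\<^sub>q\<^esub> F')"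
    and "F \<otimes>\<^bsub>E\<^sub>q\<^esub> (a \<odot>\<^bsub>E\<^sub>q\<^esub> F') = a \<odot>\<^bsub>E\<^sub>q\<^esub> (F \<otimes>\<^bsub>E\<^sub>q\<^esub> F')"
proof -
  show "(a \<odot>\<^bsub>E\<^sub>q\<^esub> F) \<otimes>\<^bsub>E\<^sub>q\<^esub> F' = a \<odot>\<^bsub>E\<^sub>q\<^esub> (F \<otimes>\<^bsub>E\<^sub>q\<^esub> F')"
    by (rule Eq_ext) (use assms in \<open>auto simp: Eq_smult_apply Eq_smult_closed Eq_mult_apply\<close>)
  show "F \<otimes>\<^bsub>E\<^sub>q\<^esub> (a \<odot>\<^bsub>E\<^sub>q\<^esub> F') = a \<odot>\<^bsub>E\<^sub>q\<^esub> (F \<otimes>\<^bsub>E\<^sub>q\<^esub> F')"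
  proof (rule Eq_ext)
    fix v I assume v: "v \<in> xH_sum" and I: "I \<in> \<Lambda>"
    have u: "F' v \<in> xH_sum" using assms v by simp
    have sv: "(a \<odot>\<^bsub>E\<^sub>q\<^esub> F') v = vsmult a (F' v)"
      by (rule V_ext[OF Eq_closed[OF Eq_smult_closed[OF assms(2)] v] vsmult_closed[OF u]])
        (simp add: Eq_smult_apply v vsmult_def)
    have "F ((a \<odot>\<^bsub>E\<^sub>q\<^esub> F') v) I = a \<odot>\<^bsub>H\<^esub> F (F' v) I"
      unfolding sv Eq_smult[OF assms(1) u] using I by (simp add: vsmult_def)
    then show "(F \<otimes>\<^bsub>E\<^sub>q\<^esub> (a \<odot>\<^bsub>E\<^sub>q\<^esub> F')) v I = (a \<odot>\<^bsub>E\<^sub>q\<^esub> (F \<otimes>\<^bsub>E\<^sub>q\<^esub> F')) v I"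
      using v I by (simp add: Eq_mult_apply Eq_smult_apply)
  qed (use assms Eq_smult_closed in auto)
qed

lemma qE_I: "F \<in> carrier E\<^sub>q \<Longrightarrow> poly a 0 = 0 \<Longrightarrow> a \<odot>\<^bsub>E\<^sub>q\<^esub> F \<in> qE"
proof -
  assume F: "F \<in> carrier E\<^sub>q" and "poly a 0 = 0"
  then have "[:0, 1:] dvd a" using poly_eq_0_iff_dvd[of a 0] by simp
  then obtain b where "a = [:0, 1:] * b" by (rule dvdE)
  then have "a \<odot>\<^bsub>E\<^sub>q\<^esub> F = [:0, 1:] \<odot>\<^bsub>E\<^sub>q\<^esub> (b \<odot>\<^bsub>E\<^sub>q\<^esub> F)" using Eq_smult_smult[OF F] by simp
  then show ?thesis unfolding qE_def using Eq_smult_closed[OF F] by blast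
qed

lemma qE_ideal: "ideal qE E\<^sub>q"
proof (rule idealI[OF Eq.ring_axioms])
  have sub: "qE \<subseteq> carrier E\<^sub>q" unfolding qE_def using Eq_smult_closed by auto
  show "subgroup qE (add_monoid E\<^sub>q)"
  proof (rule Eq.add.subgroupI)
    show "qE \<subseteq> carrier E\<^sub>q" by (rule sub)
    show "qE \<noteq> {}" unfolding qE_def using Eq_zero_closed by blast
    fix x assume "x \<in> qE"
    then obtain F where F: "F \<in> carrier E\<^sub>q" "x = [:0, 1:] \<odot>\<^bsub>E\<^sub>q\<^esub> F" unfolding qE_def by auto
    have "\<ominus>\<^bsub>E\<^sub>q\<^esub> x = ((-1) * [:0, 1:]) \<odot>\<^bsub>E\<^sub>q\<^esub> F"
      using Eq_neg_eq[of x] Eq_smult_smult[OF F(1), of "-1"] Eq_smult_closed[OF F(1)] F(2) by simp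
    then show "\<ominus>\<^bsub>E\<^sub>q\<^esub> x \<in> qE" using qE_I[OF F(1)] by simp
    fix y assume "y \<in> qE"
    then obtain F' where F': "F' \<in> carrier E\<^sub>q" "y = [:0, 1:] \<odot>\<^bsub>E\<^sub>q\<^esub> F'" unfolding qE_def by auto
    show "x \<oplus>\<^bsub>E\<^sub>q\<^esub> y \<in> qE"
      unfolding F(2) F'(2) Eq_smult_add[OF F(1) F'(1), symmetric]
      using Eq_add_closed[OF F(1) F'(1)] unfolding qE_def by blast
  qed
  fix x y assume "x \<in> qE" and y: "y \<in> carrier E\<^sub>q"
  then obtain F where F: "F \<in> carrier E\<^sub>q" "x = [:0, 1:] \<odot>\<^bsub>E\<^sub>q\<^esub> F" unfolding qE_def by auto
  show "y \<otimes>\<^bsub>E\<^sub>q\<^esub> x \<in> qE" unfolding F(2) Eq_smult_mult(2)[OF y F(1)]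
    using Eq_mult_closed[OF y F(1)] unfolding qE_def by blast
  show "x \<otimes>\<^bsub>E\<^sub>q\<^esub> y \<in> qE" unfolding F(2) Eq_smult_mult(1)[OF F(1) y]
    using Eq_mult_closed[OF F(1) y] unfolding qE_def by blast
qed

text \<open>If 1 \<otimes> F = 0, all that is known is that a formal pair lies in the ideal
  \<open>TZ\<close>. Under n \<otimes> F \<mapsto> n F the preimage of \<open>qE\<close> is an ideal
  containing the generators of \<open>TZ\<close>, so this map sends the pair (1, F), whose image is
  F, into \<open>qE\<close>.\<close>

lemma iota_kernel: assumes F: "F \<in> carrier E\<^sub>q" shows "iota F = \<zero>\<^bsub>E\<^sub>0\<^esub> \<longleftrightarrow> F \<in> qE"
proof
  interpret i: ring_hom_ring E\<^sub>q E\<^sub>0 iota by (rule iota_hom)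
  interpret h: ring_hom_ring MZ E\<^sub>0 "(+>\<^bsub>MZ\<^esub>) TZ" by (rule coset_hom)
  {
    assume "F \<in> qE"
    then obtain F' where F': "F' \<in> carrier E\<^sub>q" "F = [:0, 1:] \<odot>\<^bsub>E\<^sub>q\<^esub> F'" unfolding qE_def by auto
    have "0 \<odot>\<^bsub>E\<^sub>q\<^esub> F' = \<zero>\<^bsub>E\<^sub>q\<^esub>"
      by (rule Eq_ext) (use F' in \<open>auto simp: Eq_smult_apply Eq_smult_closed Eq_zero_apply\<close>)
    then have "iota F = iota \<zero>\<^bsub>E\<^sub>q\<^esub>"
      using tensor_scalar[OF F'(1), of "[:0, 1:]"] tensor_scalar[OF F'(1), of 0] F'(2) by simp
    then show "iota F = \<zero>\<^bsub>E\<^sub>0\<^esub>" by simp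
  }
  assume "iota F = \<zero>\<^bsub>E\<^sub>0\<^esub>"
  then have "TZ +>\<^bsub>MZ\<^esub> frag_of (1, F) = TZ" unfolding iota_def E0_eq FactRing_def by simp
  then have FT: "frag_of (1, F) \<in> TZ" using TZi.rcos_const_imp_mem[OF MZ_frag[OF F]] by simp
  let ?g = "\<lambda>(n, F). [:n:] \<odot>\<^bsub>E\<^sub>q\<^esub> F"
  have gc: "?g x \<in> carrier E\<^sub>q" if "x \<in> carrier (\<Z> \<times>\<times> E\<^sub>q)" for x
    using that Eq_smult_closed by auto
  have hom: "ring_hom_ring MZ E\<^sub>q (Eq.ext_mor ?g)"
    by (rule Eq.ext_mor_hom[OF ZE_monoid gc])
      (auto simp: Eq_smult_mult Eq_smult_smult Eq_smult_closed Eq_mult_closed Eq_one_smult one_pCons[symmetric])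
  let ?K = "{f \<in> carrier MZ. Eq.ext_mor ?g f \<in> qE}"
  have K: "ideal ?K MZ" using ring_hom_ring.ideal_vimage[OF hom qE_ideal] .
  have of: "Eq.ext_mor ?g (frag_of (n, x)) = [:n:] \<odot>\<^bsub>E\<^sub>q\<^esub> x" if "x \<in> carrier E\<^sub>q" for n x
    using that Eq_smult_closed[OF that] by (simp add: Eq.ext_mor_of)
  have dif: "f - g \<in> carrier MZ \<and> Eq.ext_mor ?g (f - g) = Eq.ext_mor ?g f \<ominus>\<^bsub>E\<^sub>q\<^esub> Eq.ext_mor ?g g"
    if "f \<in> carrier MZ" "g \<in> carrier MZ" for f g
    using that keys_diff_subset Eq.ext_mor_diff[of f "carrier (\<Z> \<times>\<times> E\<^sub>q)" g ?g] gc by simp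
  have neg: "\<ominus>\<^bsub>E\<^sub>q\<^esub> (a \<odot>\<^bsub>E\<^sub>q\<^esub> x) = (- a) \<odot>\<^bsub>E\<^sub>q\<^esub> x" if "x \<in> carrier E\<^sub>q" for a x
    using Eq_neg_eq[OF Eq_smult_closed[OF that]] Eq_smult_smult[OF that] by simp
  have z: "\<zero>\<^bsub>E\<^sub>q\<^esub> \<in> qE" using qE_ideal by (intro additive_subgroup.zero_closed ideal.axioms(1))
  have "TZ \<subseteq> ?K"
  proof (rule TZ_props(5))
    show "ideal ?K MZ" by (rule K)
  next
    fix b c :: int and x assume x: "x \<in> carrier E\<^sub>q"
    have "Eq.ext_mor ?g (frag_of (b + c, x) - frag_of (b, x) - frag_of (c, x)) =
        ([:b + c:] - [:b:] - [:c:]) \<odot>\<^bsub>E\<^sub>q\<^esub> x"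
      using dif x by (simp only: MZ_frag of a_minus_def neg Eq_add_smult[symmetric] diff_conv_add_uminus conjunct1[OF dif] conjunct2[OF dif])
    then show "frag_of (b \<oplus>\<^bsub>\<Z>\<^esub> c, x) - frag_of (b, x) - frag_of (c, x) \<in> ?K"
      using qE_I[OF x, of "[:b + c:] - [:b:] - [:c:]"] dif MZ_frag[OF x] by simp
  next
    fix b :: int and x y assume xy: "x \<in> carrier E\<^sub>q" "y \<in> carrier E\<^sub>q"
    have "Eq.ext_mor ?g (frag_of (b, x \<oplus>\<^bsub>E\<^sub>q\<^esub> y) - frag_of (b, x) - frag_of (b, y)) = \<zero>\<^bsub>E\<^sub>q\<^esub>"
    proof -
      have ab: "a \<oplus>\<^bsub>E\<^sub>q\<^esub> b \<ominus>\<^bsub>E\<^sub>q\<^esub> a \<ominus>\<^bsub>E\<^sub>q\<^esub> b = \<zero>\<^bsub>E\<^sub>q\<^esub>" if "a \<in> carrier E\<^sub>q" "b \<in> carrier E\<^sub>q" for a b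
        unfolding a_minus_def Eq.a_comm[OF that] using that by (simp add: Eq.a_assoc Eq.r_neg)
      have m: "frag_of (b, x) \<in> carrier MZ" "frag_of (b, y) \<in> carrier MZ"
        "frag_of (b, x \<oplus>\<^bsub>E\<^sub>q\<^esub> y) \<in> carrier MZ"
        using xy Eq_add_closed by (intro MZ_frag; simp)+
      show ?thesis
        unfolding conjunct2[OF dif[OF conjunct1[OF dif[OF m(3,1)]] m(2)]] conjunct2[OF dif[OF m(3,1)]]
          of[OF xy(1)] of[OF xy(2)] of[OF Eq_add_closed[OF xy]] Eq_smult_add[OF xy]
        by (rule ab[OF Eq_smult_closed[OF xy(1)] Eq_smult_closed[OF xy(2)]])
    qed
    then show "frag_of (b, x \<oplus>\<^bsub>E\<^sub>q\<^esub> y) - frag_of (b, x) - frag_of (b, y) \<in> ?K"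
      using z dif MZ_frag xy Eq_add_closed by (simp del: monoid_ring_simps)
  next
    fix a and b :: int and x assume x: "x \<in> carrier E\<^sub>q"
    have m: "frag_of (b * poly a 0, x) \<in> carrier MZ" "frag_of (b, a \<odot>\<^bsub>E\<^sub>q\<^esub> x) \<in> carrier MZ"
      by (rule MZ_frag[OF x]) (rule MZ_frag[OF Eq_smult_closed[OF x]])
    have "Eq.ext_mor ?g (frag_of (b * poly a 0, x) - frag_of (b, a \<odot>\<^bsub>E\<^sub>q\<^esub> x)) =
        ([:b * poly a 0:] - [:b:] * a) \<odot>\<^bsub>E\<^sub>q\<^esub> x"
      unfolding conjunct2[OF dif[OF m]] of[OF x] of[OF Eq_smult_closed[OF x]] a_minus_def
        Eq_smult_smult[OF x] neg[OF x] Eq_add_smult[OF x, symmetric] by simp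
    \<comment> \<open>The two constant terms agree, so the scalar is divisible by q.\<close>
    moreover have "([:b * poly a 0:] - [:b:] * a) \<odot>\<^bsub>E\<^sub>q\<^esub> x \<in> qE" using x by (rule qE_I) simp
    ultimately show "frag_of (b \<otimes>\<^bsub>\<Z>\<^esub> Zq_to_Z a, x) - frag_of (b, a \<odot>\<^bsub>E\<^sub>q\<^esub> x) \<in> ?K"
      using conjunct1[OF dif[OF m]] by (simp add: Zq_to_Z_def)
  qed (auto simp: Eq_add_closed Eq_smult_closed)
  then have "Eq.ext_mor ?g (frag_of (1, F)) \<in> qE" using FT by blast
  then show "F \<in> qE" using of[OF F, of 1] Eq_one_smult[OF F] by (simp add: one_pCons[symmetric])
qed

text \<open>The condition on r covers r = 1 and, since Poincare polynomials have constant term 1,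
  also r = \<pi>(I)/\<pi>(J). So this factor is invisible in \<open>E\<^sub>0\<close>.\<close>

lemma RE_to_E0_tensor:
  assumes r: "r \<in> R_carrier" and F: "F \<in> carrier E\<^sub>q" and n: "R_to_Z r = 1"
  shows "RE\<^sub>q_to_E\<^sub>0 (tensor Zq Zq_to_R R_ring E\<^sub>q r F) = iota F"
proof -
  interpret TRi: ideal TR MR by (rule TR_props(1)) assumption+
  have sc: "scal f \<in> carrier MZ" if "f \<in> carrier MR" for f
    using ring_hom_closed[OF ring_hom_ring.homh[OF scal_hom] that] .
  have "TZ +>\<^bsub>MZ\<^esub> scal f = iota F" if f: "f \<in> TR +>\<^bsub>MR\<^esub> frag_of (r, F)" for f
  proof -
    obtain i where i: "i \<in> TR" "f = i + frag_of (r, F)"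
      using f unfolding a_r_coset_def' by auto
    have ic: "i \<in> carrier MR" using TRi.Icarr[OF i(1)] .
    have "scal f - frag_of (1, F) = scal i" unfolding i(2) scal_add by (simp add: n)
    then have "scal f - frag_of (1, F) \<in> TZ" using scal_TR[OF i(1)] by simp
    moreover have "scal f \<in> carrier MZ"
      using ic r F unfolding i(2) by (intro sc) (simp add: keys_add_subset)
    ultimately show ?thesis unfolding iota_def using MZ_frag[OF F] by (intro coset_frag_eq)
  qed
  \<comment> \<open>\<open>scalar_map\<close> is a union of equal terms over the coset; nonemptiness
    makes the union equal to the common term.\<close>
  moreover have "TR +>\<^bsub>MR\<^esub> frag_of (r, F) \<noteq> {}"
    using TRi.zero_closed unfolding a_r_coset_def' by blast
  ultimately show ?thesis
    unfolding RE\<^sub>q_to_E\<^sub>0_def scalar_map_def tensor_def scal_def[symmetric] by auto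
qed

end


subsection \<open>Consequences of the relations\<close>

lemma word_monoid: "Group.monoid \<lparr>carrier = lists X, monoid.mult = (@), one = []\<rparr>"
  by (rule monoidI) auto

lemma free_algebra_ring: "ring (free_algebra X)"
  unfolding free_algebra_def by (rule monoid.monoid_ring_ring[OF word_monoid])

lemma free_algebra_simps [simp]:
  "carrier (free_algebra X) = {f. Poly_Mapping.keys f \<subseteq> lists X}"
  "f \<otimes>\<^bsub>free_algebra X\<^esub> g = frag_extend (\<lambda>x. frag_extend (\<lambda>y. frag_of (x @ y)) g) f"
  "\<one>\<^bsub>free_algebra X\<^esub> = frag_of []"
  "\<zero>\<^bsub>free_algebra X\<^esub> = 0"
  "f \<oplus>\<^bsub>free_algebra X\<^esub> g = f + g"
  by (simp_all add: free_algebra_def)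

lemma free_algebra_minus:
  "f \<in> carrier (free_algebra X) \<Longrightarrow> g \<in> carrier (free_algebra X) \<Longrightarrow> f \<ominus>\<^bsub>free_algebra X\<^esub> g = f - g"
  unfolding free_algebra_def by (rule monoid.monoid_ring_minus[OF word_monoid])

lemma free_algebra_ideal_diff:
  assumes "ideal K (free_algebra X)" "f \<in> K" "g \<in> K" shows "f - g \<in> K"
proof -
  interpret ideal K "free_algebra X" by fact
  note sub = ideal.axioms(1)[OF assms(1)]
  have "f \<ominus>\<^bsub>free_algebra X\<^esub> g \<in> K" unfolding a_minus_def
    using additive_subgroup.a_closed[OF sub assms(2) additive_subgroup.a_inv_closed[OF sub assms(3)]] .
  then show ?thesis using free_algebra_minus[OF Icarr Icarr] assms(2,3) by simp
qed

lemma free_algebra_ideal_add: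
  assumes "ideal K (free_algebra X)" "f \<in> K" "g \<in> K" shows "f + g \<in> K"
  using additive_subgroup.a_closed[OF ideal.axioms(1)[OF assms(1)] assms(2,3)] by simp

context coxeter_system
begin

section \<open>Finitary sets and their covers\<close>

lemma \<Lambda>_mono: "J \<in> \<Lambda> \<Longrightarrow> I \<subseteq> J \<Longrightarrow> I \<in> \<Lambda>"
  using W_mono[of I J] by (auto simp: \<Lambda>_def intro: finite_subset)

lemma \<Lambda>_finite: "I \<in> \<Lambda> \<Longrightarrow> finite I"
  using W_gen finite_subset[of I "W I"] by (auto simp: \<Lambda>_def)

lemma \<Lambda>_empty: "{} \<in> \<Lambda>"
  by (simp add: \<Lambda>_def)

lemma cov_D:
  assumes "I \<lessdot> J" shows "I \<in> \<Lambda>" "J \<in> \<Lambda>" "I \<subseteq> J" "card J = Suc (card I)" "I \<noteq> J"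
  using assms unfolding cov_def by auto

lemma cov_I: "J \<in> \<Lambda> \<Longrightarrow> I \<subseteq> J \<Longrightarrow> card J = Suc (card I) \<Longrightarrow> I \<lessdot> J"
  unfolding cov_def using \<Lambda>_mono by auto

lemma cov_remove: "J \<in> \<Lambda> \<Longrightarrow> a \<in> J \<Longrightarrow> J - {a} \<lessdot> J"
  using \<Lambda>_finite[of J] card_Suc_Diff1[of J a] by (intro cov_I) auto

text \<open>By counting, J \<union> J' has as many elements as I, so inclusion and exclusion gives
  the size of J \<inter> J'. This closes the diamond below I when two orderings are
  compared.\<close>

lemma cov_inter:
  assumes "J \<lessdot> I" "J' \<lessdot> I" "J \<noteq> J'" shows "J \<inter> J' \<lessdot> J" "J \<inter> J' \<lessdot> J'"
proof -
  have fin: "finite I" "finite J" "finite J'" using cov_D[OF assms(1)] cov_D[OF assms(2)] \<Lambda>_finite by auto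
  have c: "card J = card J'" "card I = Suc (card J)" using cov_D(4)[OF assms(1)] cov_D(4)[OF assms(2)] by auto
  have "\<not> J' \<subseteq> J" using card_subset_eq[of J J'] fin c assms(3) by auto
  then have "card J < card (J \<union> J')" using fin by (intro psubset_card_mono) auto
  moreover have "card (J \<union> J') \<le> card I"
    using fin cov_D(3)[OF assms(1)] cov_D(3)[OF assms(2)] by (intro card_mono) auto
  ultimately have "card (J \<union> J') = Suc (card J)" using c by simp
  then have "card J = Suc (card (J \<inter> J'))" using card_Un_Int[OF fin(2,3)] c by simp
  then show "J \<inter> J' \<lessdot> J" "J \<inter> J' \<lessdot> J'"
    using cov_D(2) cov_D(1)[OF assms(1)] cov_D(1)[OF assms(2)] c by (auto intro!: cov_I)
qed

section \<open>The ideal of relations\<close>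

definition relI :: "('w gen list \<Rightarrow>\<^sub>0 int) set" where
  "relI = Idl\<^bsub>free_algebra gens\<^esub> {a - b | a b. (a, b) \<in> rels}"

lemma gens_I [simp]:
  "I \<lessdot> J \<Longrightarrow> Up I J \<in> gens" "I \<lessdot> J \<Longrightarrow> Down J I \<in> gens" "K \<in> \<Lambda> \<Longrightarrow> One K \<in> gens"
  unfolding gens_def by auto

lemma gens_E:
  assumes "g \<in> gens"
  obtains I J where "g = Up I J" "I \<lessdot> J" | I J where "g = Down J I" "I \<lessdot> J" | K where "g = One K" "K \<in> \<Lambda>"
  using assms unfolding gens_def by auto

lemma empty_cov_singleton: "s \<in> S \<Longrightarrow> {} \<lessdot> {s}"
  using longest_singleton(1) by (intro cov_I) auto

lemma p_word_gens: "ws \<in> lists S \<Longrightarrow> p_word ws \<in> lists gens"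
  unfolding p_word_def by (induction ws) (auto simp: empty_cov_singleton)

lemma p_word_append [simp]: "p_word (us @ vs) = p_word us @ p_word vs"
  by (simp add: p_word_def)

lemma p_word_Nil [simp]: "p_word [] = []"
  by (simp add: p_word_def)

lemma p_word_Cons [simp]: "p_word (s # ws) = [Up {} {s}, Down {s} {}] @ p_word ws"
  by (simp add: p_word_def)


subsubsection \<open>Orderings\<close>

lemma ordering_empty: "ordering {} [{}]"
  by (simp add: ordering_def)

lemma ordering_snoc: assumes "ordering I Is" "I \<lessdot> J" shows "ordering J (Is @ [J])"
proof -
  have "(Is @ [J]) ! i \<lessdot> (Is @ [J]) ! Suc i" if i: "Suc i < length (Is @ [J])" for i
  proof (cases "Suc i < length Is")
    case True
    then show ?thesis using assms(1) by (simp add: ordering_def nth_append)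
  next
    case False
    then have "i = length Is - 1" "Suc i = length Is" using i by auto
    moreover have "Is ! (length Is - 1) = I" using assms(1) by (auto simp: ordering_def last_conv_nth)
    ultimately show ?thesis using assms(2) by (simp add: nth_append)
  qed
  then show ?thesis using assms(1) by (auto simp: ordering_def)
qed

lemma ordering_cases:
  assumes "ordering J Js"
  obtains "J = {}" "Js = [{}]" | I Is where "Js = Is @ [J]" "ordering I Is" "I \<lessdot> J"
proof (cases Js rule: rev_cases)
  case Nil
  then show thesis using assms by (simp add: ordering_def)
next
  case (snoc Is x)
  have x: "x = J" using assms snoc by (simp add: ordering_def)
  show thesis
  proof (cases "Is = []")
    case True
    then show thesis using assms snoc x that(1) by (simp add: ordering_def)
  next
    case False
    have c: "Js ! i \<lessdot> Js ! Suc i" if "Suc i < length Js" for i using assms that by (simp add: ordering_def)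
    have "Is ! i \<lessdot> Is ! Suc i" if "Suc i < length Is" for i
      using c[of i] that snoc by (simp add: nth_append)
    moreover have "hd Is = {}" using assms snoc False by (simp add: ordering_def)
    ultimately have o: "ordering (last Is) Is" using False by (simp add: ordering_def)
    have "last Is \<lessdot> J"
      using c[of "length Is - 1"] snoc False x by (simp add: nth_append last_conv_nth)
    then show thesis using that(2)[of Is "last Is"] snoc x o by simp
  qed
qed

lemma ordering_in_\<Lambda>: assumes "ordering J Js" shows "J \<in> \<Lambda>"
  using assms by (cases rule: ordering_cases) (auto simp: \<Lambda>_empty cov_D)

lemma ordering_nonempty: "ordering J Js \<Longrightarrow> Js \<noteq> []" "ordering J Js \<Longrightarrow> last Js = J"
  by (simp_all add: ordering_def)

lemma ordering_induct [consumes 1, case_names empty snoc]: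
  assumes "ordering J Js" "P {} [{}]"
    "\<And>I Is J. ordering I Is \<Longrightarrow> I \<lessdot> J \<Longrightarrow> P I Is \<Longrightarrow> P J (Is @ [J])"
  shows "P J Js"
  using assms(1)
proof (induction "length Js" arbitrary: J Js rule: less_induct)
  case less
  from less.prems show ?case
  proof (cases rule: ordering_cases)
    case 1
    then show ?thesis using assms(2) by simp
  next
    case (2 I Is)
    then show ?thesis using assms(3)[OF 2(2,3)] less.hyps[OF _ 2(2)] by simp
  qed
qed

lemma up_word_snoc: "Is \<noteq> [] \<Longrightarrow> up_word (Is @ [J]) = up_word Is @ [Up (last Is) J]"
  by (cases Is rule: rev_cases) (auto simp: up_word_def nth_append)

lemma down_word_snoc: "Is \<noteq> [] \<Longrightarrow> down_word (Is @ [J]) = Down J (last Is) # down_word Is"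
  by (cases Is rule: rev_cases) (auto simp: down_word_def nth_append)

lemma words_single [simp]: "up_word [I] = []" "down_word [I] = []"
  by (simp_all add: up_word_def down_word_def)

lemma ordering_words: "ordering I Is \<Longrightarrow> up_word Is \<in> lists gens \<and> down_word Is \<in> lists gens"
proof (induction rule: ordering_induct)
  case (snoc I Is J)
  then show ?case using ordering_nonempty[OF snoc(1)] by (simp add: up_word_snoc down_word_snoc)
qed simp

lemma ordering_exists: "I \<in> \<Lambda> \<Longrightarrow> \<exists>Is. ordering I Is"
proof (induction "card I" arbitrary: I)
  case 0
  then have "I = {}" using \<Lambda>_finite by auto
  then show ?case using ordering_empty by blast
next
  case (Suc n)
  then obtain a where a: "a \<in> I" by fastforce
  have cv: "I - {a} \<lessdot> I" using cov_remove Suc.prems a .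
  have "n = card (I - {a})" using cov_D(4)[OF cv] Suc.hyps(2) by simp
  then obtain Is where "ordering (I - {a}) Is" using Suc.hyps(1) cov_D(1)[OF cv] by blast
  then show ?case using ordering_snoc[OF _ cv] by blast
qed

lemma rels_carrier:
  assumes "(a, b) \<in> rels" shows "a \<in> carrier (free_algebra gens)" "b \<in> carrier (free_algebra gens)"
proof -
  have e: "Poly_Mapping.keys (\<Sum>I\<in>\<Lambda>. frag_of [One I]) \<subseteq> lists gens"
    using keys_sum[of "\<lambda>I. frag_of [One I]" \<Lambda>] by fastforce
  have o: "up_word Is @ down_word Is \<in> lists gens" if "ordering I Is" for I Is
    using ordering_words[OF that] by simp
  have p: "p_word ws \<in> lists gens" if "associated_expr I Is ws" for I Is ws
    using that by (intro p_word_gens) (simp add: associated_expr_def reduced_def)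
  have g: "frag_of ws \<in> carrier (free_algebra gens)" if "ws \<in> lists gens" for ws
    using that by simp
  have "a \<in> carrier (free_algebra gens) \<and> b \<in> carrier (free_algebra gens)"
    using assms unfolding rels_def
    by (elim UnE; (clarsimp simp del: free_algebra_simps)?;
      (intro conjI g)?; (auto simp: e cov_D intro!: o p simp del: append_in_lists_conv)?)
  then show "a \<in> carrier (free_algebra gens)" "b \<in> carrier (free_algebra gens)" by auto
qed


lemma rel_differences_carrier:
  "{a - b | a b. (a, b) \<in> rels} \<subseteq> carrier (free_algebra gens)"
proof
  fix x assume "x \<in> {a - b | a b. (a, b) \<in> rels}"
  then obtain a b where "(a, b) \<in> rels" "x = a - b" by blast
  then show "x \<in> carrier (free_algebra gens)" using rels_carrier[of a b] keys_diff_subset by simp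
qed

lemma relI_ideal: "ideal relI (free_algebra gens)"
proof -
  interpret FA: ring "free_algebra gens" by (rule free_algebra_ring)
  show ?thesis unfolding relI_def by (rule FA.genideal_ideal[OF rel_differences_carrier])
qed

lemma relI_rel: assumes "(a, b) \<in> rels" shows "a - b \<in> relI"
proof -
  interpret FA: ring "free_algebra gens" by (rule free_algebra_ring)
  have "{a - b | a b. (a, b) \<in> rels} \<subseteq> relI"
    unfolding relI_def by (rule FA.genideal_self[OF rel_differences_carrier])
  then show ?thesis using assms by blast
qed

lemma relI_minimal:
  assumes "ideal K (free_algebra gens)" "\<And>a b. (a, b) \<in> rels \<Longrightarrow> a - b \<in> K" shows "relI \<subseteq> K"
proof -
  interpret FA: ring "free_algebra gens" by (rule free_algebra_ring)
  show ?thesis unfolding relI_def using assms by (intro FA.genideal_minimal) auto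
qed

lemma relI_zero: "0 \<in> relI"
  using additive_subgroup.zero_closed[OF ideal.axioms(1)[OF relI_ideal]] by simp

lemmas relI_diff = free_algebra_ideal_diff[OF relI_ideal]
lemmas relI_add = free_algebra_ideal_add[OF relI_ideal]

lemma relI_mult:
  assumes "f \<in> relI" "xs \<in> lists gens" "ys \<in> lists gens"
  shows "frag_extend (\<lambda>w. frag_of (xs @ w @ ys)) f \<in> relI"
proof -
  interpret relI: ideal relI "free_algebra gens" by (rule relI_ideal)
  have "frag_of xs \<otimes>\<^bsub>free_algebra gens\<^esub> f \<otimes>\<^bsub>free_algebra gens\<^esub> frag_of ys \<in> relI"
    using assms by (intro relI.I_l_closed relI.I_r_closed) simp_all
  then show ?thesis by (simp add: frag_extend_frag_extend)
qed


subsubsection \<open>Congruence of words\<close>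

definition weq :: "'w gen list \<Rightarrow> 'w gen list \<Rightarrow> bool" (infix \<open>\<approx>\<close> 50) where
  "us \<approx> vs \<longleftrightarrow> frag_of us - frag_of vs \<in> relI"

text \<open>Separate from \<open>weq\<close>, because 0 is not a word.\<close>

definition wzero :: "'w gen list \<Rightarrow> bool" where
  "wzero us \<longleftrightarrow> frag_of us \<in> relI"

lemma weq_refl: "us \<approx> us"
  by (simp add: weq_def relI_zero)

lemma weq_sym: "us \<approx> vs \<Longrightarrow> vs \<approx> us"
  using relI_diff[OF relI_zero, of "frag_of us - frag_of vs"] by (simp add: weq_def)

lemma weq_trans [trans]: "us \<approx> vs \<Longrightarrow> vs \<approx> ws \<Longrightarrow> us \<approx> ws"
  using relI_add[of "frag_of us - frag_of vs" "frag_of vs - frag_of ws"] by (simp add: weq_def)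

lemma wzero_weq: "us \<approx> vs \<Longrightarrow> wzero vs \<Longrightarrow> wzero us"
  using relI_add[of "frag_of us - frag_of vs" "frag_of vs"] by (simp add: weq_def wzero_def)

lemma weq_context:
  assumes "us \<approx> vs" "xs \<in> lists gens" "ys \<in> lists gens" shows "xs @ us @ ys \<approx> xs @ vs @ ys"
  using relI_mult[of "frag_of us - frag_of vs" xs ys] assms by (simp add: weq_def frag_extend_diff)

lemma wzero_context:
  assumes "wzero us" "xs \<in> lists gens" "ys \<in> lists gens" shows "wzero (xs @ us @ ys)"
  using relI_mult[of "frag_of us" xs ys] assms by (simp add: wzero_def)

lemma weq_right: "us \<approx> vs \<Longrightarrow> ys \<in> lists gens \<Longrightarrow> us @ ys \<approx> vs @ ys"
  using weq_context[of us vs "[]" ys] by simp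

lemma weq_left: "us \<approx> vs \<Longrightarrow> xs \<in> lists gens \<Longrightarrow> xs @ us \<approx> xs @ vs"
  using weq_context[of us vs xs "[]"] by simp

lemma weq_rel: "(frag_of us, frag_of vs) \<in> rels \<Longrightarrow> us \<approx> vs"
  using relI_rel by (simp add: weq_def)

lemma weq_DU: "I \<lessdot> J \<Longrightarrow> [Down J I, Up I J] \<approx> [One J]"
  by (rule weq_rel) (auto simp: rels_def)

lemma weq_UU: 
  assumes "I \<lessdot> J" "J \<lessdot> K" "I \<lessdot> J'" "J' \<lessdot> K" shows "[Up I J, Up J K] \<approx> [Up I J', Up J' K]"
proof (rule weq_rel)
  have m: "(frag_of ([Up I J, Up J K]), frag_of ([Up I J', Up J' K])) \<in> {(frag_of [Up I J, Up J K], frag_of [Up I J', Up J' K]) | I J J' K.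
       I \<lessdot> J \<and> J \<lessdot> K \<and> I \<lessdot> J' \<and> J' \<lessdot> K}"
    using assms by blast
  show "(frag_of ([Up I J, Up J K]), frag_of ([Up I J', Up J' K])) \<in> rels" unfolding rels_def by (simp only: Un_iff m simp_thms)
qed

lemma weq_DD: 
  assumes "I \<lessdot> J" "J \<lessdot> K" "I \<lessdot> J'" "J' \<lessdot> K" shows "[Down K J, Down J I] \<approx> [Down K J', Down J' I]"
proof (rule weq_rel)
  have m: "(frag_of ([Down K J, Down J I]), frag_of ([Down K J', Down J' I])) \<in> {(frag_of [Down K J, Down J I], frag_of [Down K J', Down J' I]) | I J J' K.
       I \<lessdot> J \<and> J \<lessdot> K \<and> I \<lessdot> J' \<and> J' \<lessdot> K}"
    using assms by blast
  show "(frag_of ([Down K J, Down J I]), frag_of ([Down K J', Down J' I])) \<in> rels" unfolding rels_def by (simp only: Un_iff m simp_thms)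
qed

lemma weq_UD: 
  assumes "I \<noteq> {}" "ordering I Is" "associated_expr I Is ws" shows "up_word Is @ down_word Is \<approx> p_word ws"
proof (rule weq_rel)
  have m: "(frag_of (up_word Is @ down_word Is), frag_of (p_word ws)) \<in> {(frag_of (up_word Is @ down_word Is), frag_of (p_word ws)) | I Is ws.
       I \<in> \<Lambda> - {{}} \<and> ordering I Is \<and> associated_expr I Is ws}"
    using assms ordering_in_\<Lambda>[OF assms(2)] by blast
  show "(frag_of (up_word Is @ down_word Is), frag_of (p_word ws)) \<in> rels" unfolding rels_def by (simp only: Un_iff m simp_thms)
qed

lemma weq_U_One: "I \<lessdot> J \<Longrightarrow> [Up I J, One J] \<approx> [Up I J]"
  by (rule weq_rel, unfold rels_def) blast

lemma weq_One_U: "I \<lessdot> J \<Longrightarrow> [One I, Up I J] \<approx> [Up I J]"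
  by (rule weq_rel, unfold rels_def) blast

lemma weq_D_One: "I \<lessdot> J \<Longrightarrow> [Down J I, One I] \<approx> [Down J I]"
  by (rule weq_rel, unfold rels_def) blast

lemma weq_One_D: "I \<lessdot> J \<Longrightarrow> [One J, Down J I] \<approx> [Down J I]"
  by (rule weq_rel, unfold rels_def) blast

lemma weq_One_One: "I \<in> \<Lambda> \<Longrightarrow> [One I, One I] \<approx> [One I]"
  by (rule weq_rel, unfold rels_def) blast

lemma wzero_One_One:
  assumes "I \<in> \<Lambda>" "J \<in> \<Lambda>" "I \<noteq> J" shows "wzero [One I, One J]"
proof -
  have "(frag_of [One I, One J], 0) \<in> rels" unfolding rels_def using assms by blast
  then show ?thesis using relI_rel[of "frag_of [One I, One J]" 0] by (simp add: wzero_def)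
qed

lemma sum_One: "frag_of [] - (\<Sum>I\<in>\<Lambda>. frag_of [One I]) \<in> relI"
  by (rule relI_rel) (simp add: rels_def)


subsubsection \<open>Independence of the ordering\<close>

text \<open>Induction on the size of I. Chains through J and J' are compared through a chain that
  ends in J \<inter> J'; the commutation relations \<open>weq_UU\<close> and \<open>weq_DD\<close>
  are the two faces of this diamond.\<close>

lemma words_independent:
  assumes "ordering I Is" "ordering I Is'"
  shows "up_word Is \<approx> up_word Is' \<and> down_word Is \<approx> down_word Is'"
  using assms
proof (induction "card I" arbitrary: I Is Is' rule: less_induct)
  case less
  note or_cases = ordering_cases
  from less.prems(1) show ?case
  proof (cases rule: or_cases)
    case 1
    have "Is' = [{}]" using less.prems(2) 1(1)
      by (cases rule: or_cases) (auto dest: cov_D)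
    then show ?thesis using 1 weq_refl by simp
  next
    case (2 J Js)
    note J = 2
    from less.prems(2) show ?thesis
    proof (cases rule: or_cases)
      case 1
      then show ?thesis using cov_D(3,5)[OF J(3)] by blast
    next
      case (2 J' Js')
      note J' = 2
      have w: "up_word Ls @ [Up L I] \<in> lists gens" "Down I L # down_word Ls \<in> lists gens"
        if "ordering L Ls" "L \<lessdot> I" for L Ls
        using ordering_words[OF that(1)] that(2) by simp_all
      have lt: "card L < card I" if "L \<lessdot> I" for L using cov_D(4)[OF that] by simp
      have U: "up_word Is = up_word Js @ [Up J I]" "down_word Is = Down I J # down_word Js"
        using J ordering_nonempty[OF J(2)] by (simp_all add: up_word_snoc down_word_snoc)
      have U': "up_word Is' = up_word Js' @ [Up J' I]" "down_word Is' = Down I J' # down_word Js'"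
        using J' ordering_nonempty[OF J'(2)] by (simp_all add: up_word_snoc down_word_snoc)
      have step: "up_word Ls @ [Up L I] \<approx> up_word Ls' @ [Up L I] \<and>
          Down I L # down_word Ls \<approx> Down I L # down_word Ls'"
        if "ordering L Ls" "ordering L Ls'" "L \<lessdot> I" for L Ls Ls'
        using less.hyps[OF lt[OF that(3)] that(1,2)] that(3)
          weq_right[of "up_word Ls" "up_word Ls'" "[Up L I]"]
          weq_left[of "down_word Ls" "down_word Ls'" "[Down I L]"] by simp
      show ?thesis
      proof (cases "J = J'")
        case True
        then show ?thesis using step[OF J(2) _ J(3), of Js'] J'(2) U U' by simp
      next
        case False
        let ?K = "J \<inter> J'"
        have K: "?K \<lessdot> J" "?K \<lessdot> J'" using cov_inter[OF J(3) J'(3) False] .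
        obtain Ks where Ks: "ordering ?K Ks" using ordering_exists cov_D(1)[OF K(1)] by blast
        have Kw: "up_word Ks \<in> lists gens" "down_word Ks \<in> lists gens" using ordering_words[OF Ks] by auto
        have e: "up_word (Ks @ [L]) = up_word Ks @ [Up ?K L]" "down_word (Ks @ [L]) = Down L ?K # down_word Ks" for L
          using ordering_nonempty[OF Ks] by (simp_all add: up_word_snoc down_word_snoc)
        note s1 = step[OF J(2) ordering_snoc[OF Ks K(1)] J(3)]
        note s2 = step[OF J'(2) ordering_snoc[OF Ks K(2)] J'(3)]
        have "up_word Ks @ [Up ?K J, Up J I] \<approx> up_word Ks @ [Up ?K J', Up J' I]"
          using weq_left[OF weq_UU[OF K(1) J(3) K(2) J'(3)] Kw(1)] .
        then have "up_word Is \<approx> up_word Is'"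
          using s1 s2 weq_trans weq_sym unfolding U U' e by (metis append_Cons append_Nil append_assoc)
        moreover have "[Down I J, Down J ?K] @ down_word Ks \<approx> [Down I J', Down J' ?K] @ down_word Ks"
          using weq_right[OF weq_DD[OF K(1) J(3) K(2) J'(3)] Kw(2)] .
        then have "down_word Is \<approx> down_word Is'"
          using s1 s2 weq_trans weq_sym unfolding U U' e by (metis append_Cons append_Nil)
        ultimately show ?thesis ..
      qed
    qed
  qed
qed

definition och :: "'w set \<Rightarrow> 'w set list" where
  "och I = (SOME Is. ordering I Is)"

abbreviation Uw :: "'w set \<Rightarrow> 'w gen list" where "Uw I \<equiv> up_word (och I)"
abbreviation Dw :: "'w set \<Rightarrow> 'w gen list" where "Dw I \<equiv> down_word (och I)"

lemma och: "I \<in> \<Lambda> \<Longrightarrow> ordering I (och I)"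
  unfolding och_def using ordering_exists by (rule someI_ex)

lemma UDw_gens: "I \<in> \<Lambda> \<Longrightarrow> Uw I \<in> lists gens" "I \<in> \<Lambda> \<Longrightarrow> Dw I \<in> lists gens"
  using ordering_words[OF och] by auto

lemma Uw_step: assumes "A \<lessdot> B" shows "Uw A @ [Up A B] \<approx> Uw B"
proof -
  note o = och[OF cov_D(1)[OF assms]]
  have "up_word (och A @ [B]) \<approx> Uw B"
    using words_independent[OF ordering_snoc[OF o assms] och[OF cov_D(2)[OF assms]]] by blast
  then show ?thesis using ordering_nonempty[OF o] by (simp add: up_word_snoc)
qed

lemma Dw_step: assumes "A \<lessdot> B" shows "Down B A # Dw A \<approx> Dw B"
proof -
  note o = och[OF cov_D(1)[OF assms]]
  have "down_word (och A @ [B]) \<approx> Dw B"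
    using words_independent[OF ordering_snoc[OF o assms] och[OF cov_D(2)[OF assms]]] by blast
  then show ?thesis using ordering_nonempty[OF o] by (simp add: down_word_snoc)
qed

text \<open>The word contracts from the inside by d u = 1. The factors \<open>One I\<close> are
  there for the empty I, whose chains are empty words and hence stand for the unit of the algebra
  rather than for its idempotent.\<close>

lemma down_up_word:
  "ordering I Is \<Longrightarrow> [One I] @ down_word Is @ up_word Is \<approx> [One I] \<and>
    down_word Is @ up_word Is @ [One I] \<approx> [One I]"
proof (induction rule: ordering_induct)
  case empty
  then show ?case using weq_refl by simp
next
  case (snoc I Is J)
  note cv = cov_D[OF snoc(2)]
  have g: "Up I J \<in> gens" "Down J I \<in> gens" "One I \<in> gens" "One J \<in> gens"
    using snoc(2) cv by simp_all
  have w: "up_word Is \<in> lists gens" "down_word Is \<in> lists gens" using ordering_words[OF snoc(1)] by auto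
  have e: "up_word (Is @ [J]) = up_word Is @ [Up I J]" "down_word (Is @ [J]) = Down J I # down_word Is"
    using ordering_nonempty[OF snoc(1)] by (simp_all add: up_word_snoc down_word_snoc)
  have "[Down J I] @ (down_word Is @ up_word Is @ [Up I J]) \<approx> [Down J I, One I] @ (down_word Is @ up_word Is @ [Up I J])"
    using w g by (intro weq_right weq_sym[OF weq_D_One] snoc(2)) auto
  also have "\<dots> = [Down J I] @ ([One I] @ down_word Is @ up_word Is) @ [Up I J]" by simp
  also have "\<dots> \<approx> [Down J I] @ [One I] @ [Up I J]"
    using snoc.IH g by (intro weq_context) auto
  also have "\<dots> \<approx> [Down J I] @ [Up I J]"
    using weq_left[OF weq_One_U[OF snoc(2)], of "[Down J I]"] g by simp
  also have "\<dots> \<approx> [One J]" using weq_DU[OF snoc(2)] by simp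
  finally have *: "down_word (Is @ [J]) @ up_word (Is @ [J]) \<approx> [One J]" by (simp add: e)
  have "[One J] @ down_word (Is @ [J]) @ up_word (Is @ [J]) \<approx> [One J] @ [One J]"
    using * g by (intro weq_left) auto
  moreover have "(down_word (Is @ [J]) @ up_word (Is @ [J])) @ [One J] \<approx> [One J] @ [One J]"
    using * g by (intro weq_right) auto
  ultimately show ?case using weq_One_One[OF cv(2)] weq_trans by auto
qed

text \<open>\<open>longest_coset\<close> puts a prefix in front of some reduced word of w_I.
  Exchanging that word for the expression already found keeps product and length, so the longer word
  stays reduced.\<close>

lemma associated_expr_exists:
  "ordering I Is \<Longrightarrow> \<exists>ws. associated_expr I Is ws"
proof (induction rule: ordering_induct)
  case empty
  then show ?case by (intro exI[of _ "[]"]) (simp add: associated_expr_def reduced_def longest_empty)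
next
  case (snoc I Is J)
  then obtain ws where ws: "reduced ws" "wp ws = longest I"
    "\<forall>i < length Is. \<exists>j \<le> length ws. longest (Is ! i) = wp (drop (length ws - j) ws)"
    by (auto simp: associated_expr_def)
  obtain ds us where d: "reduced (ds @ us)" "wp (ds @ us) = longest J" "reduced us" "wp us = longest I"
    using longest_coset[OF cov_D(2,3)[OF snoc(2)]] by blast
  have l: "length us = length ws" using d ws by (simp add: reduced_def)
  have dl: "ds \<in> lists S" "us \<in> lists S" "ws \<in> lists S"
    using reduced_lists[OF d(1)] reduced_lists[OF ws(1)] by auto
  have p: "wp (ds @ ws) = longest J" using dl d ws by (simp add: wp_append)
  have r: "reduced (ds @ ws)" using d(1,2) p dl l by (simp add: reduced_def)
  have "\<exists>j \<le> length (ds @ ws). longest ((Is @ [J]) ! i) = wp (drop (length (ds @ ws) - j) (ds @ ws))"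
    if i: "i < length (Is @ [J])" for i
  proof (cases "i < length Is")
    case True
    then obtain j where "j \<le> length ws" "longest (Is ! i) = wp (drop (length ws - j) ws)" using ws(3) by blast
    then show ?thesis using True by (intro exI[of _ j]) (simp add: nth_append)
  next
    case False
    then have "(Is @ [J]) ! i = J" using i by (simp add: nth_append)
    then show ?thesis using p by (intro exI[of _ "length (ds @ ws)"]) simp
  qed
  then show ?case using r p unfolding associated_expr_def by blast
qed


subsubsection \<open>The 0-Hecke monoid inside the algebra\<close>

lemma p_word_idem:
  assumes "s \<in> S" shows "p_word [s, s] \<approx> p_word [s]"
proof -
  note c = empty_cov_singleton[OF assms]
  have g: "Up {} {s} \<in> gens" "Down {s} {} \<in> gens" using c by simp_all
  have "[Up {} {s}] @ [Down {s} {}, Up {} {s}] @ [Down {s} {}] \<approx> [Up {} {s}] @ [One {s}] @ [Down {s} {}]"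
    using g by (intro weq_context weq_DU c) auto
  also have "\<dots> \<approx> [Up {} {s}] @ [Down {s} {}]"
    using weq_left[OF weq_One_D[OF c], of "[Up {} {s}]"] g by simp
  finally show ?thesis by simp
qed

text \<open>For the ordering with middle term {x} the only extra condition is that the suffix of
  length one is x.\<close>

lemma associated_dihedral:
  assumes xy: "x \<in> S" "y \<in> S" "x \<noteq> y" "{x, y} \<in> \<Lambda>" and ws: "reduced ws" "wp ws = longest {x, y}" "ws = vs @ [x]"
  shows "\<exists>Is. ordering {x, y} Is \<and> associated_expr {x, y} Is ws"
proof -
  have c: "{x} \<lessdot> {x, y}" using xy by (intro cov_I) auto
  have o: "ordering {x, y} [{}, {x}, {x, y}]"
    using ordering_snoc[OF ordering_snoc[OF ordering_empty empty_cov_singleton[OF xy(1)]] c] by simp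
  have "\<exists>j \<le> length ws. longest ([{}, {x}, {x, y}] ! i) = wp (drop (length ws - j) ws)" if "i < 3" for i
  proof -
    consider "i = 0" | "i = 1" | "i = 2" using \<open>i < 3\<close> by linarith
    then show ?thesis
    proof cases
      case 1
      then show ?thesis by (intro exI[of _ 0]) (simp add: longest_empty)
    next
      case 2
      then show ?thesis using ws(3) longest_singleton(2)[OF xy(1)] xy(1) by (intro exI[of _ 1]) simp
    next
      case 3
      then show ?thesis using ws(2) by (intro exI[of _ "length ws"]) simp
    qed
  qed
  then have "associated_expr {x, y} [{}, {x}, {x, y}] ws" using ws(1,2) by (simp add: associated_expr_def)
  then show ?thesis using o by blast
qed

lemma alternating_snoc: "alternating (Suc n) s t = alternating n s t @ [if even n then s else t]"
  by (simp add: alternating_def)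

lemma p_word_braid:
  assumes st: "s \<in> S" "t \<in> S" and m: "m = ord (s \<otimes> t)" "m > 0"
  shows "p_word (alternating m s t) \<approx> p_word (alternating m t s)"
proof (cases "s = t")
  case True
  then show ?thesis using weq_refl by simp
next
  case False
  have one: "(s \<otimes> t) [^] m = \<one>" using m st pow_ord_eq_1[of "s \<otimes> t"] by simp
  have L: "{s, t} \<in> \<Lambda>" using dihedral_finite[OF st one m(2)] st by (simp add: \<Lambda>_def)
  obtain m' where m': "m' = ord (s \<otimes> t)" "longest {s, t} = wp (alternating m' s t)"
    "reduced (alternating m' s t)" "reduced (alternating m' t s)"
    using both_descents[OF st False longest_in[OF L]] longest_descents(1)[OF L] by (metis insert_iff)
  have mm: "m' = m" using m m' by simp
  have lt: "longest {s, t} = wp (alternating m t s)" using alternating_eq[OF st one] m'(2) mm by simp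
  obtain k where k: "m = Suc k" using m(2) by (cases m) auto
  \<comment> \<open>The parity of m decides whether an alternating word ends in s or in t; the
    middle term of the ordering has to be the singleton of that last letter.\<close>
  have *: "\<exists>Is. ordering {s, t} Is \<and> associated_expr {s, t} Is ws"
    if "reduced ws" "wp ws = longest {s, t}" "ws = vs @ [x]" "x \<in> {s, t}" for ws vs x
  proof (cases "x = s")
    case True
    then show ?thesis using associated_dihedral[OF st False L that(1,2)] that(3) by blast
  next
    case neq: False
    then have "x = t" using that(4) by simp
    then show ?thesis
      using associated_dihedral[OF st(2,1) _ _ that(1)] False L that(2,3) by (simp add: insert_commute)
  qed
  have al: "alternating m s t = alternating k s t @ [if even k then s else t]" for s t
    unfolding k by (rule alternating_snoc)
  note m'' = m'(2-4)[unfolded mm]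
  obtain Is where Is: "ordering {s, t} Is" "associated_expr {s, t} Is (alternating m s t)"
  proof -
    have "\<exists>Is. ordering {s, t} Is \<and> associated_expr {s, t} Is (alternating m s t)"
      by (rule *[of _ "alternating k s t" "if even k then s else t"]) (use m'' al[of s t] in simp_all)
    then show ?thesis using that by blast
  qed
  obtain Js where Js: "ordering {s, t} Js" "associated_expr {s, t} Js (alternating m t s)"
  proof -
    have "\<exists>Js. ordering {s, t} Js \<and> associated_expr {s, t} Js (alternating m t s)"
      by (rule *[of _ "alternating k t s" "if even k then t else s"]) (use m'' lt al[of t s] in simp_all)
    then show ?thesis using that by blast
  qed
  have w: "up_word Is \<in> lists gens" "down_word Js \<in> lists gens"
    using ordering_words[OF Is(1)] ordering_words[OF Js(1)] by auto
  have i: "up_word Is \<approx> up_word Js" "down_word Is \<approx> down_word Js"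
    using words_independent[OF Is(1) Js(1)] by auto
  have "p_word (alternating m s t) \<approx> up_word Is @ down_word Is"
    by (rule weq_sym[OF weq_UD[OF _ Is]]) simp
  also have "\<dots> \<approx> up_word Is @ down_word Js" using weq_left[OF i(2) w(1)] .
  also have "\<dots> \<approx> up_word Js @ down_word Js" using weq_right[OF i(1) w(2)] .
  also have "\<dots> \<approx> p_word (alternating m t s)" using weq_UD[OF _ Js] by auto
  finally show ?thesis .
qed

lemma zcong_p_word: "zcong us vs \<Longrightarrow> us \<in> lists S \<Longrightarrow> p_word us \<approx> p_word vs"
proof (induction rule: zcong.induct)
  case (zcong_refl us)
  then show ?case using weq_refl by simp
next
  case (zcong_sym us vs)
  then show ?case using zcong_lists[OF zcong_sym.hyps, of S] weq_sym by simp
next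
  case (zcong_trans us vs ws)
  then show ?case using zcong_lists[OF zcong_trans.hyps(1), of S] weq_trans by blast
next
  case (zcong_idem s)
  then show ?case using p_word_idem by blast
next
  case (zcong_braid s t m)
  then show ?case using p_word_braid by blast
next
  case (zcong_append us vs us' vs')
  have l: "us \<in> lists S" "us' \<in> lists S" "vs \<in> lists S"
    using zcong_append.prems zcong_lists[OF zcong_append.hyps(1), of S] by auto
  have "p_word us @ p_word us' \<approx> p_word vs @ p_word us'"
    using weq_right[OF zcong_append.IH(1)[OF l(1)] p_word_gens[OF l(2)]] .
  also have "\<dots> \<approx> p_word vs @ p_word vs'"
    using weq_left[OF zcong_append.IH(2)[OF l(2)] p_word_gens[OF l(3)]] .
  finally show ?case by simp
qed

text \<open>The relation speaks of nonempty I and of expressions associated with the chosen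
  ordering. Matsumoto's theorem passes from one of these to any reduced word; for empty I all words
  are empty.\<close>

lemma Uw_Dw:
  assumes I: "I \<in> \<Lambda>" and ws: "reduced ws" "wp ws = longest I" shows "Uw I @ Dw I \<approx> p_word ws"
proof (cases "I = {}")
  case True
  have "och {} = [{}]" using och[OF \<Lambda>_empty] by (cases rule: ordering_cases) (auto dest: cov_D)
  moreover have "ws = []" using ws True longest_empty by (simp add: reduced_def)
  ultimately show ?thesis using True weq_refl by simp
next
  case False
  obtain vs where vs: "associated_expr I (och I) vs" using associated_expr_exists[OF och[OF I]] by blast
  then have v: "reduced vs" "wp vs = wp ws" using ws(2) by (auto simp: associated_expr_def)
  have "Uw I @ Dw I \<approx> p_word vs" using weq_UD[OF False och[OF I] vs] .
  also have "\<dots> \<approx> p_word ws" using zcong_p_word[OF matsumoto[OF v(1) ws(1) v(2)] reduced_lists[OF v(1)]] .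
  finally show ?thesis .
qed


subsubsection \<open>Normal forms\<close>

definition rw :: "'w \<Rightarrow> 'w list" where
  "rw w = (SOME ws. reduced ws \<and> wp ws = w)"

lemma rw: "w \<in> carrier G \<Longrightarrow> reduced (rw w)" "w \<in> carrier G \<Longrightarrow> wp (rw w) = w"
  unfolding rw_def using someI_ex[OF reduced_exists[of w]] by auto

text \<open>
  Every object \<open>I\<close> is a retract of \<open>{}\<close>, so it suffices to reduce words from \<open>{}\<close> to \<open>{}\<close>, which
  are products of the idempotents \<open>p\<^bsub>{s}\<^esub>\<close>.
\<close>

definition nb :: "'w set \<Rightarrow> 'w list \<Rightarrow> 'w set \<Rightarrow> 'w gen list" where
  "nb I ws J = [One I] @ Dw I @ p_word ws @ Uw J @ [One J]"

text \<open>Maximality in the double coset W_I w W_J, expressed by descents: absorption of letters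
  yields this form, and so does the invariance of the function of an endomorphism.\<close>

definition full :: "'w set \<Rightarrow> 'w set \<Rightarrow> 'w set" where
  "full I J = {w \<in> carrier G. (\<forall>s \<in> I. len (s \<otimes> w) < len w) \<and> (\<forall>s \<in> J. len (w \<otimes> s) < len w)}"

lemma nb_gens: "I \<in> \<Lambda> \<Longrightarrow> J \<in> \<Lambda> \<Longrightarrow> ws \<in> lists S \<Longrightarrow> nb I ws J \<in> lists gens"
  unfolding nb_def using UDw_gens p_word_gens by simp

text \<open>Insert d u = 1 beside 1_I and read the loop u d as the product along w_I. So a reduced
  word of w_I may be added for free next to \<open>Dw I\<close> or \<open>Uw I\<close>.\<close>

lemma One_Dw_absorb:
  assumes I: "I \<in> \<Lambda>" and ws: "reduced ws" "wp ws = longest I"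
  shows "[One I] @ Dw I \<approx> [One I] @ Dw I @ p_word ws" and "Uw I @ [One I] \<approx> p_word ws @ Uw I @ [One I]"
proof -
  note g = UDw_gens[OF I] gens_I(3)[OF I]
  note du = down_up_word[OF och[OF I]]
  have "[One I] @ Dw I \<approx> ([One I] @ Dw I @ Uw I) @ Dw I"
    using weq_right[OF weq_sym[OF conjunct1[OF du]] g(2)] .
  also have "\<dots> = ([One I] @ Dw I) @ (Uw I @ Dw I)" by simp
  also have "\<dots> \<approx> ([One I] @ Dw I) @ p_word ws" using weq_left[OF Uw_Dw[OF I ws], of "[One I] @ Dw I"] g by simp
  finally show "[One I] @ Dw I \<approx> [One I] @ Dw I @ p_word ws" by simp
  have "Uw I @ [One I] \<approx> Uw I @ (Dw I @ Uw I @ [One I])"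
    using weq_left[OF weq_sym[OF conjunct2[OF du]] g(1)] .
  also have "\<dots> = (Uw I @ Dw I) @ (Uw I @ [One I])" by simp
  also have "\<dots> \<approx> p_word ws @ (Uw I @ [One I])" using weq_right[OF Uw_Dw[OF I ws]] g by simp
  finally show "Uw I @ [One I] \<approx> p_word ws @ Uw I @ [One I]" by simp
qed

text \<open>Induction from the left: the first generator either does not fit the idempotent in front
  of it, which gives zero, or merges with the descending chain of the word obtained for the
  rest.\<close>

lemma word_to_nb:
  assumes "w \<in> lists gens" and I: "I \<in> \<Lambda>" and J: "J \<in> \<Lambda>"
  shows "wzero ([One I] @ w @ [One J]) \<or> (\<exists>vs \<in> lists S. [One I] @ w @ [One J] \<approx> nb I vs J)"
  using assms(1) I
proof (induction w arbitrary: I)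
  case Nil
  show ?case
  proof (cases "I = J")
    case True
    note g = UDw_gens[OF J] gens_I(3)[OF J]
    have "[One J, One J] \<approx> ([One J] @ Dw J @ Uw J) @ [One J]"
      using weq_right[OF weq_sym[OF conjunct1[OF down_up_word[OF och[OF J]]]], of "[One J]"] g by simp
    then show ?thesis using True unfolding nb_def by (intro disjI2 bexI[of _ "[]"]) auto
  next
    case False
    then show ?thesis using wzero_One_One[OF Nil.prems J] by simp
  qed
next
  case (Cons g w)
  have w: "w \<in> lists gens" "One J \<in> gens" "One I \<in> gens" using Cons.hyps J Cons.prems by auto
  have gg: "g \<in> gens" using Cons.hyps by simp
  \<comment> \<open>A generator that belongs to another object K is killed: insert 1_K in front of
    it and use 1_I 1_K = 0.\<close>
  have zero: ?case
    if "[One K, g] \<approx> [g]" "K \<in> \<Lambda>" "I \<noteq> K" for K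
  proof -
    have gs: "One K \<in> gens" using that(2) by simp
    have "[One I] @ [g] @ w @ [One J] \<approx> [One I] @ [One K, g] @ w @ [One J]"
      using weq_context[OF weq_sym[OF that(1)], of "[One I]" "w @ [One J]"] w by simp
    moreover have "wzero ([] @ [One I, One K] @ ([g] @ w @ [One J]))"
      using w gg by (intro wzero_context wzero_One_One that(2,3) Cons.prems) auto
    ultimately show ?thesis using wzero_weq by auto
  qed
  from gg show ?case
  proof (cases rule: gens_E)
    case (1 A B)
    note cv = cov_D[OF 1(2)]
    show ?thesis
    proof (cases "I = A")
      case False
      then show ?thesis using zero[of A] weq_One_U[OF 1(2)] 1 cv by simp
    next
      case True
      have gs: "Up A B \<in> gens" "One B \<in> gens" "One A \<in> gens" using 1(2) cv by simp_all
      have e: "[One A] @ [Up A B] @ w @ [One J] \<approx> [One A, Up A B] @ [One B] @ w @ [One J]"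
        using weq_context[OF weq_sym[OF weq_U_One[OF 1(2)]], of "[One A]" "w @ [One J]"] w gs by simp
      from Cons.IH[OF cv(2)] show ?thesis
      proof
        assume "wzero ([One B] @ w @ [One J])"
        then have "wzero ([One A, Up A B] @ ([One B] @ w @ [One J]) @ [])"
          by (rule wzero_context) (use gs in simp_all)
        then show ?thesis using wzero_weq[OF e] True 1(1) by simp
      next
        assume "\<exists>vs \<in> lists S. [One B] @ w @ [One J] \<approx> nb B vs J"
        then obtain vs where vs: "vs \<in> lists S" "[One B] @ w @ [One J] \<approx> nb B vs J" by blast
        note uA = UDw_gens[OF cv(1)] and uB = UDw_gens[OF cv(2)] and uJ = UDw_gens[OF J]
        have pv: "p_word vs \<in> lists gens" using p_word_gens vs(1) .
        have lB: "reduced (rw (longest B))" "wp (rw (longest B)) = longest B"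
          using rw[OF longest_closed[OF cv(2)]] .
        let ?R = "p_word vs @ Uw J @ [One J]"
        have R: "?R \<in> lists gens" using pv uJ w by simp
        have "[One A, Up A B] @ [One B] @ w @ [One J] \<approx> [One A, Up A B] @ nb B vs J"
          using weq_left[OF vs(2), of "[One A, Up A B]"] gs by simp
        also have "\<dots> = [One A] @ [Up A B, One B] @ Dw B @ ?R" by (simp add: nb_def)
        also have "\<dots> \<approx> [One A] @ [Up A B] @ Dw B @ ?R"
          using R uB gs by (intro weq_context weq_U_One 1(2)) auto
        \<comment> \<open>The loop d u at A is inserted so that the ascending chain
          \<open>Uw A\<close> can be continued to B. It then meets \<open>Dw B\<close>, and u d at B
          turns into the letters of w_B.\<close>
        also have "\<dots> \<approx> ([One A] @ Dw A @ Uw A) @ [Up A B] @ Dw B @ ?R"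
          using R uB gs by (intro weq_right weq_sym[OF conjunct1[OF down_up_word]] och cv(1)) auto
        also have "\<dots> = ([One A] @ Dw A) @ (Uw A @ [Up A B]) @ Dw B @ ?R" by simp
        also have "\<dots> \<approx> ([One A] @ Dw A) @ Uw B @ Dw B @ ?R"
          using R uB uA gs by (intro weq_context Uw_step 1(2)) auto
        also have "\<dots> = ([One A] @ Dw A) @ (Uw B @ Dw B) @ ?R" by simp
        also have "\<dots> \<approx> ([One A] @ Dw A) @ p_word (rw (longest B)) @ ?R"
          using R uA gs by (intro weq_context Uw_Dw cv(2) lB) auto
        also have "\<dots> = nb A (rw (longest B) @ vs) J" by (simp add: nb_def)
        finally have "[One A] @ [Up A B] @ w @ [One J] \<approx> nb A (rw (longest B) @ vs) J"
          using e weq_trans by blast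
        moreover have "rw (longest B) @ vs \<in> lists S" using vs(1) reduced_lists[OF lB(1)] by simp
        ultimately show ?thesis using True 1(1) by (intro disjI2 bexI[of _ "rw (longest B) @ vs"]) simp_all
      qed
    qed
  next
    case (2 A B)
    note cv = cov_D[OF 2(2)]
    show ?thesis
    proof (cases "I = B")
      case False
      then show ?thesis using zero[of B] weq_One_D[OF 2(2)] 2 cv by simp
    next
      case True
      have gs: "Down B A \<in> gens" "One B \<in> gens" "One A \<in> gens" using 2(2) cv by simp_all
      have e: "[One B] @ [Down B A] @ w @ [One J] \<approx> [One B, Down B A] @ [One A] @ w @ [One J]"
        using weq_context[OF weq_sym[OF weq_D_One[OF 2(2)]], of "[One B]" "w @ [One J]"] w gs by simp
      from Cons.IH[OF cv(1)] show ?thesis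
      proof
        assume "wzero ([One A] @ w @ [One J])"
        then have "wzero ([One B, Down B A] @ ([One A] @ w @ [One J]) @ [])"
          by (rule wzero_context) (use gs in simp_all)
        then show ?thesis using wzero_weq[OF e] True 2(1) by simp
      next
        assume "\<exists>vs \<in> lists S. [One A] @ w @ [One J] \<approx> nb A vs J"
        then obtain vs where vs: "vs \<in> lists S" "[One A] @ w @ [One J] \<approx> nb A vs J" by blast
        note uA = UDw_gens[OF cv(1)] and uJ = UDw_gens[OF J]
        have pv: "p_word vs \<in> lists gens" using p_word_gens vs(1) .
        let ?R = "p_word vs @ Uw J @ [One J]"
        have R: "?R \<in> lists gens" using pv uJ w by simp
        have "[One B, Down B A] @ [One A] @ w @ [One J] \<approx> [One B, Down B A] @ nb A vs J"
          using weq_left[OF vs(2), of "[One B, Down B A]"] gs by simp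
        also have "\<dots> = [One B] @ [Down B A, One A] @ Dw A @ ?R" by (simp add: nb_def)
        also have "\<dots> \<approx> [One B] @ [Down B A] @ Dw A @ ?R"
          using R uA gs by (intro weq_context weq_D_One 2(2)) auto
        also have "\<dots> = [One B] @ (Down B A # Dw A) @ ?R" by simp
        also have "\<dots> \<approx> [One B] @ Dw B @ ?R"
          using R gs by (intro weq_context Dw_step 2(2)) auto
        also have "\<dots> = nb B vs J" by (simp add: nb_def)
        finally have "[One B] @ [Down B A] @ w @ [One J] \<approx> nb B vs J"
          using e weq_trans by blast
        then show ?thesis using True 2(1) vs(1) by auto
      qed
    qed
  next
    case (3 K)
    show ?thesis
    proof (cases "I = K")
      case False
      then show ?thesis using zero[of K] weq_One_One[OF 3(2)] 3 by simp
    next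
      case True
      have e: "[One K, One K] @ w @ [One J] \<approx> [One K] @ w @ [One J]"
        using w by (intro weq_right weq_One_One 3(2)) auto
      from Cons.IH[OF 3(2)] show ?thesis
      proof
        assume "wzero ([One K] @ w @ [One J])"
        then show ?thesis using wzero_weq[OF e] True 3(1) by simp
      next
        assume "\<exists>vs \<in> lists S. [One K] @ w @ [One J] \<approx> nb K vs J"
        then obtain vs where "vs \<in> lists S" "[One K] @ w @ [One J] \<approx> nb K vs J" by blast
        then show ?thesis using weq_trans[OF e] True 3(1) by auto
      qed
    qed
  qed
qed

text \<open>Letters of w_I on the left and of w_J on the right are free. After padding
  \<open>vs\<close> with them and reducing in the 0-Hecke monoid, the word absorbs each s in I on
  the left and each s in J on the right, which amounts to the required descents.\<close>

lemma nb_full: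
  assumes I: "I \<in> \<Lambda>" and J: "J \<in> \<Lambda>" and vs: "vs \<in> lists S"
  shows "\<exists>w \<in> full I J. nb I vs J \<approx> nb I (rw w) J"
proof -
  have lI: "reduced (rw (longest I))" "wp (rw (longest I)) = longest I" using rw[OF longest_closed[OF I]] .
  have lJ: "reduced (rw (longest J))" "wp (rw (longest J)) = longest J" using rw[OF longest_closed[OF J]] .
  let ?a = "rw (longest I)" and ?b = "rw (longest J)"
  have l: "?a \<in> lists S" "?b \<in> lists S" "?a @ vs @ ?b \<in> lists S"
    using reduced_lists[OF lI(1)] reduced_lists[OF lJ(1)] vs by auto
  obtain us where us: "reduced us" "zcong (?a @ vs @ ?b) us" using zcong_reduced[OF l(3)] by blast
  have ul: "us \<in> lists S" using reduced_lists[OF us(1)] .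
  let ?w = "wp us"
  have wc: "?w \<in> carrier G" using ul by simp
  have "len (s \<otimes> ?w) < len ?w" if s: "s \<in> I" for s
  proof (rule absorbed_descent[OF us(1)])
    show sS: "s \<in> S" using s \<Lambda>_D(1)[OF I] by blast
    have "zcong (s # ?a) ?a" using zcong_left_absorb[OF lI(1) sS] longest_descents(1)[OF I s] lI(2) by simp
    then have "zcong (s # ?a @ vs @ ?b) (?a @ vs @ ?b)" using zcong_append[OF _ zcong_refl] by fastforce
    then show "zcong (s # us) us"
      using zcong_trans[OF zcong_sym[OF zcong_Cons[OF us(2)]]] zcong_trans us(2) by blast
  qed
  moreover have "len (?w \<otimes> s) < len ?w" if s: "s \<in> J" for s
  proof (rule absorbed_right_descent[OF us(1)])
    show sS: "s \<in> S" using s \<Lambda>_D(1)[OF J] by blast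
    have "zcong (?b @ [s]) ?b" using zcong_right_absorb[OF lJ(1) sS] longest_descents(2)[OF J s] lJ(2) by simp
    then have "zcong ((?a @ vs @ ?b) @ [s]) (?a @ vs @ ?b)"
      using zcong_append[OF zcong_refl[of "?a @ vs"], of "?b @ [s]" ?b] by simp
    then show "zcong (us @ [s]) us"
      using zcong_trans[OF zcong_sym[OF zcong_append[OF us(2) zcong_refl[of "[s]"]]]] zcong_trans us(2) by blast
  qed
  ultimately have full: "?w \<in> full I J" using wc by (simp add: full_def)
  note uI = UDw_gens[OF I] gens_I(3)[OF I] and uJ = UDw_gens[OF J] gens_I(3)[OF J]
  have pl: "p_word vs \<in> lists gens" "p_word ?a \<in> lists gens" using p_word_gens vs l by auto
  have "nb I vs J = ([One I] @ Dw I) @ p_word vs @ Uw J @ [One J]" by (simp add: nb_def)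
  also have "\<dots> \<approx> ([One I] @ Dw I @ p_word ?a) @ p_word vs @ Uw J @ [One J]"
    using pl uJ by (intro weq_right One_Dw_absorb I lI) auto
  also have "\<dots> = ([One I] @ Dw I @ p_word ?a @ p_word vs) @ (Uw J @ [One J])" by simp
  also have "\<dots> \<approx> ([One I] @ Dw I @ p_word ?a @ p_word vs) @ (p_word ?b @ Uw J @ [One J])"
    using pl uI by (intro weq_left One_Dw_absorb J lJ) auto
  also have "\<dots> = ([One I] @ Dw I) @ p_word (?a @ vs @ ?b) @ (Uw J @ [One J])" by simp
  also have "\<dots> \<approx> ([One I] @ Dw I) @ p_word us @ (Uw J @ [One J])"
    using uI uJ by (intro weq_context zcong_p_word us(2) l(3)) auto
  also have "\<dots> \<approx> ([One I] @ Dw I) @ p_word (rw ?w) @ (Uw J @ [One J])"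
    using uI uJ rw[OF wc] us(1) ul by (intro weq_context zcong_p_word matsumoto) auto
  also have "\<dots> = nb I (rw ?w) J" by (simp add: nb_def)
  finally show ?thesis using full by blast
qed

section \<open>The normal words span\<close>

definition nbs :: "'w gen list set" where
  "nbs = {nb I (rw w) J | I J w. I \<in> \<Lambda> \<and> J \<in> \<Lambda> \<and> w \<in> full I J}"

lemma nbs_gens: "nbs \<subseteq> lists gens"
proof
  fix b assume "b \<in> nbs"
  then obtain I J w where b: "b = nb I (rw w) J" "I \<in> \<Lambda>" "J \<in> \<Lambda>" "w \<in> full I J"
    unfolding nbs_def by blast
  then have "w \<in> carrier G" by (simp add: full_def)
  then show "b \<in> lists gens" unfolding b(1) using nb_gens[OF b(2,3)] reduced_lists[OF rw(1)] by blast
qed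

definition spanned :: "('w gen list \<Rightarrow>\<^sub>0 int) \<Rightarrow> bool" where
  "spanned f \<longleftrightarrow> (\<exists>g. Poly_Mapping.keys g \<subseteq> nbs \<and> f - g \<in> relI)"

lemma spanned_relI: "f \<in> relI \<Longrightarrow> spanned f"
  unfolding spanned_def by (intro exI[of _ 0]) simp

lemma spanned_add: assumes "spanned f" "spanned g" shows "spanned (f + g)"
proof -
  obtain f' g' where "Poly_Mapping.keys f' \<subseteq> nbs" "f - f' \<in> relI" "Poly_Mapping.keys g' \<subseteq> nbs" "g - g' \<in> relI"
    using assms unfolding spanned_def by blast
  then show ?thesis unfolding spanned_def
    using relI_add[of "f - f'" "g - g'"] keys_add_subset[of f' nbs g']
    by (intro exI[of _ "f' + g'"]) (simp add: algebra_simps)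
qed

lemma spanned_diff: assumes "spanned f" "spanned g" shows "spanned (f - g)"
proof -
  obtain f' g' where "Poly_Mapping.keys f' \<subseteq> nbs" "f - f' \<in> relI" "Poly_Mapping.keys g' \<subseteq> nbs" "g - g' \<in> relI"
    using assms unfolding spanned_def by blast
  then show ?thesis unfolding spanned_def
    using relI_diff[of "f - f'" "g - g'"] keys_diff_subset[of f' nbs g']
    by (intro exI[of _ "f' - g'"]) (simp add: algebra_simps)
qed

lemma spanned_sum: "finite A \<Longrightarrow> (\<And>i. i \<in> A \<Longrightarrow> spanned (f i)) \<Longrightarrow> spanned (\<Sum>i\<in>A. f i)"
  by (induction A rule: finite_induct) (auto intro: spanned_add spanned_relI relI_zero)

lemma spanned_word:
  assumes "w \<in> lists gens" "I \<in> \<Lambda>" "J \<in> \<Lambda>" shows "spanned (frag_of ([One I] @ w @ [One J]))"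
  using word_to_nb[OF assms]
proof
  assume "wzero ([One I] @ w @ [One J])"
  then show ?thesis by (intro spanned_relI) (simp add: wzero_def)
next
  assume "\<exists>vs \<in> lists S. [One I] @ w @ [One J] \<approx> nb I vs J"
  then obtain vs where vs: "vs \<in> lists S" "[One I] @ w @ [One J] \<approx> nb I vs J" by blast
  obtain u where u: "u \<in> full I J" "nb I vs J \<approx> nb I (rw u) J" using nb_full[OF assms(2,3) vs(1)] by blast
  have "[One I] @ w @ [One J] \<approx> nb I (rw u) J" using weq_trans[OF vs(2) u(2)] .
  moreover have "nb I (rw u) J \<in> nbs" using u(1) assms unfolding nbs_def by blast
  ultimately show ?thesis unfolding spanned_def weq_def by (intro exI[of _ "frag_of (nb I (rw u) J)"]) simp
qed

theorem normal_form:
  assumes fin: "finite \<Lambda>" and f: "Poly_Mapping.keys f \<subseteq> lists gens"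
  shows "spanned f"
  using f
proof (induction f rule: frag_induction)
  case zero
  then show ?case using spanned_relI[OF relI_zero] .
next
  case (one w)
  let ?e = "\<Sum>I\<in>\<Lambda>. frag_of [One I]"
  \<comment> \<open>The unit, as the sum of the 1_I, is inserted on the left here and on the right
    in the next step.\<close>
  have 1: "frag_of w - (\<Sum>I\<in>\<Lambda>. frag_of ([One I] @ w)) \<in> relI"
    using relI_mult[OF sum_One, of "[]" w] one
    by (simp add: frag_extend_diff frag_extend_sum[OF fin] o_def)
  have 2: "frag_of ([One I] @ w) - (\<Sum>J\<in>\<Lambda>. frag_of ([One I] @ w @ [One J])) \<in> relI" if "I \<in> \<Lambda>" for I
    using relI_mult[OF sum_One, of "[One I] @ w" "[]"] one that
    by (simp add: frag_extend_diff frag_extend_sum[OF fin] o_def)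
  have "spanned (frag_of ([One I] @ w))" if "I \<in> \<Lambda>" for I
  proof -
    have "spanned (\<Sum>J\<in>\<Lambda>. frag_of ([One I] @ w @ [One J]))"
      using spanned_word[OF one that] fin by (intro spanned_sum)
    from spanned_add[OF spanned_relI[OF 2[OF that]] this] show ?thesis by simp
  qed
  then have "spanned (\<Sum>I\<in>\<Lambda>. frag_of ([One I] @ w))" using fin by (intro spanned_sum)
  from spanned_add[OF spanned_relI[OF 1] this] show ?case by simp
next
  case (diff a b)
  then show ?case by (rule spanned_diff)
qed

end


subsection \<open>The action of words on functions\<close>

definition fsum :: "('x \<Rightarrow>\<^sub>0 int) \<Rightarrow> ('x \<Rightarrow> int) \<Rightarrow> int" where
  "fsum f h = (\<Sum>x\<in>Poly_Mapping.keys f. Poly_Mapping.lookup f x * h x)"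

lemma fsum_superset:
  "finite A \<Longrightarrow> Poly_Mapping.keys f \<subseteq> A \<Longrightarrow> fsum f h = (\<Sum>x\<in>A. Poly_Mapping.lookup f x * h x)"
  unfolding fsum_def by (intro sum.mono_neutral_left) (auto simp: in_keys_iff)

lemma fsum_0 [simp]: "fsum 0 h = 0"
  by (simp add: fsum_def)

lemma fsum_of [simp]: "fsum (frag_of x) h = h x"
  by (simp add: fsum_def)

lemma fsum_add: "fsum (f + g) h = fsum f h + fsum g h"
proof -
  let ?A = "Poly_Mapping.keys f \<union> Poly_Mapping.keys g"
  have "fsum (f + g) h = (\<Sum>x\<in>?A. Poly_Mapping.lookup (f + g) x * h x)"
    using Poly_Mapping.keys_add[of f g] by (intro fsum_superset) auto
  moreover have "fsum f h = (\<Sum>x\<in>?A. Poly_Mapping.lookup f x * h x)"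
    "fsum g h = (\<Sum>x\<in>?A. Poly_Mapping.lookup g x * h x)" by (intro fsum_superset; simp)+
  ultimately show ?thesis by (simp add: lookup_add algebra_simps sum.distrib)
qed

lemma fsum_diff: "fsum (f - g) h = fsum f h - fsum g h"
  using fsum_add[of "f - g" g h] by simp

lemma fsum_cmul: "fsum (frag_cmul c f) h = c * fsum f h"
proof -
  have "fsum (frag_cmul c f) h = (\<Sum>x\<in>Poly_Mapping.keys f. Poly_Mapping.lookup (frag_cmul c f) x * h x)"
    by (rule fsum_superset) (auto simp: keys_cmul)
  then show ?thesis by (simp add: fsum_def sum_distrib_left mult.assoc)
qed

lemma fsum_sum: "fsum (\<Sum>i\<in>A. f i) h = (\<Sum>i\<in>A. fsum (f i) h)"
  by (induction A rule: infinite_finite_induct) (auto simp: fsum_add)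

context coxeter_system
begin

text \<open>
  Elements of \<open>x\<^sub>J H\<^sub>q\<close> are reduced modulo \<open>q\<close> to functions on \<open>W\<close> that are constant on the cosets
  \<open>W\<^sub>J w\<close>.  There \<open>u\<^bsub>I,J\<^esub>\<close> is the inclusion, and \<open>d\<^bsub>J,I\<^esub>\<close> is composition with \<open>dmin J\<close>.
\<close>

primrec gact :: "'w gen \<Rightarrow> ('w set \<Rightarrow> 'w \<Rightarrow> int) \<Rightarrow> 'w set \<Rightarrow> 'w \<Rightarrow> int" where
  "gact (Up I J) \<sigma> = (\<lambda>K w. if K = I then \<sigma> J w else 0)"
| "gact (Down J I) \<sigma> = (\<lambda>K w. if K = J then \<sigma> I (dmin J w) else 0)"
| "gact (One L) \<sigma> = (\<lambda>K w. if K = L then \<sigma> L w else 0)"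

abbreviation wact :: "'w gen list \<Rightarrow> ('w set \<Rightarrow> 'w \<Rightarrow> int) \<Rightarrow> 'w set \<Rightarrow> 'w \<Rightarrow> int" where
  "wact \<equiv> foldr gact"

lemma gact_cong:
  assumes "g \<in> gens" "\<And>L u. L \<in> \<Lambda> \<Longrightarrow> u \<in> carrier G \<Longrightarrow> \<sigma> L u = \<tau> L u" "w \<in> carrier G"
  shows "gact g \<sigma> K w = gact g \<tau> K w"
  using assms(1)
proof (cases rule: gens_E)
  case (1 I J)
  then show ?thesis using assms cov_D[OF 1(2)] by simp
next
  case (2 I J)
  then show ?thesis using assms cov_D[OF 2(2)] \<Lambda>_D(1) by simp
next
  case (3 L)
  then show ?thesis using assms by simp
qed

lemma ordering_empty_unique: "ordering {} Is \<Longrightarrow> Is = [{}]"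
  by (cases rule: ordering_cases) (auto dest: cov_D)

lemma wact_up_word: "ordering I Is \<Longrightarrow> wact (up_word Is) \<sigma> {} w = \<sigma> I w"
proof (induction arbitrary: \<sigma> rule: ordering_induct)
  case (snoc I Is J)
  then show ?case using ordering_nonempty[OF snoc(1)] by (simp add: up_word_snoc)
qed simp

lemma wact_up_word_zero: "ordering I Is \<Longrightarrow> I \<noteq> {} \<Longrightarrow> K \<noteq> {} \<Longrightarrow> wact (up_word Is) \<sigma> K w = 0"
proof (induction arbitrary: \<sigma> rule: ordering_induct)
  case (snoc I Is J)
  note n = ordering_nonempty[OF snoc(1)]
  show ?case
  proof (cases "I = {}")
    case True
    then have "Is = [{}]" using snoc(1) ordering_empty_unique by simp
    then have "up_word (Is @ [J]) = [Up {} J]" using up_word_snoc[of "[{}]" J] by simp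
    then show ?thesis using snoc.prems by simp
  next
    case False
    then show ?thesis using snoc.IH[OF False snoc.prems(2)] n by (simp add: up_word_snoc)
  qed
qed simp

lemma wact_down_word:
  "ordering I Is \<Longrightarrow> w \<in> carrier G \<Longrightarrow> wact (down_word Is) \<sigma> I w = \<sigma> {} (dmin I w)"
proof (induction arbitrary: w rule: ordering_induct)
  case (snoc I Is J)
  note cv = cov_D[OF snoc(2)]
  have d: "dmin J w \<in> carrier G" using \<Lambda>_D(1)[OF cv(2)] snoc.prems by simp
  show ?case
    using snoc.IH[OF d] ordering_nonempty[OF snoc(1)] dmin_dmin[OF cv(3) \<Lambda>_D(1)[OF cv(2)] snoc.prems]
    by (simp add: down_word_snoc)
qed simp

text \<open>The leftmost letter acts last on the function, hence first on its argument; this is why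
  \<open>fold\<close> runs through \<open>ws\<close> from the left.\<close>

lemma wact_p_word:
  "ws \<in> lists S \<Longrightarrow> w \<in> carrier G \<Longrightarrow> wact (p_word ws) \<sigma> {} w = \<sigma> {} (fold dn ws w)"
proof (induction ws arbitrary: w)
  case (Cons s ws)
  then have s: "s \<in> S" "ws \<in> lists S" by auto
  then show ?case using Cons.IH[OF s(2), of "dn s w"] Cons.prems dmin_singleton[OF s(1), of w] by simp
qed simp

lemma wact_p_word_zero: "ws \<noteq> [] \<Longrightarrow> K \<noteq> {} \<Longrightarrow> wact (p_word ws) \<sigma> K w = 0"
  by (cases ws) auto

lemma wact_nb:
  assumes "I \<in> \<Lambda>" "J \<in> \<Lambda>" "ws \<in> lists S" "w \<in> carrier G"
  shows "wact (nb I ws J) \<sigma> K w = (if K = I then \<sigma> J (fold dn ws (dmin I w)) else 0)"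
proof -
  have d: "dmin I w \<in> carrier G" using assms \<Lambda>_D(1) by simp
  show ?thesis
    unfolding nb_def using wact_down_word[OF och[OF assms(1)] assms(4)] wact_p_word[OF assms(3) d]
      wact_up_word[OF och[OF assms(2)]] by simp
qed

text \<open>A full w absorbs I on the left and J on the right. So the projection
  \<open>dmin I\<close> in \<open>wact_nb\<close>, and the projection \<open>dmin J\<close> that
  comes from x_J, both drop out of the values of normal words.\<close>

lemma fold_dn_rw_full:
  assumes I: "I \<subseteq> S" and J: "J \<subseteq> S" and w: "w \<in> full I J" and u: "u \<in> carrier G"
  shows "fold dn (rw w) (dmin I u) = fold dn (rw w) u" "dmin J (fold dn (rw w) u) = fold dn (rw w) u"
proof -
  have wc: "w \<in> carrier G" using w by (simp add: full_def)
  note r = rw[OF wc]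
  have l: "rw w \<in> lists S" using reduced_lists[OF r(1)] .
  show "fold dn (rw w) (dmin I u) = fold dn (rw w) u"
  proof (rule invariant_dmin[OF I _ u])
    fix s v assume s: "s \<in> I" and v: "v \<in> carrier G"
    have sS: "s \<in> S" using s I by blast
    have z: "zcong (s # rw w) (rw w)" using zcong_left_absorb[OF r(1) sS] w s r(2) by (simp add: full_def)
    \<comment> \<open>The absorbed letter s acts first, and \<open>dn s\<close> does not distinguish
      v from sv.\<close>
    have e: "fold dn (rw w) x = fold dn (rw w) (dn s x)" if "x \<in> carrier G" for x
      using zcong_fold_dn[OF z _ that] sS l by simp
    have "s \<otimes> v \<in> carrier G" using sS v by simp
    from e[OF this] show "fold dn (rw w) (s \<otimes> v) = fold dn (rw w) v"
      unfolding dn_mult[OF sS v] e[OF v, symmetric] .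
  qed
  have c: "fold dn (rw w) u \<in> carrier G" using fold_dn_closed[OF l u] .
  have "\<not> len (s \<otimes> fold dn (rw w) u) < len (fold dn (rw w) u)" if s: "s \<in> J" for s
  proof -
    have sS: "s \<in> S" using s J by blast
    have z: "zcong (rw w @ [s]) (rw w)" using zcong_right_absorb[OF r(1) sS] w s r(2) by (simp add: full_def)
    have "dn s (fold dn (rw w) u) = fold dn (rw w) u"
      using zcong_fold_dn[OF z _ u] sS l by simp
    then show ?thesis using dn_nondescent[OF sS c] by simp
  qed
  then have "fold dn (rw w) u \<in> lmin J" using c by (simp add: lmin_def)
  then show "dmin J (fold dn (rw w) u) = fold dn (rw w) u" by (rule dmin_fix[OF J])
qed

lemma length_p_word [simp]: "length (p_word ws) = 2 * length ws"
  by (induction ws) auto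

text \<open>For fixed I and J the number of letters is a constant plus twice \<open>len w\<close>,
  so a longest word of this type has an element of maximal length. This lets independence compare
  words directly.\<close>

lemma length_nb: "w \<in> carrier G \<Longrightarrow> length (nb I (rw w) J) = 2 + length (Dw I) + 2 * len w + length (Uw J)"
  using rw[of w] by (simp add: nb_def reduced_def)

end


subsection \<open>The generators as endomorphisms\<close>

text \<open>Lifts of the generators to \<open>E\<^sub>q\<close>. The factor \<pi>(I)/\<pi>(J) of
  \<open>Down J I\<close> lies in R and becomes 1 at q = 0, so it is left out here.\<close>

primrec (in hecke_algebra) gval :: "'w gen \<Rightarrow> _" where
  "gval (Up I J) = component_map I J (\<lambda>a. a)"
| "gval (Down J I) = component_map J I (\<lambda>a. h_par J I \<otimes>\<^bsub>H\<^esub> a)"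
| "gval (One K) = component_map K K (\<lambda>a. a)"

context hecke_algebra
begin

definition coef :: "('w set \<Rightarrow> 'h) \<Rightarrow> 'w set \<Rightarrow> 'w \<Rightarrow> int" where
  "coef v K w = c0 (v K) w"

definition wval :: "'w gen list \<Rightarrow> _" where
  "wval ws = word_prod E\<^sub>q (map gval ws)"

definition fval :: "('w gen list \<Rightarrow>\<^sub>0 int) \<Rightarrow> _" where
  "fval = Eq.ext_mor wval"

lemma gval_closed: assumes "g \<in> gens" shows "gval g \<in> carrier E\<^sub>q"
  using assms
proof (cases rule: gens_E)
  case (1 I J)
  then show ?thesis using cov_D[OF 1(2)] inclusion_closed by simp
next
  case (2 I J)
  then show ?thesis using cov_D[OF 2(2)] h_par_map_closed by simp
next
  case (3 K)
  then show ?thesis using inclusion_closed by simp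
qed

lemma poincare_0: assumes "J \<in> \<Lambda>" shows "poly (poincare J) 0 = 1"
proof -
  have "poly (poincare J) 0 = (\<Sum>w\<in>W J. 0 ^ len w)" unfolding poincare_def by (simp add: poly_sum)
  also have "\<dots> = (\<Sum>w\<in>W J. if w = \<one> then 1 else 0)"
    using len_eq_0[OF W_closed[OF _ \<Lambda>_D(1)[OF assms]]] by (intro sum.cong) (auto simp: zero_power)
  also have "\<dots> = 1" using \<Lambda>_D(2)[OF assms] W_one by simp
  finally show ?thesis .
qed

lemma gen_value_iota: assumes "g \<in> gens" shows "gen_value g = iota (gval g)"
  using assms
proof (cases rule: gens_E)
  case (1 I J)
  then show ?thesis
    using RE_to_E0_tensor[OF R_one(1) _ R_one(2)] gval_closed[OF assms] by (simp add: u_RE_def)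
next
  case (2 I J)
  note cv = cov_D[OF 2(2)]
  have "R_to_Z (Fract (poincare I) (poincare J)) = 1"
    using R_to_Z_Fract[OF poincare_0[OF cv(2)]] poincare_0[OF cv(1)] by simp
  then show ?thesis
    using RE_to_E0_tensor[OF R_carrier_I[OF poincare_0[OF cv(2)]]] gval_closed[OF assms] 2(1)
    by (simp add: d_RE_def)
next
  case (3 K)
  then show ?thesis
    using RE_to_E0_tensor[OF R_one(1) _ R_one(2)] gval_closed[OF assms] by (simp add: one_RE_def)
qed

lemma component_map_apply: "v \<in> xH_sum \<Longrightarrow> K \<in> \<Lambda> \<Longrightarrow>
    component_map I J f v K = (if K = I then f (v J) else \<zero>\<^bsub>H\<^esub>)"
  by (simp add: component_map_def)

lemma c0_gval:
  assumes "g \<in> gens" "v \<in> xH_sum" "K \<in> \<Lambda>" "w \<in> carrier G"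
  shows "c0 (gval g v K) w = gact g (coef v) K w"
  using assms(1)
proof (cases rule: gens_E)
  case (1 I J)
  then show ?thesis using assms by (simp add: component_map_apply coef_def)
next
  case (2 I J)
  note cv = cov_D[OF 2(2)]
  show ?thesis
    using 2(1) assms c0_h_par_mult[OF cv(2,3,1) V_xH[OF assms(2) cv(1)] assms(4)]
    by (simp add: component_map_apply coef_def)
next
  case (3 K)
  then show ?thesis using assms by (simp add: component_map_apply coef_def)
qed

lemma wval_closed: "ws \<in> lists gens \<Longrightarrow> wval ws \<in> carrier E\<^sub>q"
  unfolding wval_def using gval_closed by (intro Eq.word_prod_closed) auto

lemma c0_wval:
  assumes "ws \<in> lists gens" "v \<in> xH_sum" "K \<in> \<Lambda>" "w \<in> carrier G"
  shows "c0 (wval ws v K) w = wact ws (coef v) K w"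
  using assms(1,3,4)
proof (induction ws arbitrary: K w)
  case Nil
  then show ?case using assms(2) by (simp add: wval_def Eq_one_apply coef_def)
next
  case (Cons g ws)
  have g: "g \<in> gens" and ws: "ws \<in> lists gens" using Cons by auto
  have "wval (g # ws) v = gval g (wval ws v)"
    using assms(2) by (simp add: wval_def Eq_mult_apply)
  then have "c0 (wval (g # ws) v K) w = gact g (coef (wval ws v)) K w"
    using c0_gval[OF g Eq_closed[OF wval_closed[OF ws] assms(2)] Cons.prems] by simp
  also have "\<dots> = gact g (wact ws (coef v)) K w"
  proof (rule gact_cong[OF g _ Cons.prems(2)])
    fix L u assume "L \<in> \<Lambda>" "u \<in> carrier G"
    then show "coef (wval ws v) L u = wact ws (coef v) L u"
      unfolding coef_def[of "wval ws v"] by (rule Cons.IH)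
  qed
  finally show ?case by simp
qed

lemma fval_hom: "ring_hom_ring (free_algebra gens) E\<^sub>q fval"
  unfolding free_algebra_def fval_def
proof (rule Eq.ext_mor_hom[OF word_monoid])
  fix us vs assume "us \<in> carrier \<lparr>carrier = lists gens, monoid.mult = (@), one = []\<rparr>"
    "vs \<in> carrier \<lparr>carrier = lists gens, monoid.mult = (@), one = []\<rparr>"
  then have *: "us \<in> lists gens" "vs \<in> lists gens" by simp_all
  show "wval us \<in> carrier E\<^sub>q" using wval_closed *(1) .
  show "wval (us \<otimes>\<^bsub>\<lparr>carrier = lists gens, monoid.mult = (@), one = []\<rparr>\<^esub> vs) = wval us \<otimes>\<^bsub>E\<^sub>q\<^esub> wval vs"
    unfolding wval_def using * gval_closed Eq.word_prod_append[of "map gval us" "map gval vs"] by auto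
qed (simp add: wval_def)

lemma fval_closed: "Poly_Mapping.keys f \<subseteq> lists gens \<Longrightarrow> fval f \<in> carrier E\<^sub>q"
  using ring_hom_closed[OF ring_hom_ring.homh[OF fval_hom]] by simp

lemma fval_of: "w \<in> lists gens \<Longrightarrow> fval (frag_of w) = wval w"
  unfolding fval_def by (rule Eq.ext_mor_of) (rule wval_closed)

lemma c0_fval:
  assumes f: "Poly_Mapping.keys f \<subseteq> lists gens" and v: "v \<in> xH_sum" "K \<in> \<Lambda>" "w \<in> carrier G"
  shows "c0 (fval f v K) w = fsum f (\<lambda>ws. wact ws (coef v) K w)"
proof -
  have "Poly_Mapping.keys f \<subseteq> lists gens \<and> c0 (fval f v K) w = fsum f (\<lambda>ws. wact ws (coef v) K w)"
    using f
  proof (induction f rule: frag_induction)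
    case zero
    then show ?case using v by (simp add: fval_def Eq_zero_apply)
  next
    case (one ws)
    then show ?case using c0_wval[OF one v] fval_of[OF one] by simp
  next
    case (diff a b)
    then have ab: "Poly_Mapping.keys a \<subseteq> lists gens" "Poly_Mapping.keys b \<subseteq> lists gens" by auto
    have "fval (a - b) = fval a \<ominus>\<^bsub>E\<^sub>q\<^esub> fval b"
      unfolding fval_def using ab wval_closed by (intro Eq.ext_mor_diff)
    then show ?case
      using Eq_minus_apply[OF fval_closed[OF ab(1)] fval_closed[OF ab(2)] v(1,2)] diff keys_diff_subset[OF ab]
      by (simp add: fsum_diff)
  qed
  then show ?thesis ..
qed

text \<open>Faithfulness of the action modulo q; the substance is the divisibility in
  \<open>Eq_q_divides\<close>.\<close>

lemma qE_iff:
  assumes "F \<in> carrier E\<^sub>q"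
  shows "F \<in> qE \<longleftrightarrow> (\<forall>v \<in> xH_sum. \<forall>K \<in> \<Lambda>. \<forall>w \<in> carrier G. c0 (F v K) w = 0)"
proof
  assume "F \<in> qE"
  then obtain F' where F': "F' \<in> carrier E\<^sub>q" "F = qq \<odot>\<^bsub>E\<^sub>q\<^esub> F'" unfolding qE_def by auto
  then show "\<forall>v \<in> xH_sum. \<forall>K \<in> \<Lambda>. \<forall>w \<in> carrier G. c0 (F v K) w = 0"
    by (simp add: Eq_smult_apply c0_smult)
next
  assume *: "\<forall>v \<in> xH_sum. \<forall>K \<in> \<Lambda>. \<forall>w \<in> carrier G. c0 (F v K) w = 0"
  have "c0 (F v K) w = 0" if "v \<in> xH_sum" "K \<in> \<Lambda>" for v K w
    using * that c0_outside[of "F v K" w] assms by (cases "w \<in> carrier G") auto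
  then show "F \<in> qE" using Eq_q_divides[OF assms] unfolding qE_def by blast
qed

lemma fval_qE:
  assumes "Poly_Mapping.keys f \<subseteq> lists gens"
  shows "fval f \<in> qE \<longleftrightarrow>
    (\<forall>v \<in> xH_sum. \<forall>K \<in> \<Lambda>. \<forall>w \<in> carrier G. fsum f (\<lambda>ws. wact ws (coef v) K w) = 0)"
  using qE_iff[OF fval_closed[OF assms]] c0_fval[OF assms] by simp

lemma rels_vanish:
  assumes fin: "finite \<Lambda>" and r: "(a, b) \<in> rels" shows "fval (a - b) \<in> qE"
proof -
  have ab: "Poly_Mapping.keys a \<subseteq> lists gens" "Poly_Mapping.keys b \<subseteq> lists gens"
    using rels_carrier[OF r] by simp_all
  have "fsum a (\<lambda>ws. wact ws (coef v) K w) = fsum b (\<lambda>ws. wact ws (coef v) K w)"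
    if v: "v \<in> xH_sum" and K: "K \<in> \<Lambda>" and w: "w \<in> carrier G" for v K w
  proof -
    have inv: "coef v J (dmin J u) = coef v J u" if "J \<in> \<Lambda>" "u \<in> carrier G" for J u
      unfolding coef_def using xH_invariant[OF that(1) V_xH[OF v that(1)] that(2)] .
    have DD: "dmin I (dmin J u) = dmin J u" if "I \<lessdot> J" "u \<in> carrier G" for I J u
      using dmin_dmin[OF cov_D(3)[OF that(1)] \<Lambda>_D(1)[OF cov_D(2)[OF that(1)]] that(2)] .
    show ?thesis
      using r unfolding rels_def
    proof (elim UnE, goal_cases)
      case 1
      then have ab: "a = frag_of []" "b = (\<Sum>I\<in>\<Lambda>. frag_of [One I])" by simp_all
      have "(\<Sum>I\<in>\<Lambda>. gact (One I) (coef v) K w) = (\<Sum>I\<in>\<Lambda>. if K = I then coef v I w else 0)"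
        by simp
      also have "\<dots> = coef v K w" using fin K by simp
      finally show ?case unfolding ab by (simp add: fsum_sum)
    next
      case 2
      then obtain I J where "a = frag_of [Down J I, Up I J]" "b = frag_of [One J]" by blast
      then show ?case using inv[OF K w] by (cases "K = J") simp_all
    next
      case 3
      then obtain I J J' L where "a = frag_of [Up I J, Up J L]" "b = frag_of [Up I J', Up J' L]" by blast
      then show ?case by simp
    next
      case 4
      then obtain I J J' L where "a = frag_of [Down L J, Down J I]" "b = frag_of [Down L J', Down J' I]"
        "J \<lessdot> L" "J' \<lessdot> L" by blast
      then show ?case using DD[OF \<open>J \<lessdot> L\<close> w] DD[OF \<open>J' \<lessdot> L\<close> w] by simp
    next
      case 5
      then obtain I Is ws where ud: "a = frag_of (up_word Is @ down_word Is)" "b = frag_of (p_word ws)"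
        "I \<in> \<Lambda>" "I \<noteq> {}" "ordering I Is" "associated_expr I Is ws" by blast
      have ws: "reduced ws" "wp ws = longest I" using ud(6) by (auto simp: associated_expr_def)
      \<comment> \<open>The empty word would act as the identity on every component, whereas the
        left side of the relation kills all components except that of the empty set.\<close>
      have ne: "ws \<noteq> []"
      proof
        assume "ws = []"
        then have "longest I = \<one>" using ws by simp
        moreover obtain s where "s \<in> I" using ud(4) by blast
        ultimately show False using longest_descents(1)[OF ud(3)] by fastforce
      qed
      show ?case
      proof (cases "K = {}")
        case True
        then show ?thesis
          using wact_up_word[OF ud(5)] wact_down_word[OF ud(5) w] wact_p_word[OF reduced_lists[OF ws(1)] w]
            fold_dn_longest[OF ud(3) ws w] unfolding ud(1,2) by simp
      next
        case False
        then show ?thesis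
          using wact_up_word_zero[OF ud(5,4)] wact_p_word_zero[OF ne] unfolding ud(1,2) by simp
      qed
    qed (auto)
  qed
  then show ?thesis using fval_qE[OF keys_diff_subset[OF ab]] by (simp add: fsum_diff)
qed


subsection \<open>The basis\<close>

abbreviation xgen :: "'w set \<Rightarrow> 'w set \<Rightarrow> 'h" where
  "xgen J \<equiv> vsingle J (x_par J)"

lemma xgen_closed: "J \<in> \<Lambda> \<Longrightarrow> xgen J \<in> xH_sum"
  using vsingle_closed x_par_in_xH \<Lambda>_D(1) by blast

lemma c0_x_par: assumes "J \<in> \<Lambda>" "u \<in> carrier G" shows "c0 (x_par J) u = (if dmin J u = \<one> then 1 else 0)"
proof -
  have "c0 (x_par J \<otimes>\<^bsub>H\<^esub> T \<one>) u = c0 (T \<one>) (dmin J u)"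
    using c0_x_par_mult[OF assms(1) T_closed assms(2)] by simp
  then show ?thesis using \<Lambda>_D(1)[OF assms(1)] by (simp add: c0_T) (simp add: T_one)
qed

lemma nb_value:
  assumes I: "I \<in> \<Lambda>" and J: "J \<in> \<Lambda>" and J': "J' \<in> \<Lambda>" and w: "w \<in> full I J" and u: "u \<in> carrier G"
  shows "wact (nb I (rw w) J) (coef (xgen J')) I' u =
    (if I' = I \<and> J' = J \<and> fold dn (rw w) u = \<one> then 1 else 0)"
proof -
  have wc: "w \<in> carrier G" using w by (simp add: full_def)
  have l: "rw w \<in> lists S" using reduced_lists[OF rw(1)[OF wc]] .
  note f = fold_dn_rw_full[OF \<Lambda>_D(1)[OF I] \<Lambda>_D(1)[OF J] w u]
  have c: "fold dn (rw w) u \<in> carrier G" using fold_dn_closed[OF l u] .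
  have cx: "coef (xgen J') J x = (if J' = J \<and> dmin J x = \<one> then 1 else 0)" if "x \<in> carrier G" for x
    using c0_x_par[OF J that] J by (auto simp: coef_def vsingle_def)
  then show ?thesis unfolding wact_nb[OF I J l u] f(1) cx[OF c] f(2) by simp
qed

text \<open>Among the keys of one type (I, J) take a longest one, with element w, and evaluate at
  x_J, in component I, at the point w. Keys of another type give 0. A key of the same type with
  value 1 has w in the interval below an element no longer than w, hence is the chosen key.\<close>

lemma nbs_independent:
  assumes g: "Poly_Mapping.keys g \<subseteq> nbs" and 0: "fval g \<in> qE" shows "g = 0"
proof (rule ccontr)
  assume "g \<noteq> 0"
  then obtain b0 where b0: "b0 \<in> Poly_Mapping.keys g" by (metis ex_in_conv keys_eq_empty)
  then obtain I J w0 where IJ: "I \<in> \<Lambda>" "J \<in> \<Lambda>" "w0 \<in> full I J" "b0 = nb I (rw w0) J"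
    using g unfolding nbs_def by blast
  let ?B = "{b \<in> Poly_Mapping.keys g. \<exists>w \<in> full I J. b = nb I (rw w) J}"
  have B: "finite ?B" "?B \<noteq> {}" using b0 IJ by auto
  obtain b where b: "b \<in> ?B" "\<And>c. c \<in> ?B \<Longrightarrow> length c \<le> length b"
  proof -
    have "Max (length ` ?B) \<in> length ` ?B"
      by (rule Max_in[OF finite_imageI[OF B(1)]]) (use B(2) in simp)
    then obtain b where b: "b \<in> ?B" "Max (length ` ?B) = length b" by (rule imageE)
    have "length c \<le> length b" if "c \<in> ?B" for c
      using Max_ge[OF finite_imageI[OF B(1)] imageI[OF that], of length] unfolding b(2) .
    then show thesis using that[OF b(1)] by blast
  qed
  then obtain w where w: "w \<in> full I J" "b = nb I (rw w) J" "b \<in> Poly_Mapping.keys g" by blast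
  have wc: "w \<in> carrier G" using w by (simp add: full_def)
  have val: "wact c (coef (xgen J)) I w = (if c = b then 1 else 0)" if c: "c \<in> Poly_Mapping.keys g" for c
  proof -
    obtain K L x where K: "K \<in> \<Lambda>" "L \<in> \<Lambda>" "x \<in> full K L" "c = nb K (rw x) L"
      using g c unfolding nbs_def by blast
    have xc: "x \<in> carrier G" using K by (simp add: full_def)
    have v: "wact c (coef (xgen J)) I w = (if I = K \<and> J = L \<and> fold dn (rw x) w = \<one> then 1 else 0)"
      unfolding K(4) using nb_value[OF K(1,2) IJ(2) K(3) wc] .
    show ?thesis
    proof (cases "c = b")
      case True
      have "wact b (coef (xgen J)) I w = (if fold dn (rw w) w = \<one> then 1 else 0)"
        unfolding w(2) using nb_value[OF IJ(1,2,2) w(1) wc] by simp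
      moreover have "fold dn (rw w) w = \<one>" using fold_dn_reduced[OF rw(1)[OF wc]] rw(2)[OF wc] by simp
      ultimately show ?thesis using True by simp
    next
      case False
      have "\<not> (I = K \<and> J = L \<and> fold dn (rw x) w = \<one>)"
      proof
        assume a: "I = K \<and> J = L \<and> fold dn (rw x) w = \<one>"
        then have "c \<in> ?B" using c K by auto
        then have "length c \<le> length b" by (rule b(2))
        then have "len x \<le> len w" using a length_nb[OF xc] length_nb[OF wc] K(4) w(2) by simp
        moreover have "length (rw x) = len x" using rw[OF xc] by (simp add: reduced_def)
        ultimately have "w = wp (rw x)"
          using fold_dn_one[OF reduced_lists[OF rw(1)[OF xc]] wc] a by simp
        then have "w = x" using rw(2)[OF xc] by simp
        then show False using False a K(4) w(2) by simp
      qed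
      then show ?thesis using v False by auto
    qed
  qed
  have "Poly_Mapping.keys g \<subseteq> lists gens" using g nbs_gens by blast
  then have "fsum g (\<lambda>ws. wact ws (coef (xgen J)) I w) = 0"
    using fval_qE 0 xgen_closed[OF IJ(2)] IJ(1) wc by blast
  also have "fsum g (\<lambda>ws. wact ws (coef (xgen J)) I w) =
      (\<Sum>c\<in>Poly_Mapping.keys g. if c = b then Poly_Mapping.lookup g b else 0)"
    unfolding fsum_def using val by (intro sum.cong) auto
  finally show False using w(3) by (simp add: in_keys_iff)
qed

text \<open>Peels off the top layer of the support. Its elements are full: by invariance under I and
  J a longer neighbour sw or ws would lie in the support too. From length n on, the function of a
  basis word of layer n is 1 at its own element and 0 elsewhere, so subtracting these words lowers
  the bound.\<close>

lemma component_span: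
  assumes I: "I \<in> \<Lambda>" and J: "J \<in> \<Lambda>" and "F \<in> carrier E\<^sub>q"
    and "\<And>u. u \<in> carrier G \<Longrightarrow> n \<le> len u \<Longrightarrow> c0 (F (xgen J) I) u = 0"
  shows "\<exists>f. Poly_Mapping.keys f \<subseteq> {nb I (rw w) J | w. w \<in> full I J} \<and>
    (\<forall>u \<in> carrier G. c0 (F (xgen J) I) u = fsum f (\<lambda>ws. wact ws (coef (xgen J)) I u))"
  using assms(3,4)
proof (induction n arbitrary: F)
  case 0
  then show ?case by (intro exI[of _ 0]) simp
next
  case (Suc n)
  note F = Suc.prems(1)
  have v: "xgen J \<in> xH_sum" using xgen_closed[OF J] .
  have Fc: "F (xgen J) I \<in> carrier H" using F v I by simp
  let ?c = "c0 (F (xgen J) I)"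
  let ?A = "{w. ?c w \<noteq> 0 \<and> len w = n}"
  have fin: "finite ?A" using c0_finite[OF Fc] by (rule rev_finite_subset) auto
  have Af: "w \<in> full I J" if w: "w \<in> ?A" for w
  proof -
    have wc: "w \<in> carrier G" using w c0_outside[OF Fc, of w] by auto
    have "len (s \<otimes> w) < len w" if s: "s \<in> I" for s
    proof (rule ccontr)
      have sS: "s \<in> S" using s \<Lambda>_D(1)[OF I] by blast
      assume "\<not> len (s \<otimes> w) < len w"
      then have "len (s \<otimes> w) = Suc n" using len_up[OF sS wc] w by simp
      then have "?c (s \<otimes> w) = 0" using Suc.prems(2)[of "s \<otimes> w"] sS wc by simp
      then show False using Eq_left_invariant[OF F v I s wc] w by simp
    qed
    moreover have "len (w \<otimes> s) < len w" if s: "s \<in> J" for s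
    proof (rule ccontr)
      have sS: "s \<in> S" using s \<Lambda>_D(1)[OF J] by blast
      assume "\<not> len (w \<otimes> s) < len w"
      then have "len (w \<otimes> s) = Suc n" using len_right_cases[OF sS wc] w by auto
      then have "?c (w \<otimes> s) = 0" using Suc.prems(2)[of "w \<otimes> s"] sS wc by simp
      then show False using Eq_right_invariant[OF F J I s wc] w by simp
    qed
    ultimately show ?thesis using wc by (simp add: full_def)
  qed
  let ?N = "{nb I (rw w) J | w. w \<in> full I J}"
  let ?f = "\<Sum>w\<in>?A. frag_cmul (?c w) (frag_of (nb I (rw w) J))"
  have fN: "Poly_Mapping.keys ?f \<subseteq> ?N"
  proof -
    have "Poly_Mapping.keys ?f \<subseteq> (\<Union>w\<in>?A. Poly_Mapping.keys (frag_cmul (?c w) (frag_of (nb I (rw w) J))))"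
      by (rule keys_sum)
    also have "\<dots> \<subseteq> ?N" using Af by auto
    finally show ?thesis .
  qed
  have Ng: "?N \<subseteq> lists gens" using nbs_gens I J unfolding nbs_def by blast
  then have fg: "Poly_Mapping.keys ?f \<subseteq> lists gens" using fN by blast
  let ?F = "F \<ominus>\<^bsub>E\<^sub>q\<^esub> fval ?f"
  have F': "?F \<in> carrier E\<^sub>q" using F fval_closed[OF fg] by simp
  have c': "c0 (?F (xgen J) I) u = ?c u - fsum ?f (\<lambda>ws. wact ws (coef (xgen J)) I u)"
    if "u \<in> carrier G" for u
    using Eq_minus_apply[OF F fval_closed[OF fg] v I] c0_fval[OF fg v I that] by simp
  have "c0 (?F (xgen J) I) u = 0" if u: "u \<in> carrier G" "n \<le> len u" for u
  proof -
    have "fsum ?f (\<lambda>ws. wact ws (coef (xgen J)) I u) =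
        (\<Sum>w\<in>?A. ?c w * wact (nb I (rw w) J) (coef (xgen J)) I u)"
      by (simp add: fsum_sum fsum_cmul)
    also have "\<dots> = (\<Sum>w\<in>?A. if w = u then ?c u else 0)"
    proof (intro sum.cong HOL.refl)
      fix w assume w: "w \<in> ?A"
      have wc: "w \<in> carrier G" using Af[OF w] by (simp add: full_def)
      have l: "length (rw w) = n" using rw[OF wc] w by (simp add: reduced_def)
      have "fold dn (rw w) u = \<one> \<longleftrightarrow> w = u"
        using fold_dn_one[OF reduced_lists[OF rw(1)[OF wc]] u(1)] fold_dn_reduced[OF rw(1)[OF wc]]
          rw(2)[OF wc] l u(2) by auto
      then show "?c w * wact (nb I (rw w) J) (coef (xgen J)) I u = (if w = u then ?c u else 0)"
        using nb_value[OF I J J Af[OF w] u(1)] by simp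
    qed
    also have "\<dots> = (if u \<in> ?A then ?c u else 0)" using fin by simp
    also have "\<dots> = ?c u"
      using Suc.prems(2)[OF u(1)] u(2) by (cases "len u = n") auto
    finally show ?thesis using c'[OF u(1)] by simp
  qed
  from Suc.IH[OF F' this] obtain f where f: "Poly_Mapping.keys f \<subseteq> ?N"
    "\<forall>u \<in> carrier G. c0 (?F (xgen J) I) u = fsum f (\<lambda>ws. wact ws (coef (xgen J)) I u)" by blast
  have "\<forall>u \<in> carrier G. ?c u = fsum (?f + f) (\<lambda>ws. wact ws (coef (xgen J)) I u)"
  proof
    fix u assume u: "u \<in> carrier G"
    show "?c u = fsum (?f + f) (\<lambda>ws. wact ws (coef (xgen J)) I u)"
      using c'[OF u] bspec[OF f(2) u] unfolding fsum_add by linarith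
  qed
  then show ?case using keys_add_subset[OF fN f(1)] by blast
qed

lemma fval_spans:
  assumes fin: "finite \<Lambda>" and F: "F \<in> carrier E\<^sub>q"
  shows "\<exists>f. Poly_Mapping.keys f \<subseteq> lists gens \<and> F \<ominus>\<^bsub>E\<^sub>q\<^esub> fval f \<in> qE"
proof -
  let ?N = "\<lambda>I J. {nb I (rw w) J | w. w \<in> full I J}"
  let ?P = "\<lambda>I J f. Poly_Mapping.keys f \<subseteq> ?N I J \<and>
    (\<forall>u \<in> carrier G. c0 (F (xgen J) I) u = fsum f (\<lambda>ws. wact ws (coef (xgen J)) I u))"
  have ex: "\<exists>f. ?P I J f"
    if I: "I \<in> \<Lambda>" and J: "J \<in> \<Lambda>" for I J
  proof -
    have Fc: "F (xgen J) I \<in> carrier H" using F xgen_closed[OF J] I by simp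
    let ?A = "{w. c0 (F (xgen J) I) w \<noteq> 0}"
    have "c0 (F (xgen J) I) u = 0" if "Suc (Max (len ` ?A)) \<le> len u" for u
    proof (rule ccontr)
      assume "\<not> ?thesis"
      then have "len u \<le> Max (len ` ?A)" using c0_finite[OF Fc] by (intro Max_ge) auto
      then show False using that by simp
    qed
    then show ?thesis using component_span[OF I J F] by blast
  qed
  define f where "f I J = (SOME f. ?P I J f)" for I J
  have P: "?P I J (f I J)" if "I \<in> \<Lambda>" "J \<in> \<Lambda>" for I J
    using someI_ex[OF ex[OF that]] unfolding f_def .
  have f: "Poly_Mapping.keys (f I J) \<subseteq> ?N I J"
    "u \<in> carrier G \<Longrightarrow> c0 (F (xgen J) I) u = fsum (f I J) (\<lambda>ws. wact ws (coef (xgen J)) I u)"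
    if "I \<in> \<Lambda>" "J \<in> \<Lambda>" for I J u
    using conjunct1[OF P[OF that]] bspec[OF conjunct2[OF P[OF that]]] by blast+
  let ?f = "\<Sum>I\<in>\<Lambda>. \<Sum>J\<in>\<Lambda>. f I J"
  have Ng: "?N I J \<subseteq> lists gens" if "I \<in> \<Lambda>" "J \<in> \<Lambda>" for I J
    using nbs_gens that unfolding nbs_def by blast
  have fg: "Poly_Mapping.keys ?f \<subseteq> lists gens"
  proof -
    have "Poly_Mapping.keys ?f \<subseteq> (\<Union>I\<in>\<Lambda>. Poly_Mapping.keys (\<Sum>J\<in>\<Lambda>. f I J))" by (rule keys_sum)
    also have "\<dots> \<subseteq> (\<Union>I\<in>\<Lambda>. \<Union>J\<in>\<Lambda>. Poly_Mapping.keys (f I J))" by (intro UN_mono keys_sum) auto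
    also have "\<dots> \<subseteq> lists gens" using f(1) Ng by blast
    finally show ?thesis .
  qed
  let ?F = "F \<ominus>\<^bsub>E\<^sub>q\<^esub> fval ?f"
  have F': "?F \<in> carrier E\<^sub>q" using F fval_closed[OF fg] by simp
  have "c0 (?F (xgen J) I) u = 0" if J: "J \<in> \<Lambda>" and I: "I \<in> \<Lambda>" for I J u
  proof (cases "u \<in> carrier G")
    case True
    let ?h = "\<lambda>ws. wact ws (coef (xgen J)) I u"
    \<comment> \<open>Words of type (K, L) affect only component K of the value at x_L, so the
      solutions for the individual pairs do not interfere and can be added up.\<close>
    have z: "fsum (f K L) ?h = (if K = I \<and> L = J then fsum (f I J) ?h else 0)"
      if "K \<in> \<Lambda>" "L \<in> \<Lambda>" for K L
    proof (cases "K = I \<and> L = J")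
      case False
      have "?h b = 0" if bk: "b \<in> Poly_Mapping.keys (f K L)" for b
      proof -
        obtain w where "w \<in> full K L" "b = nb K (rw w) L" using f(1)[OF \<open>K \<in> \<Lambda>\<close> \<open>L \<in> \<Lambda>\<close>] bk by blast
        then show ?thesis using nb_value[OF \<open>K \<in> \<Lambda>\<close> \<open>L \<in> \<Lambda>\<close> J _ True] False by auto
      qed
      then show ?thesis using False by (auto simp: fsum_def)
    qed simp
    have "fsum ?f ?h = (\<Sum>K\<in>\<Lambda>. \<Sum>L\<in>\<Lambda>. if K = I \<and> L = J then fsum (f I J) ?h else 0)"
      unfolding fsum_sum using z by (intro sum.cong) auto
    also have "\<dots> = (\<Sum>K\<in>\<Lambda>. if K = I then fsum (f I J) ?h else 0)"
      using fin J by (intro sum.cong) auto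
    also have "\<dots> = fsum (f I J) ?h" using fin I by simp
    finally have "fsum ?f ?h = c0 (F (xgen J) I) u" using f(2)[OF I J True] by simp
    then show ?thesis
      using Eq_minus_apply[OF F fval_closed[OF fg] xgen_closed[OF J] I] c0_fval[OF fg xgen_closed[OF J] I True]
      by simp
  next
    case False
    then show ?thesis using c0_outside[of "?F (xgen J) I"] F' xgen_closed[OF J] I by simp
  qed
  then have "?F \<in> qE" using Eq_determined[OF fin F'] qE_iff[OF F'] by blast
  then show ?thesis using fg by blast
qed

section \<open>The presentation\<close>

theorem E0_presented: assumes fin: "finite \<Lambda>" shows "presented_by E\<^sub>0 gens gen_value rels"
proof -
  let ?h = "iota \<circ> fval"
  interpret FA: ring "free_algebra gens" by (rule free_algebra_ring)
  interpret i: ring_hom_ring E\<^sub>q E\<^sub>0 iota by (rule iota_hom)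
  interpret f: ring_hom_ring "free_algebra gens" E\<^sub>q fval by (rule fval_hom)
  have h: "ring_hom_ring (free_algebra gens) E\<^sub>0 ?h"
    using ring_hom_trans[OF f.homh i.homh] by (intro ring_hom_ringI2 FA.ring_axioms E0_ring)
  interpret h: ring_hom_ring "free_algebra gens" E\<^sub>0 ?h by (rule h)
  have ker: "f \<in> a_kernel (free_algebra gens) E\<^sub>0 ?h \<longleftrightarrow> Poly_Mapping.keys f \<subseteq> lists gens \<and> fval f \<in> qE" for f
  proof (cases "Poly_Mapping.keys f \<subseteq> lists gens")
    case True
    then have "f \<in> carrier (free_algebra gens)" unfolding free_algebra_simps mem_Collect_eq .
    then show ?thesis unfolding a_kernel_def kernel_def using iota_kernel[OF fval_closed[OF True]] True by simp
  next
    case False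
    then have "f \<notin> carrier (free_algebra gens)" unfolding free_algebra_simps mem_Collect_eq .
    then show ?thesis unfolding a_kernel_def kernel_def using False by (simp del: free_algebra_simps)
  qed
  have kid: "ideal (a_kernel (free_algebra gens) E\<^sub>0 ?h) (free_algebra gens)" by (rule h.kernel_is_ideal)
  have sub: "relI \<subseteq> a_kernel (free_algebra gens) E\<^sub>0 ?h"
  proof (rule relI_minimal[OF kid])
    fix a b assume r: "(a, b) \<in> rels"
    show "a - b \<in> a_kernel (free_algebra gens) E\<^sub>0 ?h"
      unfolding ker
      by (intro conjI rels_vanish[OF fin r] keys_diff_subset) (use rels_carrier[OF r] in simp_all)
  qed
  have kernel: "a_kernel (free_algebra gens) E\<^sub>0 ?h = relI"
  proof (rule equalityI[OF _ sub], rule subsetI)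
    fix f assume f: "f \<in> a_kernel (free_algebra gens) E\<^sub>0 ?h"
    then have fg: "Poly_Mapping.keys f \<subseteq> lists gens" using ker by blast
    obtain g where g: "Poly_Mapping.keys g \<subseteq> nbs" "f - g \<in> relI"
      using normal_form[OF fin fg] unfolding spanned_def by blast
    \<comment> \<open>The normal form g differs from f by an element of the ideal of relations, so
      it lies in the kernel as well, and independence forces it to be 0.\<close>
    have "f - (f - g) \<in> a_kernel (free_algebra gens) E\<^sub>0 ?h"
      using free_algebra_ideal_diff[OF kid f] g(2) sub by blast
    then have "fval g \<in> qE" using ker[of g] by simp
    then have "g = 0" using nbs_independent g(1) by blast
    then show "f \<in> relI" using g(2) by simp
  qed
  have surj: "?h ` carrier (free_algebra gens) = carrier E\<^sub>0"
  proof
    show "?h ` carrier (free_algebra gens) \<subseteq> carrier E\<^sub>0" using h.hom_closed by blast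
    show "carrier E\<^sub>0 \<subseteq> ?h ` carrier (free_algebra gens)"
    proof
      fix x assume "x \<in> carrier E\<^sub>0"
      then obtain F where F: "F \<in> carrier E\<^sub>q" "x = iota F" using iota_surj by blast
      obtain f where f: "Poly_Mapping.keys f \<subseteq> lists gens" "F \<ominus>\<^bsub>E\<^sub>q\<^esub> fval f \<in> qE"
        using fval_spans[OF fin F(1)] by blast
      have fc: "fval f \<in> carrier E\<^sub>q" using fval_closed[OF f(1)] .
      have "iota (F \<ominus>\<^bsub>E\<^sub>q\<^esub> fval f) = \<zero>\<^bsub>E\<^sub>0\<^esub>" using iota_kernel f(2) F(1) fc by simp
      then have "iota F \<ominus>\<^bsub>E\<^sub>0\<^esub> iota (fval f) = \<zero>\<^bsub>E\<^sub>0\<^esub>" using F(1) fc by (simp add: a_minus_def)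
      then have "iota F = iota (fval f)" using F(1) fc by simp
      then show "x \<in> ?h ` carrier (free_algebra gens)" using F(2) f(1) by auto
    qed
  qed
  let ?\<Phi> = "\<lambda>X. the_elem (?h ` X)"
  have iso: "?\<Phi> \<in> ring_iso (free_algebra gens Quot relI) E\<^sub>0"
    using h.FactRing_iso_set[OF surj] unfolding kernel .
  have val: "?\<Phi> (relI +>\<^bsub>free_algebra gens\<^esub> frag_of [x]) = gen_value x" if x: "x \<in> gens" for x
  proof -
    have w: "[x] \<in> lists gens" using x by simp
    have "?\<Phi> (relI +>\<^bsub>free_algebra gens\<^esub> frag_of [x]) = ?h (frag_of [x])"
      using h.the_elem_simp[of "frag_of [x]"] w unfolding kernel by simp
    also have "\<dots> = iota (wval [x])" using fval_of[OF w] by simp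
    also have "wval [x] = gval x" unfolding wval_def using gval_closed[OF x] by simp
    finally show ?thesis using gen_value_iota[OF x] by simp
  qed
  show ?thesis unfolding presented_by_def Let_def relI_def[symmetric]
  proof (rule bexI[OF _ iso], rule ballI)
    show "?\<Phi> (relI +>\<^bsub>free_algebra gens\<^esub> frag_of [x]) = gen_value x" if "x \<in> gens" for x
      using val[OF that] .
  qed
qed

end

theorem theorem6p5:
  fixes G :: "('w, 'm) monoid_scheme" and S :: "'w set"
    and H :: "(int poly, 'h) module" and T :: "'w \<Rightarrow> 'h"
  assumes "coxeter_system G S"
    and "finite S"
    and "hecke_algebra G S H T"
  shows "presented_by (hecke_algebra.E\<^sub>0 G S H T)
    (coxeter_system.gens G S)
    (hecke_algebra.gen_value G S H T)
    (coxeter_system.rels G S)"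
proof (rule hecke_algebra.E0_presented[OF assms(3)])
  have "coxeter_system.\<Lambda> G S \<subseteq> Pow S" unfolding coxeter_system.\<Lambda>_def[OF assms(1)] by blast
  then show "finite (coxeter_system.\<Lambda> G S)" using assms(2) finite_subset by blast
qed

end
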